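(* Let $\mathcal{T}_1$ and $\mathcal{T}_2$ be two self-similar tilings of $\mathbb{R}^d$ satisfying the finite pattern condition, with $S_1(\mathcal{T}_1)=\mathcal{T}_1$ and $S_2(\mathcal{T}_2)=\mathcal{T}_2$, where $S_1$ and $S_2$ are primitive substitutions (each defined by a similarity of $\mathbb{R}^d$), and with $\Omega_{\mathcal{T}_i}=X_{S_i}$ for $i\in\{1,2\}$. Let $\lambda_1$ and $\lambda_2$ be the Perron eigenvalues of the substitution matrices associated to $S_1$ and $S_2$ respectively. If there exist a non periodic tiling $\mathcal{T}$ of $\mathbb{R}^d$ and factor maps $\pi_i:\Omega_{\mathcal{T}_i}\to\Omega_{\mathcal{T}}$ for $i\in\{1,2\}$, then $\lambda_1$ and $\lambda_2$ are multiplicatively dependent, i.e. there exist positive integers $n,m$ with $\lambda_1^{n}=\lambda_2^{m}$.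
   Context: Tilings. A tiling of $\mathbb{R}^d$ is a countable collection of closed sets (tiles), each homeomorphic to a closed ball, whose union is $\mathbb{R}^d$ and whose interiors are pairwise disjoint, and which belong up to translation to a finite collection of sets called prototiles. Prototiles may carry labels; two tiles are equivalent if they are translates of each other (with the same label). $\mathrm{supp}(t)$ is the closed set underlying a tile $t$. A patch is a finite collection of tiles; its support is the union of the supports of its tiles. For $v\in\mathbb{R}^d$, $\mathcal{T}+v$ is the tiling obtained by translating every tile of $\mathcal{T}$ by $-v$. $\mathcal{T}$ is non periodic if $\mathcal{T}+v=\mathcal{T}$ implies $v=0$. $\mathcal{T}$ satisfies the finite pattern condition (FPC) if for every $r>0$ there are, up to translation, only finitely many patches in $\mathcal{T}$ of diameter smaller than $r$. Tiling spaces. For a finite set $\mathcal{A}$ of prototiles, $T(\mathcal{A})$ is the set of all tilings of $\mathbb{R}^d$ by translates of elements of $\mathcal{A}$. For $A\subseteq\mathbb{R}^d$, $\mathcal{T}\cap A=\{t\cap A: t\in\mathcal{T}\}$ (labels kept). $B_r(v)$ is the open ball. $T(\mathcal{A})$ carries the metric: $d(\mathcal{T},\mathcal{T}')$ is the infimum of the $\varepsilon\in(0,1)$ for which there are $v,v'\in B_\varepsilon(0)$ with $(\mathcal{T}+v)\cap B_{1/\varepsilon}(0)=(\mathcal{T}'+v')\cap B_{1/\varepsilon}(0)$, and $d(\mathcal{T},\mathcal{T}')=1$ if there is no such $\varepsilon$. $\Omega_{\mathcal{T}}=\overline{\{\mathcal{T}+v:v\in\mathbb{R}^d\}}$ is the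 orbit closure. A factor map $\pi:\Omega_1\to\Omega_2$ between translation-invariant closed sets of tilings is a continuous surjective map with $\pi(\mathcal{T}+v)=\pi(\mathcal{T})+v$ for all $\mathcal{T}\in\Omega_1$, $v\in\mathbb{R}^d$. Substitutions. A similarity is a linear map $M$ on $\mathbb{R}^d$ with $\|Mv\|=\lambda\|v\|$ for all $v$, for some constant $\lambda>1$. A substitution (defined by $M$) on a finite prototile set $\mathcal{A}$ assigns to each $p\in\mathcal{A}$ a patch $S(p)$, consisting of translates of elements of $\mathcal{A}$ with pairwise disjoint interiors, whose support is $M\,\mathrm{supp}(p)$. It extends to tiles: if $t$ is the translate of $p$ with $\mathrm{supp}(t)=\mathrm{supp}(p)+v$ (ordinary translation of sets), then $S(t)$ is $S(p)$ translated by $Mv$; and to tilings by $S(\mathcal{T})=\bigcup_{t\in\mathcal{T}}S(t)$. The substitution matrix $A$ has entry $A_{p,q}$ equal to the number of tiles of $S(p)$ equivalent to $q$. $S$ is primitive if $A^k>0$ entrywise for some $k>0$. A self-similar tiling is a tiling satisfying the FPC that is a fixed point $S(\mathcal{T})=\mathcal{T}$ of a substitution defined by a similarity. $X_S$ is the set of tilings in $T(\mathcal{A})$ each of whose patches is contained, up to translation, in $S^k(p)$ for some $p\in\mathcal{A}$ and $k>0$. *)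

theory Defs
  imports "HOL-Analysis.Analysis" "Jordan_Normal_Form.Char_Poly"
begin

section \<open>Tiles and tilings\<close>

text \<open>A tile is a pair of a label and a subset of \<open>real ^ 'n\<close>, its support. Unlabelled tiles are
  the case of a constant label.\<close>

type_synonym ('l, 'n) tile = "'l \<times> (real ^ 'n) set"

abbreviation supp :: "('l, 'n::finite) tile \<Rightarrow> (real ^ 'n) set" where
  "supp t \<equiv> snd t"

definition is_tile :: "('l, 'n::finite) tile \<Rightarrow> bool" where
  "is_tile t \<longleftrightarrow> closed (supp t) \<and> supp t homeomorphic (cball 0 1 :: (real ^ 'n) set)"

definition translate_tile :: "real ^ 'n \<Rightarrow> ('l, 'n::finite) tile \<Rightarrow> ('l, 'n) tile" where
  "translate_tile v t = (fst t, (\<lambda>x. x + v) ` supp t)"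

definition tile_equiv :: "('l, 'n::finite) tile \<Rightarrow> ('l, 'n) tile \<Rightarrow> bool" where
  "tile_equiv t t' \<longleftrightarrow> (\<exists>v. t' = translate_tile v t)"

definition disjoint_interiors :: "('l, 'n::finite) tile set \<Rightarrow> bool" where
  "disjoint_interiors P \<longleftrightarrow>
     (\<forall>t\<in>P. \<forall>t'\<in>P. t \<noteq> t' \<longrightarrow> interior (supp t) \<inter> interior (supp t') = {})"

definition tiles_support :: "('l, 'n::finite) tile set \<Rightarrow> (real ^ 'n) set" where
  "tiles_support P = (\<Union>t\<in>P. supp t)"

definition prototile_set :: "('l, 'n::finite) tile set \<Rightarrow> bool" where
  "prototile_set \<A> \<longleftrightarrow> finite \<A> \<and> (\<forall>p\<in>\<A>. is_tile p)"

definition is_tiling :: "('l, 'n::finite) tile set \<Rightarrow> bool" where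
  "is_tiling T \<longleftrightarrow>
     countable T \<and> (\<forall>t\<in>T. is_tile t) \<and>
     tiles_support T = UNIV \<and> disjoint_interiors T \<and>
     (\<exists>\<A>. prototile_set \<A> \<and> (\<forall>t\<in>T. \<exists>p\<in>\<A>. tile_equiv p t))"

definition tiling_space :: "('l, 'n::finite) tile set \<Rightarrow> ('l, 'n) tile set set" where
  "tiling_space \<A> = {T. is_tiling T \<and> (\<forall>t\<in>T. \<exists>p\<in>\<A>. tile_equiv p t)}"

text \<open>The tiling usually written \<open>T + v\<close>: every tile is moved by \<open>- v\<close>, so that the
  origin of the shifted tiling is the point \<open>v\<close> of the original one.\<close>

definition shift :: "real ^ 'n \<Rightarrow> ('l, 'n::finite) tile set \<Rightarrow> ('l, 'n) tile set" where
  "shift v T = translate_tile (- v) ` T"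

definition non_periodic :: "('l, 'n::finite) tile set \<Rightarrow> bool" where
  "non_periodic T \<longleftrightarrow> (\<forall>v. shift v T = T \<longrightarrow> v = 0)"

definition finite_pattern_condition :: "('l, 'n::finite) tile set \<Rightarrow> bool" where
  "finite_pattern_condition T \<longleftrightarrow>
     (\<forall>r>0. \<exists>F. finite F \<and>
        (\<forall>P. P \<subseteq> T \<and> finite P \<and> diameter (tiles_support P) < r \<longrightarrow>
             (\<exists>Q\<in>F. \<exists>v. P = translate_tile v ` Q)))"

section \<open>Spaces of tilings\<close>

subsection \<open>The tiling distance\<close>

text \<open>Only nonempty intersections are kept: otherwise every tile missing \<open>B\<close> would
  contribute its label, paired with the empty set, and labels occurring only far
  away from \<open>B\<close> would be visible.\<close>

definition tiling_restrict ::
    "('l, 'n::finite) tile set \<Rightarrow> (real ^ 'n) set \<Rightarrow> ('l, 'n) tile set" where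
  "tiling_restrict T B = {(fst t, supp t \<inter> B) |t. t \<in> T \<and> supp t \<inter> B \<noteq> {}}"

definition agreement_radii ::
    "('l, 'n::finite) tile set \<Rightarrow> ('l, 'n) tile set \<Rightarrow> real set" where
  "agreement_radii T T' =
     {\<epsilon>. 0 < \<epsilon> \<and> \<epsilon> < 1 \<and>
        (\<exists>v\<in>ball 0 \<epsilon>. \<exists>v'\<in>ball 0 \<epsilon>.
           tiling_restrict (shift v T) (ball 0 (1 / \<epsilon>)) =
           tiling_restrict (shift v' T') (ball 0 (1 / \<epsilon>)))}"

definition tiling_dist :: "('l, 'n::finite) tile set \<Rightarrow> ('l, 'n) tile set \<Rightarrow> real" where
  "tiling_dist T T' =
     (if agreement_radii T T' = {} then 1 else Inf (agreement_radii T T'))"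

subsection \<open>The tiling distance is a metric\<close>

lemma translate_tile_0 [simp]: "translate_tile 0 t = t"
  by (simp add: translate_tile_def)

lemma translate_translate_tile [simp]:
  "translate_tile v (translate_tile w t) = translate_tile (w + v) t"
  by (simp add: translate_tile_def image_image add.assoc)

lemma shift_0 [simp]: "shift 0 T = T"
  by (simp add: shift_def)

lemma shift_shift [simp]: "shift v (shift w T) = shift (v + w) T"
  by (simp add: shift_def image_image add.commute)

lemma tiling_restrict_restrict:
  fixes T :: "('l, 'n::finite) tile set"
  assumes "B' \<subseteq> B"
  shows "tiling_restrict (tiling_restrict T B) B' = tiling_restrict T B'"
proof -
  have *: "supp t \<inter> B \<inter> B' = supp t \<inter> B'" for t :: "('l, 'n) tile"
    using assms by blast
  show ?thesis
  proof (intro equalityI subsetI)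
    fix u assume "u \<in> tiling_restrict (tiling_restrict T B) B'"
    then obtain t where t: "t \<in> tiling_restrict T B" "supp t \<inter> B' \<noteq> {}" "u = (fst t, supp t \<inter> B')"
      unfolding tiling_restrict_def by blast
    then obtain r where r: "r \<in> T" "t = (fst r, supp r \<inter> B)"
      unfolding tiling_restrict_def by blast
    have "fst t = fst r" "supp t = supp r \<inter> B"
      using r(2) by (metis fst_conv, metis snd_conv)
    then have "u = (fst r, supp r \<inter> B')" "supp r \<inter> B' \<noteq> {}"
      using t(2,3) * by simp_all
    then show "u \<in> tiling_restrict T B'"
      using r(1) unfolding tiling_restrict_def by blast
  next
    fix u assume "u \<in> tiling_restrict T B'"
    then obtain r where r: "r \<in> T" "supp r \<inter> B' \<noteq> {}" "u = (fst r, supp r \<inter> B')"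
      unfolding tiling_restrict_def by blast
    define t where "t = (fst r, supp r \<inter> B)"
    have "t \<in> tiling_restrict T B"
      using r assms unfolding tiling_restrict_def t_def by blast
    moreover have "u = (fst t, supp t \<inter> B')" "supp t \<inter> B' \<noteq> {}"
      using r * by (simp_all add: t_def)
    ultimately show "u \<in> tiling_restrict (tiling_restrict T B) B'"
      unfolding tiling_restrict_def by blast
  qed
qed

lemma tiling_restrict_shift:
  fixes T :: "('l, 'n::finite) tile set"
  shows "tiling_restrict (shift v T) B = shift v (tiling_restrict T ((\<lambda>x. x + v) ` B))"
proof -
  let ?C = "(\<lambda>x. x + v) ` B" and ?f = "translate_tile (- v)"
  have image: "tiling_restrict X D = (\<lambda>t. (fst t, supp t \<inter> D)) ` {t \<in> X. supp t \<inter> D \<noteq> {}}"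
    for X :: "('l, 'n) tile set" and D
    unfolding tiling_restrict_def by blast
  have supp: "supp (?f t) \<inter> B = (\<lambda>x. x - v) ` (supp t \<inter> ?C)" for t :: "('l, 'n) tile"
    by (force simp: translate_tile_def image_iff)
  have eq: "(fst (?f t), supp (?f t) \<inter> B) = ?f (fst t, supp t \<inter> ?C)" for t :: "('l, 'n) tile"
    unfolding supp by (simp add: translate_tile_def)
  have "{t \<in> shift v T. supp t \<inter> B \<noteq> {}} = ?f ` {t \<in> T. supp (?f t) \<inter> B \<noteq> {}}"
    unfolding shift_def by blast
  also have "{t \<in> T. supp (?f t) \<inter> B \<noteq> {}} = {t \<in> T. supp t \<inter> ?C \<noteq> {}}"
    unfolding supp by simp
  finally have dom: "{t \<in> shift v T. supp t \<inter> B \<noteq> {}} = ?f ` {t \<in> T. supp t \<inter> ?C \<noteq> {}}" .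
  show ?thesis
    unfolding image dom unfolding shift_def image_image eq ..
qed

lemma tiling_restrict_shift_cong:
  assumes "tiling_restrict X (ball 0 R) = tiling_restrict Y (ball 0 R)" and "norm w + R' \<le> R"
  shows "tiling_restrict (shift w X) (ball 0 R') = tiling_restrict (shift w Y) (ball 0 R')"
proof -
  have sub: "(\<lambda>x. x + w) ` ball 0 R' \<subseteq> ball 0 R"
    using assms(2) by (force intro: le_less_trans[OF norm_triangle_ineq])
  show ?thesis
    unfolding tiling_restrict_shift
    by (metis assms(1) tiling_restrict_restrict[OF sub])
qed

lemma agreement_radii_commute: "agreement_radii T T' = agreement_radii T' T"
  unfolding agreement_radii_def by (intro Collect_cong conj_cong refl) (blast dest: sym)

lemma agreement_radii_bdd [simp]: "bdd_below (agreement_radii T T')"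
  by (rule bdd_belowI[of _ 0]) (auto simp: agreement_radii_def)

lemma tiling_dist_nonneg: "0 \<le> tiling_dist T T'"
  unfolding tiling_dist_def by (auto intro!: cInf_greatest simp: agreement_radii_def)

lemma tiling_dist_le: "\<epsilon> \<in> agreement_radii T T' \<Longrightarrow> tiling_dist T T' \<le> \<epsilon>"
  unfolding tiling_dist_def by (auto intro: cInf_lower)

lemma tiling_dist_le_1: "tiling_dist T T' \<le> 1"
proof (cases "agreement_radii T T' = {}")
  case False
  then obtain e where "e \<in> agreement_radii T T'" by blast
  then show ?thesis
    using tiling_dist_le[of e T T'] by (auto simp: agreement_radii_def)
qed (simp add: tiling_dist_def)

lemma tiling_dist_lessD:
  assumes "tiling_dist T T' < e" "e \<le> 1"
  shows "\<exists>\<epsilon>\<in>agreement_radii T T'. \<epsilon> < e"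
proof -
  have "agreement_radii T T' \<noteq> {}" "Inf (agreement_radii T T') < e"
    using assms by (auto simp: tiling_dist_def split: if_splits)
  then show ?thesis by (rule cInf_lessD)
qed

lemma agreement_radii_add:
  assumes a: "a \<in> agreement_radii T T'" and b: "b \<in> agreement_radii T' T''" and "a + b < 1"
  shows "a + b \<in> agreement_radii T T''"
proof -
  from a obtain v v' where v: "0 < a" "norm v < a" "norm v' < a"
      "tiling_restrict (shift v T) (ball 0 (1 / a)) = tiling_restrict (shift v' T') (ball 0 (1 / a))"
    by (auto simp: agreement_radii_def)
  from b obtain w w' where w: "0 < b" "norm w < b" "norm w' < b"
      "tiling_restrict (shift w T') (ball 0 (1 / b)) = tiling_restrict (shift w' T'') (ball 0 (1 / b))"
    by (auto simp: agreement_radii_def)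
  have key: "y + 1 / (x + y) \<le> 1 / x" if "0 < x" "0 < y" "x + y < 1" for x y :: real
  proof -
    have "x * (x + y) \<le> 1"
      using that mult_mono[of x 1 "x + y" 1] by simp
    then have "y * (x * (x + y)) \<le> y * 1"
      using that by (intro mult_left_mono) auto
    then show ?thesis
      using that by (simp add: field_simps)
  qed
  have wR: "norm w + 1 / (a + b) \<le> 1 / a"
    using key[OF v(1) w(1) \<open>a + b < 1\<close>] w(2) by linarith
  have "a + 1 / (b + a) \<le> 1 / b"
    using \<open>a + b < 1\<close> by (intro key v(1) w(1)) linarith
  then have vR: "norm v' + 1 / (a + b) \<le> 1 / b"
    using v(3) unfolding add.commute[of b a] by linarith
  have "tiling_restrict (shift (w + v) T) (ball 0 (1 / (a + b))) =
        tiling_restrict (shift (w + v') T') (ball 0 (1 / (a + b)))"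
    using tiling_restrict_shift_cong[OF v(4) wR] by simp
  also have "\<dots> = tiling_restrict (shift (v' + w') T'') (ball 0 (1 / (a + b)))"
    using tiling_restrict_shift_cong[OF w(4) vR] unfolding shift_shift add.commute[of w v'] .
  finally have "tiling_restrict (shift (w + v) T) (ball 0 (1 / (a + b))) =
        tiling_restrict (shift (v' + w') T'') (ball 0 (1 / (a + b)))" .
  moreover have "w + v \<in> ball 0 (a + b)" "v' + w' \<in> ball 0 (a + b)"
    using norm_add_less[OF w(2) v(2)] norm_add_less[OF v(3) w(3)] by (simp_all add: add.commute)
  moreover have "0 < a + b"
    using v(1) w(1) by linarith
  ultimately show ?thesis
    using \<open>a + b < 1\<close> unfolding agreement_radii_def by blast
qed

lemma tiling_dist_triangle: "tiling_dist T T'' \<le> tiling_dist T T' + tiling_dist T' T''"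
proof (rule ccontr)
  assume neg: "\<not> ?thesis"
  define h where "h = (tiling_dist T T'' - tiling_dist T T' - tiling_dist T' T'') / 2"
  have h: "h > 0" "tiling_dist T T' + h \<le> 1" "tiling_dist T' T'' + h \<le> 1"
    using neg tiling_dist_nonneg[of T T'] tiling_dist_nonneg[of T' T''] tiling_dist_le_1[of T T'']
    unfolding h_def by (auto simp: field_simps)
  obtain a b where ab: "a \<in> agreement_radii T T'" "a < tiling_dist T T' + h"
      "b \<in> agreement_radii T' T''" "b < tiling_dist T' T'' + h"
    using tiling_dist_lessD[of T T' "tiling_dist T T' + h"]
          tiling_dist_lessD[of T' T'' "tiling_dist T' T'' + h"] h by auto
  have lt: "a + b < tiling_dist T T''"
    using ab unfolding h_def by (simp add: field_simps)
  then have "a + b \<in> agreement_radii T T''"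
    using agreement_radii_add[OF ab(1,3)] tiling_dist_le_1[of T T''] by linarith
  then show False
    using tiling_dist_le lt by force
qed

lemma is_tileD:
  assumes "is_tile (t :: ('l, 'n::finite) tile)"
  shows "compact (supp t)" "connected (supp t)" "interior (supp t) \<noteq> {}"
proof -
  have h: "supp t homeomorphic (cball 0 1 :: (real ^ 'n) set)"
    using assms by (simp add: is_tile_def)
  show "compact (supp t)"
    using homeomorphic_compactness[OF h] compact_cball by blast
  show "connected (supp t)"
    using homeomorphic_connectedness[OF h] connected_cball by blast
  have "interior (supp t) homeomorphic interior (cball 0 1 :: (real ^ 'n) set)"
    by (rule homeomorphic_interiors_same_dimension[OF h]) simp
  then show "interior (supp t) \<noteq> {}"
    unfolding interior_cball by (auto simp: homeomorphic_empty)
qed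

lemma is_tile_translate:
  fixes t :: "('l, 'n::finite) tile"
  assumes "is_tile t"
  shows "is_tile (translate_tile v t)"
proof -
  have eq: "supp (translate_tile v t) = (+) v ` supp t"
    by (simp add: translate_tile_def add.commute)
  have "(+) v ` supp t homeomorphic supp t"
    using homeomorphic_translation[of "supp t" v] homeomorphic_sym by blast
  also have "supp t homeomorphic (cball 0 1 :: (real ^ 'n) set)"
    using assms by (simp add: is_tile_def)
  finally show ?thesis
    using assms closed_translation[of "supp t" v] unfolding is_tile_def eq by blast
qed

lemma tiling_dist_zero_subset:
  fixes T T' :: "('l, 'n::finite) tile set"
  assumes T: "is_tiling T" and T': "is_tiling T'" and d: "tiling_dist T T' = 0"
  shows "T \<subseteq> T'"
proof
  fix t assume t: "t \<in> T"
  then have tt: "is_tile t" using T by (simp add: is_tiling_def)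
  obtain x where "x \<in> interior (supp t)" using is_tileD(3)[OF tt] by blast
  then obtain \<delta> where \<delta>: "\<delta> > 0" "ball x \<delta> \<subseteq> interior (supp t)"
    by (meson open_contains_ball open_interior)
  obtain R where R: "R > 0" "\<And>y. y \<in> supp t \<Longrightarrow> norm y \<le> R"
    using is_tileD(1)[OF tt] compact_imp_bounded bounded_pos by metis
  have near: "\<exists>w. norm w < e \<and> translate_tile w t \<in> T'" if "e > 0" for e
  proof -
    define m where "m = min (e / 2) (1 / (R + 1))"
    have m: "m > 0" "m \<le> 1" "m \<le> 1 / (R + 1)" "2 * m \<le> e"
      using that R by (auto simp: m_def min_le_iff_disj)
    obtain \<epsilon> where \<epsilon>: "\<epsilon> \<in> agreement_radii T T'" "\<epsilon> < m"
      using tiling_dist_lessD[of T T' m] d m by auto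
    then obtain v v' where v: "0 < \<epsilon>" "\<epsilon> < 1" "norm v < \<epsilon>" "norm v' < \<epsilon>"
        "tiling_restrict (shift v T) (ball 0 (1 / \<epsilon>)) = tiling_restrict (shift v' T') (ball 0 (1 / \<epsilon>))"
      by (auto simp: agreement_radii_def)
    let ?B = "ball (0 :: real ^ 'n) (1 / \<epsilon>)"
    have "\<epsilon> < 1 / (R + 1)" using \<epsilon> m by linarith
    then have big: "R + 1 < 1 / \<epsilon>" using v R by (simp add: field_simps)
    define u where "u = translate_tile (- v) t"
    have u: "is_tile u" unfolding u_def using tt by (rule is_tile_translate)
    have uB: "supp u \<subseteq> ?B"
    proof
      fix y assume "y \<in> supp u"
      then obtain z where z: "z \<in> supp t" "y = z - v"
        by (auto simp: u_def translate_tile_def)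
      have "norm y \<le> norm z + norm v" using z norm_triangle_ineq4 by blast
      then show "y \<in> ?B" using R(2)[OF z(1)] big v by simp
    qed
    have u0: "supp u \<noteq> {}" using is_tileD(3)[OF u] interior_subset by blast
    have "u \<in> shift v T" using t by (simp add: u_def shift_def)
    moreover have "u = (fst u, supp u \<inter> ?B)" using uB by (simp add: inf.absorb1)
    moreover have "supp u \<inter> ?B \<noteq> {}" using u0 uB by auto
    ultimately have "u \<in> tiling_restrict (shift v T) ?B"
      unfolding tiling_restrict_def by blast
    then obtain s where s: "s \<in> shift v' T'" "u = (fst s, supp s \<inter> ?B)"
      unfolding v(5) unfolding tiling_restrict_def by blast
    have ss: "is_tile s"
      using s(1) T' by (auto simp: shift_def is_tiling_def intro: is_tile_translate)
    have K: "supp u = supp s \<inter> ?B" using s(2) by (metis snd_conv)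
    have "closedin (top_of_set (supp s)) (supp u)"
      using K is_tileD(1)[OF u] by (intro closed_subset) (auto intro: compact_imp_closed)
    moreover have "openin (top_of_set (supp s)) (supp u)"
      unfolding K by (rule openin_open_Int) simp
    ultimately have "supp u = supp s"
      using is_tileD(2)[OF ss] u0 unfolding connected_clopen by blast
    then have "u = s" using s(2) by (metis fst_conv prod.collapse)
    then obtain r where r: "r \<in> T'" "translate_tile (- v) t = translate_tile (- v') r"
      using s(1) by (auto simp: shift_def u_def)
    from r(2) have "translate_tile v' (translate_tile (- v) t) = translate_tile v' (translate_tile (- v') r)"
      by simp
    then have "translate_tile (v' - v) t = r" by simp
    moreover have "norm (v' - v) < e"
      using v \<epsilon> m norm_triangle_ineq4[of v' v] by linarith
    ultimately show ?thesis using r by blast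
  qed
  have inj: "w = w'" if w: "norm w < \<delta>" "norm w' < \<delta>"
      "translate_tile w t \<in> T'" "translate_tile w' t \<in> T'" for w w'
  proof -
    have mem: "x \<in> interior (supp (translate_tile z t))" if "norm z < \<delta>" for z
    proof -
      have "x - z \<in> interior (supp t)" using \<delta> that by (auto simp: dist_norm)
      moreover have "interior ((\<lambda>x. x + z) ` supp t) = (\<lambda>x. x + z) ` interior (supp t)"
        using interior_translation[of z "supp t"] by (simp add: add.commute)
      ultimately show ?thesis
        by (force simp: translate_tile_def image_iff)
    qed
    have "translate_tile w t = translate_tile w' t"
      using mem[OF w(1)] mem[OF w(2)] w(3,4) T' unfolding is_tiling_def disjoint_interiors_def by blast
    then have "translate_tile (- w') (translate_tile w t) = t" by simp
    then have "translate_tile (w - w') t = t" by simp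
    then have fixed: "(\<lambda>x. x + (w - w')) ` supp t = supp t" by (metis translate_tile_def snd_conv)
    have x: "x \<in> supp t" using \<open>x \<in> interior (supp t)\<close> interior_subset by blast
    have "x + real k *\<^sub>R (w - w') \<in> supp t" for k
    proof (induction k)
      case (Suc k)
      then have "x + real k *\<^sub>R (w - w') + (w - w') \<in> supp t" using fixed by blast
      then show ?case by (simp add: algebra_simps)
    qed (use x in simp)
    then have le: "norm (x + real k *\<^sub>R (w - w')) \<le> R" for k using R by blast
    have bnd: "real k * norm (w - w') \<le> R + R" for k
    proof -
      have "norm (real k *\<^sub>R (w - w')) \<le> norm (x + real k *\<^sub>R (w - w')) + norm x"
        using norm_triangle_ineq4[of "x + real k *\<^sub>R (w - w')" x] by simp
      then show ?thesis
        using le[of k] R(2)[OF x] by simp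
    qed
    show ?thesis
    proof (rule ccontr)
      assume "w \<noteq> w'"
      then obtain k :: nat where "real k * norm (w - w') > R + R"
        using ex_less_of_nat_mult[of "norm (w - w')" "R + R"] by auto
      then show False using bnd[of k] by linarith
    qed
  qed
  obtain w where w: "norm w < \<delta>" "translate_tile w t \<in> T'" using near[OF \<delta>(1)] by blast
  have "w = 0"
  proof (rule ccontr)
    assume "w \<noteq> 0"
    then obtain w' where w': "norm w' < min \<delta> (norm w)" "translate_tile w' t \<in> T'"
      using near[of "min \<delta> (norm w)"] \<delta> by auto
    then show False using inj[of w w'] w by auto
  qed
  then show "t \<in> T'" using w by simp
qed

lemma tiling_dist_commute: "tiling_dist T T' = tiling_dist T' T"
  by (simp add: tiling_dist_def agreement_radii_commute)

lemma tiling_dist_refl: "tiling_dist T T = 0"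
proof (rule antisym)
  show "tiling_dist T T \<le> 0"
  proof (rule field_le_epsilon)
    fix e :: real assume "e > 0"
    have "min (e / 2) (1 / 2) \<in> agreement_radii T T"
      unfolding agreement_radii_def using \<open>e > 0\<close> by (auto intro!: bexI[of _ 0])
    then show "tiling_dist T T \<le> 0 + e"
      using tiling_dist_le \<open>e > 0\<close> by fastforce
  qed
qed (rule tiling_dist_nonneg)

proposition Metric_space_tilings: "Metric_space {T. is_tiling T} tiling_dist"
proof
  fix T T' :: "('l, 'n::finite) tile set"
  assume "T \<in> {T. is_tiling T}" "T' \<in> {T. is_tiling T}"
  then show "tiling_dist T T' = 0 \<longleftrightarrow> T = T'"
    using tiling_dist_zero_subset[of T T'] tiling_dist_zero_subset[of T' T]
      tiling_dist_commute[of T T'] tiling_dist_refl by auto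
qed (auto simp: tiling_dist_nonneg tiling_dist_commute intro: tiling_dist_triangle)

corollary Metric_space_tiling_space: "Metric_space (tiling_space \<A>) tiling_dist"
  by (rule Metric_space.subspace[OF Metric_space_tilings]) (auto simp: tiling_space_def)

subsection \<open>Topology, orbit closures and factor maps\<close>

definition tiling_topology :: "('l, 'n::finite) tile set \<Rightarrow> ('l, 'n) tile set topology" where
  "tiling_topology \<A> = Metric_space.mtopology (tiling_space \<A>) tiling_dist"

definition orbit_closure ::
    "('l, 'n::finite) tile set \<Rightarrow> ('l, 'n) tile set \<Rightarrow> ('l, 'n) tile set set" where
  "orbit_closure \<A> T = tiling_topology \<A> closure_of range (\<lambda>v. shift v T)"

definition factor_map ::
    "('l, 'n::finite) tile set \<Rightarrow> ('l, 'n) tile set set \<Rightarrow>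
     ('k, 'n) tile set \<Rightarrow> ('k, 'n) tile set set \<Rightarrow>
     (('l, 'n) tile set \<Rightarrow> ('k, 'n) tile set) \<Rightarrow> bool" where
  "factor_map \<A> \<Omega> \<A>' \<Omega>' \<pi> \<longleftrightarrow>
     continuous_map (subtopology (tiling_topology \<A>) \<Omega>)
                    (subtopology (tiling_topology \<A>') \<Omega>') \<pi> \<and>
     \<pi> ` \<Omega> = \<Omega>' \<and>
     (\<forall>T\<in>\<Omega>. \<forall>v. \<pi> (shift v T) = shift v (\<pi> T))"

section \<open>Substitutions\<close>

definition similarity :: "(real ^ 'n::finite \<Rightarrow> real ^ 'n) \<Rightarrow> bool" where
  "similarity M \<longleftrightarrow> linear M \<and> (\<exists>c>1. \<forall>v. norm (M v) = c * norm v)"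

text \<open>The prototiles of a substitution are given as a list, because the substitution matrix
  needs an enumeration of them. They are required to be pairwise inequivalent, so that
  a tile is a translate of exactly one prototile and the extension of \<open>S\<close> to tiles
  is well defined.\<close>

definition substitution ::
    "(real ^ 'n::finite \<Rightarrow> real ^ 'n) \<Rightarrow> ('l, 'n) tile list \<Rightarrow>
     (('l, 'n) tile \<Rightarrow> ('l, 'n) tile set) \<Rightarrow> bool" where
  "substitution M ps S \<longleftrightarrow>
     similarity M \<and> prototile_set (set ps) \<and>
     (\<forall>i<length ps. \<forall>j<length ps. i \<noteq> j \<longrightarrow> \<not> tile_equiv (ps ! i) (ps ! j)) \<and>
     (\<forall>p\<in>set ps.
        finite (S p) \<and> (\<forall>t\<in>S p. \<exists>q\<in>set ps. tile_equiv q t) \<and>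
        disjoint_interiors (S p) \<and> tiles_support (S p) = M ` supp p)"

text \<open>If the prototiles are pairwise inequivalent, then the union below, for a translate
  \<open>t\<close> of a prototile, consists of a single term.\<close>

definition subst_tile ::
    "(real ^ 'n::finite \<Rightarrow> real ^ 'n) \<Rightarrow> ('l, 'n) tile list \<Rightarrow>
     (('l, 'n) tile \<Rightarrow> ('l, 'n) tile set) \<Rightarrow> ('l, 'n) tile \<Rightarrow> ('l, 'n) tile set" where
  "subst_tile M ps S t =
     \<Union>{translate_tile (M v) ` S p |p v. p \<in> set ps \<and> t = translate_tile v p}"

definition subst_tiles ::
    "(real ^ 'n::finite \<Rightarrow> real ^ 'n) \<Rightarrow> ('l, 'n) tile list \<Rightarrow>
     (('l, 'n) tile \<Rightarrow> ('l, 'n) tile set) \<Rightarrow> ('l, 'n) tile set \<Rightarrow> ('l, 'n) tile set" where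
  "subst_tiles M ps S P = (\<Union>t\<in>P. subst_tile M ps S t)"

definition subst_matrix ::
    "('l, 'n::finite) tile list \<Rightarrow> (('l, 'n) tile \<Rightarrow> ('l, 'n) tile set) \<Rightarrow> real mat" where
  "subst_matrix ps S =
     mat (length ps) (length ps)
       (\<lambda>(i, j). real (card {t \<in> S (ps ! i). tile_equiv (ps ! j) t}))"

definition primitive_matrix :: "real mat \<Rightarrow> bool" where
  "primitive_matrix A \<longleftrightarrow>
     (\<exists>k>0. \<forall>i<dim_row A. \<forall>j<dim_col A. (A ^\<^sub>m k) $$ (i, j) > 0)"

definition primitive_substitution ::
    "('l, 'n::finite) tile list \<Rightarrow> (('l, 'n) tile \<Rightarrow> ('l, 'n) tile set) \<Rightarrow> bool" where
  "primitive_substitution ps S \<longleftrightarrow> primitive_matrix (subst_matrix ps S)"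

text \<open>The positive eigenvalue strictly dominating the modulus of every other complex eigenvalue;
  by the Perron-Frobenius theorem a primitive matrix has exactly one.\<close>

definition perron_eigenvalue :: "real mat \<Rightarrow> real \<Rightarrow> bool" where
  "perron_eigenvalue A l \<longleftrightarrow>
     l > 0 \<and> eigenvalue (map_mat complex_of_real A) (complex_of_real l) \<and>
     (\<forall>\<mu>. eigenvalue (map_mat complex_of_real A) \<mu> \<and> \<mu> \<noteq> complex_of_real l \<longrightarrow> cmod \<mu> < l)"

definition self_similar_tiling ::
    "(real ^ 'n::finite \<Rightarrow> real ^ 'n) \<Rightarrow> ('l, 'n) tile list \<Rightarrow>
     (('l, 'n) tile \<Rightarrow> ('l, 'n) tile set) \<Rightarrow> ('l, 'n) tile set \<Rightarrow> bool" where
  "self_similar_tiling M ps S T \<longleftrightarrow>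
     substitution M ps S \<and> T \<in> tiling_space (set ps) \<and>
     finite_pattern_condition T \<and> subst_tiles M ps S T = T"

definition substitution_space ::
    "(real ^ 'n::finite \<Rightarrow> real ^ 'n) \<Rightarrow> ('l, 'n) tile list \<Rightarrow>
     (('l, 'n) tile \<Rightarrow> ('l, 'n) tile set) \<Rightarrow> ('l, 'n) tile set set" where
  "substitution_space M ps S =
     {T \<in> tiling_space (set ps).
        \<forall>P. P \<subseteq> T \<and> finite P \<longrightarrow>
          (\<exists>p\<in>set ps. \<exists>k>0. \<exists>v. translate_tile v ` P \<subseteq> (subst_tiles M ps S ^^ k) {p})}"

end

theory Submission
  imports Defs "HOL-Real_Asymp.Real_Asymp" "HOL-Library.Diagonal_Subsequence"
    "Jordan_Normal_Form.Spectral_Radius"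
begin

text \<open>Let \<open>Y\<close> be the image of the self-similar tiling and let \<open>c\<close> be the stretching factor, so that the
  Perron eigenvalue is \<open>c ^ d\<close>. Linear repetitivity passes to \<open>Y\<close>, and as \<open>Y\<close> is non periodic,
  the occurrences of a pattern of radius \<open>R\<close> in \<open>Y\<close> are separated by a multiple of \<open>R\<close>. For \<open>R\<close> of
  the order of \<open>c ^ k\<close>, boundedly many of them therefore fall on each \<open>k\<close>-fold inflated tile, and how
  many depends only on the surroundings of that tile. Hence the upper density of the occurrences is
  \<open>c ^ (- k d)\<close> times an element of a finite set that does not depend on \<open>k\<close>. Two self-similar tilings
  with a common factor express the same densities in this way, so letting \<open>R\<close> tend to infinity,
  the pigeonhole principle yields the relation between the two stretching factors.\<close>

section \<open>Upper densities of point sets\<close>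

text \<open>Equal patterns of radius \<open>\<rho> + s\<close> have images that agree only up to a
  translation shorter than 1. An occurrence close to the border of an inflated tile may thus change
  sides when it is compared with its counterpart at another tile with the same surroundings, so
  assigning each occurrence to the tile that contains it would not depend on the surroundings alone.
  Instead, every occurrence carries mass 1, divided equally among all tiles to which it is near, for
  a notion of nearness that is invariant under such comparisons. Counterparts are unique because
  distinct occurrences are at least 3 apart while every error is below 1. The mass of a tile is then
  a fraction with bounded numerator and fixed denominator, both independent of \<open>k\<close>,
  whence the finite set. Upper densities scale exactly under similarities, and they coincide for two
  tilings that have the same patterns, as the two images do. The counting takes place in locales
  about abstract patterns \<open>P x r\<close>, in which the occurrences of one fixed pattern, the
  anchors, stand for the tiles. Volumes of tiles enter only through the Perron eigenvalue.\<close>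

definition separated :: "real \<Rightarrow> 'v::metric_space set \<Rightarrow> bool" where
  "separated r X \<longleftrightarrow> (\<forall>x\<in>X. \<forall>y\<in>X. dist x y < r \<longrightarrow> x = y)"

text \<open>Packing: the balls of radius \<open>r\<close> about the points are disjoint and lie in a
  ball of radius \<open>N + r\<close>, so volumes bound the size of every finite subset. As this
  bound is uniform, finiteness follows too.\<close>

lemma card_separated:
  fixes X :: "'v::euclidean_space set"
  assumes r: "r > 0" and sep: "separated (2 * r) X" and N: "N \<ge> 0"
  shows "finite (X \<inter> cball x N)" "real (card (X \<inter> cball x N)) \<le> ((N + r) / r) ^ DIM('v)"
proof -
  let ?d = "DIM('v)" and ?v = "unit_ball_vol (DIM('v))"
  have bound: "real (card F) \<le> ((N + r) / r) ^ ?d" if F: "finite F" "F \<subseteq> X \<inter> cball x N" for F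
  proof -
    have disj: "pairwise (\<lambda>i j. disjnt (ball i r) (ball j r)) F"
    proof (rule pairwiseI)
      fix y z assume yz: "y \<in> F" "z \<in> F" "y \<noteq> z"
      then have "dist y z \<ge> 2 * r" using sep F unfolding separated_def by force
      then show "disjnt (ball y r) (ball z r)"
        by (auto simp: disjnt_def disjoint_iff) (metis dist_commute dist_triangle_less_add mult_2 not_le)
    qed
    have "real (card F) * (?v * r ^ ?d) = (\<Sum>y\<in>F. measure lborel (ball y r))"
      using r by (simp add: content_ball)
    also have "\<dots> = measure lborel (\<Union>y\<in>F. ball y r)"
      by (rule measure_UNION'[symmetric]) (use F disj in \<open>auto intro!: fmeasurableI emeasure_lborel_ball_finite\<close>)
    also have "\<dots> \<le> measure lborel (ball x (N + r))"
    proof (rule measure_mono_fmeasurable)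
      show "(\<Union>y\<in>F. ball y r) \<subseteq> ball x (N + r)"
      proof clarify
        fix y z assume "y \<in> F" "z \<in> ball y r"
        then have "dist x y \<le> N" "dist y z < r" using F by auto
        then show "z \<in> ball x (N + r)" using dist_triangle[of x z y] by simp
      qed
    qed (use F in \<open>auto intro!: fmeasurableI emeasure_lborel_ball_finite\<close>)
    also have "\<dots> = ?v * (N + r) ^ ?d" using r N by (simp add: content_ball)
    finally have "?v * (real (card F) * r ^ ?d) \<le> ?v * (N + r) ^ ?d" by (simp add: algebra_simps)
    moreover have "?v > 0" by simp
    ultimately have "real (card F) * r ^ ?d \<le> (N + r) ^ ?d"
      using mult_le_cancel_left_pos by blast
    then show ?thesis using r by (simp add: power_divide field_simps)
  qed
  have "\<forall>G\<subseteq>X \<inter> cball x N. finite G \<longrightarrow> card G \<le> nat \<lfloor>((N + r) / r) ^ ?d\<rfloor>"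
    using bound le_nat_floor by blast
  then show fin: "finite (X \<inter> cball x N)"
    using finite_if_finite_subsets_card_bdd by blast
  then show "real (card (X \<inter> cball x N)) \<le> ((N + r) / r) ^ ?d"
    using bound by blast
qed

text \<open>Covering, dual to the packing bound: balls of radius \<open>l\<close> about the points
  in \<open>cball x N\<close> cover \<open>cball x (N - l)\<close>.\<close>

lemma card_relatively_dense:
  fixes X :: "'v::euclidean_space set"
  assumes l: "l > 0" and dense: "\<And>x. \<exists>y\<in>X. dist x y \<le> l" and N: "N \<ge> l"
    and fin: "finite (X \<inter> cball x N)"
  shows "((N - l) / l) ^ DIM('v) \<le> real (card (X \<inter> cball x N))"
proof -
  let ?d = "DIM('v)" and ?v = "unit_ball_vol (DIM('v))" and ?F = "X \<inter> cball x N"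
  have "cball x (N - l) \<subseteq> (\<Union>y\<in>?F. cball y l)"
  proof
    fix z assume z: "z \<in> cball x (N - l)"
    obtain y where y: "y \<in> X" "dist z y \<le> l" using dense by blast
    have "dist x y \<le> N" using z y dist_triangle[of x y z] by simp
    then show "z \<in> (\<Union>y\<in>?F. cball y l)" using y by (auto simp: dist_commute)
  qed
  then have "measure lborel (cball x (N - l)) \<le> measure lborel (\<Union>y\<in>?F. cball y l)"
    by (rule measure_mono_fmeasurable) (use fin in \<open>auto intro!: fmeasurable.finite_UN fmeasurableI emeasure_bounded_finite\<close>)
  also have "\<dots> \<le> (\<Sum>y\<in>?F. measure lborel (cball y l))"
    by (rule measure_UNION_le) (use fin in auto)
  finally have "?v * (N - l) ^ ?d \<le> ?v * (real (card ?F) * l ^ ?d)"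
    using l N by (simp add: content_cball algebra_simps)
  moreover have "?v > 0" by simp
  ultimately have "(N - l) ^ ?d \<le> real (card ?F) * l ^ ?d"
    using mult_le_cancel_left_pos by blast
  then show ?thesis using l by (simp add: power_divide field_simps)
qed

text \<open>The slack \<open>h\<close> makes this upper Banach density insensitive to boundary effects without
  any passage to a limit.\<close>

definition density_bounds :: "('v::euclidean_space \<Rightarrow> real) \<Rightarrow> 'v set \<Rightarrow> real set" where
  "density_bounds w X =
     {a. a \<ge> 0 \<and> (\<exists>h\<ge>0. \<forall>x. \<forall>N\<ge>0. (\<Sum>p\<in>X \<inter> cball x N. w p) \<le> a * (N + h) ^ DIM('v))}"

text \<open>Counts are compared with powers of the radius instead of volumes of balls; the constant
  factor cancels because only ratios of densities matter in the end. The infimum of the empty set is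
  unspecified, which is why nonemptiness of \<open>density_bounds\<close> is an issue below.\<close>

definition upper_density :: "('v::euclidean_space \<Rightarrow> real) \<Rightarrow> 'v set \<Rightarrow> real" where
  "upper_density w X = Inf (density_bounds w X)"

lemma density_bounds_bdd: "bdd_below (density_bounds w X)"
  by (rule bdd_belowI[of _ 0]) (auto simp: density_bounds_def)

lemma density_bounds_separated:
  fixes X :: "'v::euclidean_space set"
  assumes "r > 0" "separated (2 * r) X"
  shows "1 / r ^ DIM('v) \<in> density_bounds (\<lambda>_. 1) X"
  using assms card_separated(2)[OF assms]
  by (auto simp: density_bounds_def power_divide intro!: exI[of _ r])

text \<open>The covering count, as \<open>N\<close> tends to infinity, forces every admissible
  constant to be at least \<open>1 / l ^ DIM('v)\<close>. Separation makes the counts finite and the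
  set of admissible constants nonempty.\<close>

lemma upper_density_relatively_dense:
  fixes X :: "'v::euclidean_space set"
  assumes r: "r > 0" "separated (2 * r) X" and l: "l > 0" and dense: "\<And>x. \<exists>y\<in>X. dist x y \<le> l"
  shows "upper_density (\<lambda>_. 1) X > 0"
proof -
  have "1 / l ^ DIM('v) \<le> a" if a: "a \<in> density_bounds (\<lambda>_. 1) X" for a
  proof -
    obtain h where h: "h \<ge> 0"
      "\<And>x N. N \<ge> 0 \<Longrightarrow> real (card (X \<inter> cball x N)) \<le> a * (N + h) ^ DIM('v)"
      using a by (auto simp: density_bounds_def)
    have "((N - l) / (N + h)) ^ DIM('v) / l ^ DIM('v) \<le> a" if "N \<ge> l" for N
    proof -
      have "((N - l) / l) ^ DIM('v) \<le> a * (N + h) ^ DIM('v)"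
        using card_relatively_dense[OF l dense \<open>N \<ge> l\<close>, of 0] card_separated(1)[OF r, of N 0] h(2)[of N 0]
          that l by simp
      moreover have "(N + h) ^ DIM('v) > 0" using that l h(1) by simp
      ultimately have "((N - l) / l) ^ DIM('v) / (N + h) ^ DIM('v) \<le> a"
        by (simp add: pos_divide_le_eq)
      then show ?thesis by (simp add: power_divide mult.commute)
    qed
    moreover have "((\<lambda>N. ((N - l) / (N + h)) ^ DIM('v) / l ^ DIM('v)) \<longlongrightarrow> 1 ^ DIM('v) / l ^ DIM('v)) at_top"
      using l by (intro tendsto_intros) (auto, real_asymp)
    ultimately show ?thesis
      by (intro tendsto_upperbound[where F = at_top and f = "\<lambda>N. ((N - l) / (N + h)) ^ DIM('v) / l ^ DIM('v)"])
         (auto simp: eventually_at_top_linorder)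
  qed
  then have "1 / l ^ DIM('v) \<le> upper_density (\<lambda>_. 1) X"
    unfolding upper_density_def using density_bounds_separated[OF r] by (intro cInf_greatest) auto
  then show ?thesis using l by (meson less_le_trans zero_less_divide_1_iff zero_less_power)
qed

lemma upper_density_cong:
  assumes "\<And>p. p \<in> X \<Longrightarrow> w p = w' p"
  shows "upper_density w X = upper_density w' X"
  unfolding upper_density_def density_bounds_def using assms by simp

text \<open>Centres are universally quantified in \<open>density_bounds\<close>, so for each radius
  only the collection of attained counts matters. This serves to compare sets that are locally alike
  without being translates of each other.\<close>

lemma upper_density_count_cong:
  fixes X X' :: "'v::euclidean_space set"
  assumes "\<And>x N. \<exists>x'. card (X \<inter> cball x N) = card (X' \<inter> cball x' N)"
    and "\<And>x N. \<exists>x'. card (X' \<inter> cball x N) = card (X \<inter> cball x' N)"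
  shows "upper_density (\<lambda>_. 1) X = upper_density (\<lambda>_. 1) X'"
proof -
  have "density_bounds (\<lambda>_. 1) Y \<subseteq> density_bounds (\<lambda>_. 1) Y'"
    if "\<And>x N. \<exists>x'. card (Y' \<inter> cball x N) = card (Y \<inter> cball x' N)" for Y Y' :: "'v set"
    unfolding density_bounds_def sum_constant mult_1_right
  proof (intro Collect_mono impI; elim conjE exE)
    fix a h :: real
    assume "a \<ge> 0" "h \<ge> 0" and h: "\<forall>x. \<forall>N\<ge>0. real (card (Y \<inter> cball x N)) \<le> a * (N + h) ^ DIM('v)"
    moreover have "real (card (Y' \<inter> cball x N)) \<le> a * (N + h) ^ DIM('v)" if "N \<ge> 0" for x N
      using h that \<open>\<And>x N. \<exists>x'. card (Y' \<inter> cball x N) = card (Y \<inter> cball x' N)\<close>[of x N] by metis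
    ultimately show "a \<ge> 0 \<and> (\<exists>h\<ge>0. \<forall>x. \<forall>N\<ge>0. real (card (Y' \<inter> cball x N)) \<le> a * (N + h) ^ DIM('v))"
      by blast
  qed
  then show ?thesis
    unfolding upper_density_def using assms by (metis subset_antisym)
qed

text \<open>Both comparisons lose a boundary layer of width \<open>E\<close>, which the slack in
  \<open>density_bounds\<close> absorbs; hence the exact factor \<open>s ^ DIM('v)\<close>.
  Surjectivity of \<open>M\<close> allows every centre to be written as \<open>M x\<close>.\<close>

lemma upper_density_scale:
  fixes X A :: "'v::euclidean_space set" and w :: "'v \<Rightarrow> real"
  assumes s: "s > 0" and M: "surj M" and E: "E \<ge> 0"
    and 1: "\<And>x N. N \<ge> 0 \<Longrightarrow> real (card (X \<inter> cball (M x) (s * N))) \<le> (\<Sum>p\<in>A \<inter> cball x (N + E). w p)"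
    and 2: "\<And>x N. N \<ge> 0 \<Longrightarrow> (\<Sum>p\<in>A \<inter> cball x N. w p) \<le> real (card (X \<inter> cball (M x) (s * (N + E))))"
    and ne: "density_bounds (\<lambda>_. 1) X \<noteq> {}"
  shows "upper_density w A = s ^ DIM('v) * upper_density (\<lambda>_. 1) X"
proof -
  let ?d = "DIM('v)"
  have A: "a * s ^ ?d \<in> density_bounds w A" if a: "a \<in> density_bounds (\<lambda>_. 1) X" for a
  proof -
    obtain h where h: "a \<ge> 0" "h \<ge> 0"
      "\<And>x N. N \<ge> 0 \<Longrightarrow> real (card (X \<inter> cball x N)) \<le> a * (N + h) ^ ?d"
      using a unfolding density_bounds_def by auto
    have "(\<Sum>p\<in>A \<inter> cball x N. w p) \<le> a * s ^ ?d * (N + (E + h / s)) ^ ?d" if "N \<ge> 0" for x N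
    proof -
      have "(\<Sum>p\<in>A \<inter> cball x N. w p) \<le> a * (s * (N + E) + h) ^ ?d"
        using 2[OF that, of x] h(3)[of "s * (N + E)" "M x"] that s E by simp
      also have "s * (N + E) + h = s * (N + (E + h / s))" using s by (simp add: field_simps)
      finally show ?thesis by (simp add: power_mult_distrib mult.assoc)
    qed
    then show ?thesis using s h E by (auto simp: density_bounds_def intro!: exI[of _ "E + h / s"])
  qed
  have B: "a / s ^ ?d \<in> density_bounds (\<lambda>_. 1) X" if a: "a \<in> density_bounds w A" for a
  proof -
    obtain h where h: "a \<ge> 0" "h \<ge> 0"
      "\<And>x N. N \<ge> 0 \<Longrightarrow> (\<Sum>p\<in>A \<inter> cball x N. w p) \<le> a * (N + h) ^ ?d"
      using a unfolding density_bounds_def by blast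
    have "real (card (X \<inter> cball y N)) \<le> a / s ^ ?d * (N + s * (E + h)) ^ ?d" if "N \<ge> 0" for y N
    proof -
      obtain x where x: "y = M x" using M by (metis surjD)
      have "real (card (X \<inter> cball y N)) \<le> a * (N / s + E + h) ^ ?d"
        using 1[of "N / s" x] h(3)[of "N / s + E" x] that s E by (simp add: x)
      also have "N / s + E + h = (N + s * (E + h)) / s" using s by (simp add: field_simps)
      finally show ?thesis by (simp add: power_divide)
    qed
    then show ?thesis using s h E by (auto simp: density_bounds_def intro!: exI[of _ "s * (E + h)"])
  qed
  have ne': "density_bounds w A \<noteq> {}" using A ne by blast
  show ?thesis
  proof (rule antisym)
    have "upper_density w A / s ^ ?d \<le> a" if "a \<in> density_bounds (\<lambda>_. 1) X" for a
      using cInf_lower[OF A[OF that] density_bounds_bdd] s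
      by (simp add: upper_density_def pos_divide_le_eq)
    then have "upper_density w A / s ^ ?d \<le> upper_density (\<lambda>_. 1) X"
      unfolding upper_density_def[of _ X] using ne by (intro cInf_greatest) auto
    then show "upper_density w A \<le> s ^ ?d * upper_density (\<lambda>_. 1) X"
      using s by (simp add: pos_divide_le_eq mult.commute)
    have "s ^ ?d * upper_density (\<lambda>_. 1) X \<le> a" if "a \<in> density_bounds w A" for a
      using cInf_lower[OF B[OF that] density_bounds_bdd] s
      by (simp add: upper_density_def pos_le_divide_eq mult.commute)
    then show "s ^ ?d * upper_density (\<lambda>_. 1) X \<le> upper_density w A"
      unfolding upper_density_def[of _ A] using ne' by (intro cInf_greatest) auto
  qed
qed

section \<open>Densities of patterns in factors\<close>

definition share :: "('a \<Rightarrow> 'b \<Rightarrow> bool) \<Rightarrow> 'b \<Rightarrow> real" where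
  "share N p = (\<Sum>y | N y p. 1 / real (card {q. N y q}))"

text \<open>Every \<open>y\<close> has mass 1, divided equally among its partners, and
  \<open>share N p\<close> is what \<open>p\<close> collects. All partners of elements of
  \<open>B\<close> lie in \<open>C\<close>, so the whole mass of \<open>B\<close> arrives there,
  possibly along with mass from outside \<open>B\<close>.\<close>

lemma card_le_sum_share:
  assumes fin: "finite B" "finite C" "\<And>p. p \<in> C \<Longrightarrow> finite {y. N y p}"
    and N: "\<And>y. y \<in> B \<Longrightarrow> {p. N y p} \<noteq> {} \<and> {p. N y p} \<subseteq> C"
  shows "real (card B) \<le> (\<Sum>p\<in>C. share N p)"
proof -
  let ?m = "\<lambda>y. 1 / real (card {q. N y q})"
  have "(\<Sum>p | p \<in> C \<and> N y p. ?m y) = 1" if "y \<in> B" for y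
  proof -
    have "{p. p \<in> C \<and> N y p} = {p. N y p}" using N[OF that] by blast
    moreover have "finite {p. N y p}" using N[OF that] fin(2) finite_subset by blast
    ultimately show ?thesis using N[OF that] by (simp add: card_gt_0_iff)
  qed
  then have "real (card B) = (\<Sum>y\<in>B. \<Sum>p | p \<in> C \<and> N y p. ?m y)"
    by (simp only: sum.cong[OF refl] sum_constant mult_1_right)
  also have "\<dots> = (\<Sum>p\<in>C. \<Sum>y | y \<in> B \<and> N y p. ?m y)"
    by (rule sum.swap_restrict[OF fin(1,2)])
  also have "\<dots> \<le> (\<Sum>p\<in>C. share N p)"
    unfolding share_def by (intro sum_mono sum_mono2) (use fin in auto)
  finally show ?thesis .
qed

text \<open>The opposite estimate: \<open>C\<close> collects mass from \<open>B\<close> only, and no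
  \<open>y\<close> gives away more than 1, although some of its partners may lie outside
  \<open>C\<close>.\<close>

lemma sum_share_le_card:
  assumes fin: "finite B" "finite C" "\<And>y. y \<in> B \<Longrightarrow> finite {q. N y q}"
    and N: "\<And>p. p \<in> C \<Longrightarrow> {y. N y p} \<subseteq> B"
  shows "(\<Sum>p\<in>C. share N p) \<le> real (card B)"
proof -
  let ?m = "\<lambda>y. 1 / real (card {q. N y q})"
  have "{y. N y p} = {y. y \<in> B \<and> N y p}" if "p \<in> C" for p using N[OF that] by blast
  then have "(\<Sum>p\<in>C. share N p) = (\<Sum>p\<in>C. \<Sum>y | y \<in> B \<and> N y p. ?m y)"
    unfolding share_def by simp
  also have "\<dots> = (\<Sum>y\<in>B. \<Sum>p | p \<in> C \<and> N y p. ?m y)"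
    by (rule sum.swap_restrict[OF fin(1,2), symmetric])
  also have "\<dots> \<le> (\<Sum>y\<in>B. 1)"
  proof (rule sum_mono)
    fix y assume y: "y \<in> B"
    have "card {p. p \<in> C \<and> N y p} \<le> card {q. N y q}"
      using fin(3)[OF y] by (intro card_mono) auto
    then show "(\<Sum>p | p \<in> C \<and> N y p. ?m y) \<le> 1"
      by (auto simp: divide_le_eq_1)
  qed
  finally show ?thesis by simp
qed

lemma share_cong:
  assumes bij: "bij_betw f {y. N y p} {y. N y p'}"
    and card: "\<And>y. N y p \<Longrightarrow> card {q. N (f y) q} = card {q. N y q}"
  shows "share N p = share N p'"
proof -
  have "share N p' = (\<Sum>y | N y p. 1 / real (card {q. N (f y) q}))"
    unfolding share_def by (rule sum.reindex_bij_betw[OF bij, symmetric])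
  then show ?thesis unfolding share_def using card by simp
qed

text \<open>The portions are reciprocals of integers up to \<open>m\<close>, so
  \<open>fact m\<close> is a common denominator. The resulting finite range depends on
  \<open>b\<close> and \<open>m\<close> alone, which will make it independent of the inflation
  level.\<close>

lemma share_range:
  assumes "finite {y. N y p}" "card {y. N y p} \<le> b"
    and m: "\<And>y. N y p \<Longrightarrow> finite {q. N y q} \<and> card {q. N y q} \<le> m"
  shows "share N p \<in> (\<lambda>j. real j / fact m) ` {..b * fact m}"
proof -
  let ?g = "\<lambda>y. fact m div card {q. N y q}"
  have eq: "1 / real (card {q. N y q}) = real (?g y) / fact m" if y: "N y p" for y
  proof -
    have pos: "card {q. N y q} > 0" using m[OF y] y by (auto simp: card_gt_0_iff)
    then have "card {q. N y q} dvd fact m" using m[OF y] by (intro dvd_fact) auto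
    then have "real (?g y) = fact m / real (card {q. N y q})"
      by (simp add: real_of_nat_div)
    then show ?thesis by simp
  qed
  have "share N p = real (\<Sum>y | N y p. ?g y) / fact m"
    unfolding share_def by (simp add: eq sum_divide_distrib)
  moreover have "(\<Sum>y | N y p. ?g y) \<le> (\<Sum>y | N y p. fact m)" by (intro sum_mono) simp
  then have "(\<Sum>y | N y p. ?g y) \<le> b * fact m"
    using assms(2) by (auto intro: order_trans[OF _ mult_right_mono])
  ultimately show ?thesis by blast
qed

section \<open>Similarities, abstract patterns and linear repetitivity\<close>

lemma linear_funpow: "linear (M :: 'v::real_vector \<Rightarrow> 'v) \<Longrightarrow> linear (M ^^ k)"
  by (induction k) (auto intro: linear_compose[unfolded o_def] simp: linear_id[unfolded id_def] o_def)

lemma norm_funpow: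
  fixes M :: "'v::real_normed_vector \<Rightarrow> 'v"
  assumes "\<And>v. norm (M v) = c * norm v"
  shows "norm ((M ^^ k) v) = c ^ k * norm v"
  by (induction k) (auto simp: assms)

lemma bij_funpow_similarity:
  fixes M :: "'v::euclidean_space \<Rightarrow> 'v"
  assumes "linear M" "\<And>v. norm (M v) = c * norm v" "c > 1"
  shows "bij (M ^^ k)"
proof -
  have "inj (M ^^ k)"
    unfolding linear_injective_0[OF linear_funpow[OF assms(1)]]
  proof (intro allI impI)
    fix x assume "(M ^^ k) x = 0"
    then have "c ^ k * norm x = 0" using norm_funpow[where M = M and c = c and k = k and v = x] assms(2) by simp
    then show "x = 0" using assms(3) by simp
  qed
  moreover from this have "surj (M ^^ k)"
    using linear_injective_imp_surjective[OF linear_funpow[OF assms(1)]] by blast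
  ultimately show ?thesis by (rule bijI)
qed

text \<open>The axiom reflects that the ball of radius \<open>r'\<close> about \<open>x + u\<close>
  lies in the ball of radius \<open>r\<close> about \<open>x\<close>. Patterns are of an abstract
  type because the tilings involved may carry different kinds of labels.\<close>

locale pattern_map =
  fixes P :: "'v::euclidean_space \<Rightarrow> real \<Rightarrow> 'p"
  assumes move: "P x r = P x' r \<Longrightarrow> norm u + r' \<le> r \<Longrightarrow> P (x + u) r' = P (x' + u) r'"
begin

lemma restrict: "P x r = P x' r \<Longrightarrow> r' \<le> r \<Longrightarrow> P x r' = P x' r'"
  using move[of x r x' 0 r'] by simp

end

text \<open>\<open>P x r\<close> and \<open>Q x r\<close> stand for the patterns of radius \<open>r\<close> around \<open>x\<close> in a self-similar tiling and in
  its image under a factor map. In contrast to subshifts, a factor map is a sliding block code only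
  up to a small translation, the \<open>w\<close> in the assumption \<open>code\<close>.\<close>

locale self_similar_factor = P: pattern_map P + Q: pattern_map Q
  for P :: "'v::euclidean_space \<Rightarrow> real \<Rightarrow> 'p" and Q :: "'v \<Rightarrow> real \<Rightarrow> 'q" +
  fixes M :: "'v \<Rightarrow> 'v" and c s r0 \<delta> :: real
  assumes c: "c > 1" and lin: "linear M" and norm_M: "norm (M v) = c * norm v"
    and inflate: "P x r = P x' r \<Longrightarrow> P (M x) (c * r) = P (M x') (c * r)"
    and recurrent: "\<exists>L. \<forall>y. \<exists>y'. dist y y' \<le> L \<and> P y' r = P x r"
    and rigid: "\<delta> > 0" "norm u < \<delta> \<Longrightarrow> P x r0 = P (x + u) r0 \<Longrightarrow> u = 0"
    and finite_types: "r \<ge> r0 \<Longrightarrow> finite {P p r |p. P p r0 = P 0 r0}"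
    and code: "P x (\<rho> + s) = P x' (\<rho> + s) \<Longrightarrow> \<exists>w. norm w < 1 \<and> Q x \<rho> = Q (x' + w) \<rho>"
    and aperiodic: "(\<And>x. Q x 1 = Q (x + u) 1) \<Longrightarrow> u = 0"
begin

text \<open>The occurrences of one fixed pattern play the role of the tiles.\<close>

definition anchors :: "'v set" where
  "anchors = {p. P p r0 = P 0 r0}"

lemma linear_pow: "linear (M ^^ k)"
  by (rule linear_funpow[OF lin])

lemma norm_pow: "norm ((M ^^ k) v) = c ^ k * norm v"
  by (rule norm_funpow[OF norm_M])

lemma surj_pow: "surj (M ^^ k)"
  by (rule bij_is_surj[OF bij_funpow_similarity[OF lin norm_M c]])

lemma inflate_pow: "P x r = P x' r \<Longrightarrow> P ((M ^^ k) x) (c ^ k * r) = P ((M ^^ k) x') (c ^ k * r)"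
  by (induction k) (auto simp: mult.assoc dest: inflate)

lemma anchors_dense: "\<exists>D\<ge>0. \<forall>x. \<exists>p\<in>anchors. dist x p \<le> D"
proof -
  obtain L where "\<forall>y. \<exists>y'. dist y y' \<le> L \<and> P y' r0 = P 0 r0" using recurrent by blast
  moreover have "L \<ge> 0" using calculation by (metis order_trans zero_le_dist)
  ultimately show ?thesis unfolding anchors_def by blast
qed

lemma anchors_separated: "separated \<delta> anchors"
  unfolding separated_def
proof clarify
  fix p q assume "p \<in> anchors" "q \<in> anchors" "dist p q < \<delta>"
  then have "norm (q - p) < \<delta>" "P p r0 = P (p + (q - p)) r0"
    by (auto simp: anchors_def dist_norm norm_minus_commute)
  then show "p = q" using rigid(2) by fastforce
qed

text \<open>A pattern of radius \<open>\<rho>\<close> is determined, through a suitable power of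
  \<open>M\<close>, by a pattern of radius 1, and that one by the pattern of radius \<open>a\<close>
  at a nearby anchor. The latter are finite in number and so recur with a common gap
  \<open>L1\<close>; inflation turns it into a gap proportional to \<open>c ^ k\<close>, hence to
  \<open>\<rho>\<close>.\<close>

lemma linearly_repetitive: "\<exists>L\<ge>0. \<forall>\<rho>\<ge>1. \<forall>x y. \<exists>y'. dist y y' \<le> L * \<rho> \<and> P y' \<rho> = P x \<rho>"
proof -
  obtain D where D: "D \<ge> 0" "\<And>x. \<exists>p\<in>anchors. dist x p \<le> D" using anchors_dense by blast
  \<comment> \<open>\<open>D + 1\<close> leaves room for a unit ball about any point within
    \<open>D\<close> of the anchor; \<open>finite_types\<close> applies from \<open>r0\<close>
    on.\<close>
  define a where "a = max r0 (D + 1)"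
  define types where "types = {P p a |p. P p r0 = P 0 r0}"
  have "finite types" unfolding types_def by (rule finite_types) (simp add: a_def)
  moreover have "\<exists>L. \<forall>y. \<exists>y'. dist y y' \<le> L \<and> P y' a = \<tau>" if "\<tau> \<in> types" for \<tau>
    using that recurrent unfolding types_def by blast
  then obtain L where L: "\<And>\<tau> y. \<tau> \<in> types \<Longrightarrow> \<exists>y'. dist y y' \<le> L \<tau> \<and> P y' a = \<tau>" by metis
  ultimately have "bdd_above (L ` types)" by simp
  then obtain L1 where L1: "\<And>\<tau>. \<tau> \<in> types \<Longrightarrow> L \<tau> \<le> L1"
    unfolding bdd_above_def by blast
  have L1': "\<exists>y'. dist y y' \<le> L1 \<and> P y' a = P p a" if p: "p \<in> anchors" for p y
  proof -
    have t: "P p a \<in> types" using p unfolding types_def anchors_def by blast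
    obtain y' where "dist y y' \<le> L (P p a)" "P y' a = P p a" using L[OF t] by blast
    then show ?thesis using L1[OF t] order_trans by blast
  qed
  have L10: "L1 \<ge> 0"
    using L1'[of 0 0] by (auto simp: anchors_def intro: order_trans[OF norm_ge_zero])
  show ?thesis
  proof (intro exI[of _ "c * (L1 + D)"] conjI allI impI)
    show "c * (L1 + D) \<ge> 0" using L10 D(1) c by simp
    fix \<rho> :: real and x y assume \<rho>: "1 \<le> \<rho>"
    \<comment> \<open>The least suitable \<open>k\<close>; minimality yields the second bound, and
      \<open>1 \<le> \<rho>\<close> settles the case \<open>k = 0\<close>.\<close>
    obtain k where k: "\<rho> \<le> c ^ k" "c ^ k \<le> c * \<rho>"
    proof -
      define k where "k = (LEAST k. \<rho> \<le> c ^ k)"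
      have ex: "\<exists>k. \<rho> \<le> c ^ k" using real_arch_pow[OF c, of \<rho>] less_imp_le by blast
      then have 1: "\<rho> \<le> c ^ k" unfolding k_def by (rule LeastI_ex)
      have "c ^ k \<le> c * \<rho>"
      proof (cases k)
        case 0 then show ?thesis using \<rho> c mult_mono[of 1 c 1 \<rho>] by simp
      next
        case (Suc j)
        then have "\<not> \<rho> \<le> c ^ j" unfolding k_def by (metis lessI not_less_Least)
        then show ?thesis using Suc c by simp
      qed
      then show ?thesis using that 1 by blast
    qed
    obtain \<xi> \<eta> where xy: "x = (M ^^ k) \<xi>" "y = (M ^^ k) \<eta>" using surj_pow by (metis surjD)
    obtain p where p: "p \<in> anchors" "dist \<xi> p \<le> D" using D(2) by blast
    obtain q where q: "dist \<eta> q \<le> L1" "P q a = P p a" using L1'[OF p(1)] by blast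
    have "P (q + (\<xi> - p)) 1 = P (p + (\<xi> - p)) 1"
      by (rule P.move[OF q(2)]) (use p(2) in \<open>simp add: a_def dist_norm\<close>)
    then have "P ((M ^^ k) (q + (\<xi> - p))) (c ^ k * 1) = P x (c ^ k * 1)"
      unfolding xy by (intro inflate_pow) simp
    then have "P ((M ^^ k) (q + (\<xi> - p))) \<rho> = P x \<rho>" by (rule P.restrict) (use k in simp)
    moreover have "dist y ((M ^^ k) (q + (\<xi> - p))) = c ^ k * norm (\<eta> - (q + (\<xi> - p)))"
      unfolding xy dist_norm linear_diff[OF linear_pow, symmetric] by (rule norm_pow)
    moreover have "norm (\<eta> - (q + (\<xi> - p))) \<le> L1 + D"
      using norm_triangle_ineq4[of "\<eta> - q" "\<xi> - p"] p(2) q(1)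
      by (simp add: dist_norm algebra_simps)
    then have "c ^ k * norm (\<eta> - (q + (\<xi> - p))) \<le> (c * \<rho>) * (L1 + D)"
      using k \<rho> c by (intro mult_mono) auto
    ultimately show "\<exists>y'. dist y y' \<le> c * (L1 + D) * \<rho> \<and> P y' \<rho> = P x \<rho>"
      by (auto simp: mult_ac intro!: exI[of _ "(M ^^ k) (q + (\<xi> - p))"])
  qed
qed

text \<open>A return of the \<open>P\<close>-pattern of radius \<open>\<rho> + s\<close> gives a
  return of the \<open>Q\<close>-pattern of radius \<open>\<rho>\<close> after a translation shorter
  than 1. Both additive constants are absorbed into a multiple of \<open>\<rho>\<close> because
  \<open>1 \<le> \<rho>\<close>.\<close>

lemma factor_linearly_repetitive:
  "\<exists>L\<ge>0. \<forall>\<rho>\<ge>1. \<forall>x y. \<exists>y'. dist y y' \<le> L * \<rho> \<and> Q y' \<rho> = Q x \<rho>"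
proof -
  obtain L where L: "L \<ge> 0" "\<And>\<rho> x y. \<rho> \<ge> 1 \<Longrightarrow> \<exists>y'. dist y y' \<le> L * \<rho> \<and> P y' \<rho> = P x \<rho>"
    using linearly_repetitive by blast
  \<comment> \<open>The sign of \<open>s\<close> is unspecified, whereas repetitivity of
    \<open>P\<close> must be applied at a radius of at least 1.\<close>
  let ?s = "max s 0"
  show ?thesis
  proof (intro exI[of _ "L * (1 + ?s) + 1"] conjI allI impI)
    show "L * (1 + ?s) + 1 \<ge> 0" using L(1) by simp
    fix \<rho> :: real and x y assume \<rho>: "1 \<le> \<rho>"
    obtain y' where y': "dist y y' \<le> L * (\<rho> + ?s)" "P y' (\<rho> + ?s) = P x (\<rho> + ?s)"
      using L(2)[of "\<rho> + ?s" y x] \<rho> by force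
    have "P x (\<rho> + s) = P y' (\<rho> + s)" using P.restrict[OF y'(2), of "\<rho> + s"] by simp
    then obtain w where w: "norm w < 1" "Q x \<rho> = Q (y' + w) \<rho>" using code by blast
    have "dist y (y' + w) \<le> dist y y' + norm w"
      using dist_triangle[of y "y' + w" y'] by (simp add: dist_norm)
    also have "\<dots> \<le> L * (\<rho> + ?s * \<rho>) + \<rho>"
    proof -
      have "?s * 1 \<le> ?s * \<rho>" using \<rho> by (intro mult_left_mono) auto
      then have "L * (\<rho> + ?s) \<le> L * (\<rho> + ?s * \<rho>)" using L(1) by (intro mult_left_mono) auto
      then show ?thesis using y'(1) w(1) \<rho> by linarith
    qed
    finally have "dist y (y' + w) \<le> (L * (1 + ?s) + 1) * \<rho>" by (simp add: algebra_simps)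
    then show "\<exists>y'. dist y y' \<le> (L * (1 + ?s) + 1) * \<rho> \<and> Q y' \<rho> = Q x \<rho>" using w(2) by metis
  qed
qed

text \<open>By linear repetitivity, a local period of a pattern that is short compared with its radius
  is a local period everywhere.\<close>

lemma factor_separated:
  "\<exists>\<kappa>>0. \<exists>R0>0. \<forall>R\<ge>R0. \<forall>x. separated (\<kappa> * R) {y. Q y R = Q x R}"
proof -
  obtain L where L: "L \<ge> 0" "\<And>\<rho> x y. \<rho> \<ge> 1 \<Longrightarrow> \<exists>y'. dist y y' \<le> L * \<rho> \<and> Q y' \<rho> = Q x \<rho>"
    using factor_linearly_repetitive by blast
  have per: "y = z"
    if R: "R \<ge> 2 * (L + 1)" and yz: "Q y R = Q z R" "dist y z < R / (2 * (L + 1))" for R y z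
  proof -
    define u where "u = z - y"
    \<comment> \<open>The choice makes \<open>L * \<rho> + \<rho> = R\<close>, so the ball of radius
      \<open>R\<close> about \<open>y\<close> contains a copy of every pattern of radius
      \<open>\<rho>\<close>.\<close>
    define \<rho> where "\<rho> = R / (L + 1)"
    have L1: "L + 1 > 0" using L(1) by simp
    then have "(L + 1) * \<rho> = R" unfolding \<rho>_def by simp
    then have "L * \<rho> + \<rho> = R" by (simp add: algebra_simps)
    moreover have "\<rho> \<ge> 2" using R L1 unfolding \<rho>_def by (simp add: pos_le_divide_eq)
    moreover have "norm u < \<rho> / 2"
      using yz(2) unfolding \<rho>_def u_def by (simp add: dist_norm norm_minus_commute mult.commute)
    ultimately have \<rho>: "\<rho> \<ge> 2" "L * \<rho> + \<rho> = R" "norm u < \<rho> / 2" by auto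
    \<comment> \<open>A copy of the pattern at \<open>v\<close> sits where the patterns at
      \<open>y\<close> and \<open>z\<close> agree, so \<open>u\<close> is a period there. This is
      carried back to \<open>v\<close>; the copy also shows the surroundings of \<open>v + u\<close>
      since \<open>norm u + 1 \<le> \<rho>\<close>.\<close>
    have "Q v 1 = Q (v + u) 1" for v
    proof -
      obtain v' where v': "dist y v' \<le> L * \<rho>" "Q v' \<rho> = Q v \<rho>" using L(2)[of \<rho> y v] \<rho>(1) by auto
      have "Q (v' + u) 1 = Q (v + u) 1" by (rule Q.move[OF v'(2)]) (use \<rho> in linarith)
      moreover have "Q v' 1 = Q v 1" by (rule Q.restrict[OF v'(2)]) (use \<rho> in linarith)
      moreover have "Q (y + (v' - y)) 1 = Q (z + (v' - y)) 1"
        by (rule Q.move[OF yz(1)]) (use \<rho> v'(1) in \<open>simp add: dist_norm norm_minus_commute\<close>)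
      ultimately show ?thesis by (simp add: u_def algebra_simps)
    qed
    then have "u = 0" by (rule aperiodic)
    then show ?thesis by (simp add: u_def)
  qed
  have "separated (1 / (2 * (L + 1)) * R) {y. Q y R = Q x R}" if "2 * (L + 1) \<le> R" for R x
    unfolding separated_def using per[OF that] by auto
  moreover have "1 / (2 * (L + 1)) > 0" "2 * (L + 1) > 0" using L(1) by auto
  ultimately show ?thesis by blast
qed

end

section \<open>Sharing occurrences among inflated anchors\<close>

lemma separated_mono: "separated r X \<Longrightarrow> r' \<le> r \<Longrightarrow> separated r' X"
  by (auto simp: separated_def)

text \<open>An occurrence \<open>y\<close> of a \<open>Q\<close>-pattern of radius about \<open>c ^ k\<close> is distributed evenly over the
  inflated anchors that are near it. Since \<open>Q\<close> is determined by \<open>P\<close> only up to a small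
  translation, nearness is saturated under the correspondence between occurrences
  close to anchors with the same surroundings. The share of an anchor then depends
  only on its surroundings of a radius independent of \<open>k\<close>.\<close>

locale occurrence_sharing = self_similar_factor P Q M c s r0 \<delta>
  for P :: "'v::euclidean_space \<Rightarrow> real \<Rightarrow> 'p" and Q :: "'v \<Rightarrow> real \<Rightarrow> 'q"
    and M :: "'v \<Rightarrow> 'v" and c s r0 \<delta> :: real +
  fixes D R :: real and x0 :: 'v and k :: nat
  assumes D: "D \<ge> 0" "\<And>x. \<exists>p\<in>anchors. dist x p \<le> D"
    and k: "1 \<le> c ^ k" "s \<le> c ^ k" "R \<le> c ^ k"
    and sep: "separated 3 {y. Q y R = Q x0 R}"
begin

definition occ :: "'v set" where "occ = {y. Q y R = Q x0 R}"

definition rel :: "'v \<Rightarrow> 'v \<Rightarrow> 'v" where "rel y p = y - (M ^^ k) p"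

text \<open>An occurrence within \<open>c ^ k * (D + 1)\<close> of an inflated anchor, together with
  the coding radius \<open>R + s\<close>, which is at most \<open>2 * c ^ k\<close>, fits into
  \<open>c ^ k * (D + 3)\<close>. The maximum with \<open>r0\<close> lets a pattern of radius
  \<open>a\<close> reveal whether its centre is an anchor.\<close>

definition a :: real where "a = max (D + 3) r0"

text \<open>The bare condition \<open>norm (rel y p) \<le> c ^ k * D\<close> would not be invariant:
  a displacement below 1 can cross the threshold. Therefore it is enough that some counterpart
  \<open>z\<close> of \<open>y\<close>, at some anchor \<open>q\<close> with the same surroundings
  as \<open>p\<close>, satisfies it.\<close>

definition near :: "'v \<Rightarrow> 'v \<Rightarrow> bool" where
  "near y p \<longleftrightarrow> y \<in> occ \<and> p \<in> anchors \<and>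
     (\<exists>q\<in>anchors. \<exists>z\<in>occ. P q a = P p a \<and> norm (rel z q) \<le> c ^ k * D \<and> norm (rel z q - rel y p) < 1)"

lemma nearI:
  assumes "y \<in> occ" "p \<in> anchors" "q \<in> anchors" "z \<in> occ" "P q a = P p a"
    and "norm (rel z q) \<le> c ^ k * D" "norm (rel z q - rel y p) < 1"
  shows "near y p"
  using assms unfolding near_def by blast

text \<open>The origin of the separation 3: each correspondence has an error below 1, and at most
  three such errors are ever added.\<close>

lemma occ_eqI: "y \<in> occ \<Longrightarrow> z \<in> occ \<Longrightarrow> norm (y - z) < 3 \<Longrightarrow> y = z"
  using sep by (auto simp: separated_def occ_def dist_norm)

lemma anchors_cong: "p \<in> anchors \<Longrightarrow> P p a = P q a \<Longrightarrow> q \<in> anchors"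
  using P.restrict[of p a q r0] by (simp add: anchors_def a_def)

text \<open>Inflated, the common pattern of radius \<open>a\<close> covers the coding radius around
  \<open>y\<close>. Hence \<open>code\<close> applies at the position of \<open>y\<close>, and its
  small translation \<open>w\<close> is the error.\<close>

lemma corresponding:
  assumes P: "P p a = P q a" and y: "y \<in> occ" "norm (rel y p) \<le> c ^ k * (D + 1)"
  shows "\<exists>z\<in>occ. norm (rel z q - rel y p) < 1"
proof -
  have "c ^ k * (D + 1) + (R + s) \<le> c ^ k * (D + 3)" using k by (simp add: algebra_simps)
  also have "\<dots> \<le> c ^ k * a" using k by (intro mult_left_mono) (auto simp: a_def)
  finally have "norm (rel y p) + (R + s) \<le> c ^ k * a" using y by linarith
  then have "P ((M ^^ k) p + rel y p) (R + s) = P ((M ^^ k) q + rel y p) (R + s)"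
    by (rule P.move[OF inflate_pow[OF P]])
  then obtain w where w: "norm w < 1" "Q ((M ^^ k) p + rel y p) R = Q ((M ^^ k) q + rel y p + w) R"
    using code by blast
  show ?thesis
  proof (rule bexI)
    show "(M ^^ k) q + rel y p + w \<in> occ" using w y by (simp add: occ_def rel_def)
    show "norm (rel ((M ^^ k) q + rel y p + w) q - rel y p) < 1" using w by (simp add: rel_def)
  qed
qed

lemma ex_near: "y \<in> occ \<Longrightarrow> \<exists>p. near y p"
proof -
  assume y: "y \<in> occ"
  obtain \<eta> where \<eta>: "y = (M ^^ k) \<eta>" using surj_pow by (metis surjD)
  obtain p where p: "p \<in> anchors" "dist \<eta> p \<le> D" using D by blast
  have "rel y p = (M ^^ k) (\<eta> - p)" by (simp add: rel_def \<eta> linear_diff[OF linear_pow])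
  then have "norm (rel y p) \<le> c ^ k * D"
    using p k by (simp add: norm_pow dist_norm)
  then have "near y p" using p y by (intro nearI[of y p p y]) auto
  then show ?thesis by blast
qed

lemma near_norm: "near y p \<Longrightarrow> norm (rel y p) \<le> c ^ k * (D + 1)"
proof -
  assume "near y p"
  then obtain q z where "norm (rel z q) \<le> c ^ k * D" "norm (rel z q - rel y p) < 1"
    unfolding near_def by blast
  then have "norm (rel y p) < c ^ k * D + 1"
    using norm_triangle_ineq4[of "rel z q" "rel z q - rel y p"] by simp
  then show ?thesis using k by (simp add: algebra_simps)
qed

text \<open>The witness \<open>y'\<close> at \<open>p'\<close> that makes \<open>y\<close> near
  \<open>p\<close> also has a counterpart \<open>z'\<close> at \<open>q\<close>. It differs from
  \<open>z\<close> by three errors, so \<open>z' = z\<close>, and the same witness makes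
  \<open>z\<close> near \<open>q\<close>.\<close>

lemma near_transfer:
  assumes "near y p" "P p a = P q a" "z \<in> occ" "norm (rel z q - rel y p) < 1"
  shows "near z q"
proof -
  obtain p' y' where *: "p' \<in> anchors" "y' \<in> occ" "P p' a = P p a" "norm (rel y' p') \<le> c ^ k * D"
      "norm (rel y' p' - rel y p) < 1"
    using assms(1) unfolding near_def by blast
  have q: "q \<in> anchors" using assms anchors_cong near_def by blast
  have "norm (rel y' p') \<le> c ^ k * (D + 1)" using * k by (simp add: algebra_simps)
  then obtain z' where z': "z' \<in> occ" "norm (rel z' q - rel y' p') < 1"
    using corresponding[of p' q y'] * assms by auto
  have "z' - z = (rel z' q - rel y' p') + (rel y' p' - rel y p) - (rel z q - rel y p)"
    by (simp add: rel_def)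
  then have "norm (z' - z) < 3"
    using z' * assms(4) norm_triangle_ineq4[of "(rel z' q - rel y' p') + (rel y' p' - rel y p)" "rel z q - rel y p"]
      norm_triangle_ineq[of "rel z' q - rel y' p'" "rel y' p' - rel y p"] by simp
  then have "z' = z" using occ_eqI z' assms by blast
  then show ?thesis
    using assms q * z' by (intro nearI[of z q p' y']) (auto simp: norm_minus_commute)
qed

lemma near_anchor_dist:
  assumes "near y p" "near y q" shows "norm (q - p) \<le> 2 * (D + 1)"
proof -
  have "c ^ k * norm (q - p) = norm (rel y p - rel y q)"
    by (simp add: rel_def linear_diff[OF linear_pow] norm_pow[symmetric])
  then have "c ^ k * norm (q - p) \<le> c ^ k * (2 * (D + 1))"
    using norm_triangle_ineq4[of "rel y p" "rel y q"] near_norm[OF assms(1)] near_norm[OF assms(2)]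
    by (simp add: algebra_simps)
  then show ?thesis using k by simp
qed

text \<open>All anchors near \<open>y\<close> are within \<open>2 * (D + 1)\<close> of
  \<open>p\<close>, so the larger radius exhibits their surroundings of radius \<open>a\<close> as
  well. Moving an anchor along \<open>p' - p\<close> does not alter the discrepancy between the
  relative positions.\<close>

lemma near_shift_anchor:
  assumes P: "P p (a + 2 * (D + 1)) = P p' (a + 2 * (D + 1))" and "near y p" "near z p'"
    and yz: "norm (rel z p' - rel y p) < 1" and "near y q"
  shows "near z (q + (p' - p))"
proof (rule near_transfer[OF \<open>near y q\<close>])
  show "z \<in> occ" using assms near_def by blast
  have "P (p + (q - p)) a = P (p' + (q - p)) a"
    using near_anchor_dist[OF assms(2,5)] by (intro P.move[OF P]) simp
  then show "P q a = P (q + (p' - p)) a" by (simp add: algebra_simps)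
  show "norm (rel z (q + (p' - p)) - rel y q) < 1"
    using yz by (simp add: rel_def linear_add[OF linear_pow] linear_diff[OF linear_pow] algebra_simps)
qed

lemma card_near_eq:
  assumes P: "P p (a + 2 * (D + 1)) = P p' (a + 2 * (D + 1))" and near: "near y p" "near z p'"
    and yz: "norm (rel z p' - rel y p) < 1"
  shows "card {q. near z q} = card {q. near y q}"
proof -
  have "bij_betw (\<lambda>q. q + (p' - p)) {q. near y q} {q. near z q}"
    by (rule bij_betw_byWitness[where f' = "\<lambda>q. q + (p - p')"])
       (use near_shift_anchor[OF P near yz]
          near_shift_anchor[OF P[symmetric] near(2,1)] yz in \<open>auto simp: norm_minus_commute\<close>)
  then show ?thesis by (simp add: bij_betw_same_card)
qed

text \<open>Separation makes counterparts unique, so choosing them gives a bijection between the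
  occurrences near \<open>p\<close> and those near \<open>p'\<close>. Counterparts are divided among
  equally many anchors, hence they contribute equal portions.\<close>

lemma share_near_cong:
  assumes P: "P p (a + 2 * (D + 1)) = P p' (a + 2 * (D + 1))"
  shows "share near p = share near p'"
proof -
  have *: "\<exists>z. near z p' \<and> norm (rel z p' - rel y p) < 1"
    if P: "P p a = P p' a" and y: "near y p" for p p' y
    using corresponding[OF P _ near_norm[OF y]] near_transfer[OF y P] y unfolding near_def by blast
  have Pa: "P p a = P p' a" using P.restrict[OF P] D by simp
  define f where "f y = (SOME z. near z p' \<and> norm (rel z p' - rel y p) < 1)" for y
  have f: "near (f y) p'" "norm (rel (f y) p' - rel y p) < 1" if "near y p" for y
    using someI_ex[OF *[OF Pa that]] unfolding f_def by auto
  show ?thesis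
  proof (rule share_cong)
    show "card {q. near (f y) q} = card {q. near y q}" if "near y p" for y
      using card_near_eq[OF P that f[OF that]] .
    show "bij_betw f {y. near y p} {y. near y p'}"
      unfolding bij_betw_def
    proof (intro conjI equalityI subsetI inj_onI)
      fix y z assume yz: "y \<in> {y. near y p}" "z \<in> {y. near y p}" "f y = f z"
      have "z - y = (rel (f y) p' - rel y p) - (rel (f z) p' - rel z p)"
        using yz(3) by (simp add: rel_def)
      then have "norm (z - y) < 3"
        using f(2)[of y] f(2)[of z] yz
          norm_triangle_ineq4[of "rel (f y) p' - rel y p" "rel (f z) p' - rel z p"] by simp
      then show "y = z" using occ_eqI[of z y] yz unfolding near_def by blast
    next
      fix z assume z: "z \<in> {y. near y p'}"
      then obtain y where y: "near y p" "norm (rel y p - rel z p') < 1" using *[OF Pa[symmetric]] by blast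
      have "f y - z = (rel (f y) p' - rel y p) + (rel y p - rel z p')" by (simp add: rel_def)
      then have "norm (f y - z) < 3"
        using f(2)[OF y(1)] y(2) norm_triangle_ineq[of "rel (f y) p' - rel y p" "rel y p - rel z p'"] by simp
      then have "f y = z" using occ_eqI[of "f y" z] f(1)[OF y(1)] z unfolding near_def by blast
      then show "z \<in> f ` {y. near y p}" using y by blast
    qed (use f in auto)
  qed
qed

lemma occ_separated: "separated (2 * (3/2)) occ"
  using sep by (simp add: occ_def)

lemma near_cball: "near y p \<Longrightarrow> y \<in> occ \<inter> cball ((M ^^ k) p) (c ^ k * (D + 1))"
  using near_norm[of y p] by (simp add: near_def rel_def dist_norm norm_minus_commute)

lemma near_cball': "near ((M ^^ k) \<eta>) p \<Longrightarrow> p \<in> anchors \<inter> cball \<eta> (D + 1)"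
proof -
  assume *: "near ((M ^^ k) \<eta>) p"
  have "rel ((M ^^ k) \<eta>) p = (M ^^ k) (\<eta> - p)" by (simp add: rel_def linear_diff[OF linear_pow])
  then have "c ^ k * norm (\<eta> - p) \<le> c ^ k * (D + 1)" using near_norm[OF *] by (simp add: norm_pow)
  then show ?thesis using k * by (simp add: near_def dist_norm)
qed

lemma finite_near: "finite {y. near y p}" "finite {p. near y p}"
proof -
  have "{y. near y p} \<subseteq> occ \<inter> cball ((M ^^ k) p) (c ^ k * (D + 1))" using near_cball by blast
  moreover have "finite \<dots>" by (rule card_separated(1)[OF _ occ_separated]) (use D k in auto)
  ultimately show "finite {y. near y p}" by (rule finite_subset)
  obtain \<eta> where \<eta>: "y = (M ^^ k) \<eta>" using surj_pow by (metis surjD)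
  have "{p. near y p} \<subseteq> anchors \<inter> cball \<eta> (D + 1)" using near_cball' \<eta> by blast
  moreover have "finite \<dots>"
    by (rule card_separated(1)[of "\<delta> / 2"]) (use D rigid(1) anchors_separated in auto)
  ultimately show "finite {p. near y p}" by (rule finite_subset)
qed

text \<open>Measured before inflation, mass travels a distance of at most \<open>D + 1\<close>. The
  two double counting estimates are therefore the two comparisons in
  \<open>upper_density_scale\<close>.\<close>

lemma density_share:
  "upper_density (share near) anchors = (c ^ k) ^ DIM('v) * upper_density (\<lambda>_. 1) occ"
proof (rule upper_density_scale[where M = "M ^^ k" and E = "D + 1"])
  have fin_occ: "finite (occ \<inter> cball x N)" if "N \<ge> 0" for x N
    by (rule card_separated(1)[OF _ occ_separated that]) simp
  have fin_anchors: "finite (anchors \<inter> cball x N)" if "N \<ge> 0" for x N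
    by (rule card_separated(1)[of "\<delta> / 2"]) (use that rigid(1) anchors_separated in auto)
  have dist_pow: "dist ((M ^^ k) x) ((M ^^ k) y) = c ^ k * dist x y" for x y
    unfolding dist_norm linear_diff[OF linear_pow, symmetric] by (rule norm_pow)
  have ck: "c ^ k > 0" using k by linarith
  show "0 < c ^ k" by fact
  show "surj (M ^^ k)" by (rule surj_pow)
  show "0 \<le> D + 1" using D by simp
  show "density_bounds (\<lambda>_. 1) occ \<noteq> {}"
    using density_bounds_separated[OF _ occ_separated] by auto
  fix x :: 'v and N :: real assume N: "0 \<le> N"
  show "real (card (occ \<inter> cball ((M ^^ k) x) (c ^ k * N))) \<le> sum (share near) (anchors \<inter> cball x (N + (D + 1)))"
  proof (rule card_le_sum_share)
    fix y assume y: "y \<in> occ \<inter> cball ((M ^^ k) x) (c ^ k * N)"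
    obtain \<eta> where \<eta>: "y = (M ^^ k) \<eta>" using surj_pow by (metis surjD)
    have "dist x \<eta> \<le> N" using y ck by (simp add: \<eta> dist_pow)
    then have "cball \<eta> (D + 1) \<subseteq> cball x (N + (D + 1))"
      by (simp add: cball_subset_cball_iff dist_commute)
    then show "{p. near y p} \<noteq> {} \<and> {p. near y p} \<subseteq> anchors \<inter> cball x (N + (D + 1))"
      using ex_near[of y] y near_cball'[of \<eta>] \<eta> by blast
  qed (use N D ck finite_near fin_occ fin_anchors in auto)
  show "sum (share near) (anchors \<inter> cball x N) \<le> real (card (occ \<inter> cball ((M ^^ k) x) (c ^ k * (N + (D + 1)))))"
  proof (rule sum_share_le_card)
    fix p assume p: "p \<in> anchors \<inter> cball x N"
    have "cball ((M ^^ k) p) (c ^ k * (D + 1)) \<subseteq> cball ((M ^^ k) x) (c ^ k * (N + (D + 1)))"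
    proof
      fix y assume y: "y \<in> cball ((M ^^ k) p) (c ^ k * (D + 1))"
      have "dist ((M ^^ k) x) ((M ^^ k) p) \<le> c ^ k * N" using p ck by (simp add: dist_pow)
      then show "y \<in> cball ((M ^^ k) x) (c ^ k * (N + (D + 1)))"
        using y dist_triangle[of "(M ^^ k) x" y "(M ^^ k) p"] by (simp add: algebra_simps)
    qed
    then show "{y. near y p} \<subseteq> occ \<inter> cball ((M ^^ k) x) (c ^ k * (N + (D + 1)))"
      using near_cball by blast
  qed (use N D ck finite_near fin_occ fin_anchors in auto)
qed

end

context self_similar_factor
begin

text \<open>The share of an anchor is a function of its pattern of radius \<open>A\<close> with
  values in \<open>V\<close>. As neither the finite set of these patterns nor \<open>V\<close>
  depends on \<open>k\<close>, there are finitely many such functions, and \<open>F\<close> collects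
  the densities they produce.\<close>

lemma occurrence_density_finite:
  "\<exists>F k0. finite F \<and> (\<forall>k\<ge>k0. \<forall>R x0. c ^ k \<le> c * R \<longrightarrow> R \<le> c ^ k \<longrightarrow>
     upper_density (\<lambda>_. 1) {y. Q y R = Q x0 R} > 0 \<and>
     (c ^ k) ^ DIM('v) * upper_density (\<lambda>_. 1) {y. Q y R = Q x0 R} \<in> F)"
proof -
  obtain D where D: "D \<ge> 0" "\<And>x. \<exists>p\<in>anchors. dist x p \<le> D" using anchors_dense by blast
  obtain \<kappa> R0 where \<kappa>: "\<kappa> > 0" "R0 > 0" "\<And>R x. R \<ge> R0 \<Longrightarrow> separated (\<kappa> * R) {y. Q y R = Q x R}"
    using factor_separated by blast
  obtain L where L: "L \<ge> 0" "\<And>\<rho> x y. \<rho> \<ge> 1 \<Longrightarrow> \<exists>y'. dist y y' \<le> L * \<rho> \<and> Q y' \<rho> = Q x \<rho>"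
    using factor_linearly_repetitive by blast
  define A where "A = max (D + 3) r0 + 2 * (D + 1)"
  \<comment> \<open>Packing bound for the anchors near one occurrence.\<close>
  define m where "m = nat \<lfloor>((D + 1 + \<delta> / 2) / (\<delta> / 2)) ^ DIM('v)\<rfloor>"
  \<comment> \<open>Packing bound for the occurrences near one anchor: they lie in a ball of radius
    \<open>c ^ k * (D + 1)\<close> and are \<open>\<kappa> * c ^ k / c\<close> apart, so that
    \<open>c ^ k\<close> cancels.\<close>
  define b where "b = nat \<lfloor>((D + 1) * (2 * c / \<kappa>) + 1) ^ DIM('v)\<rfloor>"
  define V where "V = (\<lambda>j. real j / fact m) ` {..b * fact m}"
  define types where "types = {P p A |p. P p r0 = P 0 r0}"
  define F where "F = (\<lambda>f. upper_density (\<lambda>p. f (P p A)) anchors) ` (types \<rightarrow>\<^sub>E V)"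
  have "finite types"
    unfolding types_def by (rule finite_types) (use D in \<open>auto simp: A_def\<close>)
  then have "finite F" unfolding F_def V_def by (intro finite_imageI finite_PiE) auto
  \<comment> \<open>The thresholds \<open>c * R0\<close> and \<open>c\<close> ensure
    \<open>R0 \<le> R\<close> and \<open>1 \<le> R\<close>, and \<open>3 * c / \<kappa>\<close>
    ensures separation by 3; the others are the size assumptions of
    \<open>occurrence_sharing\<close>.\<close>
  obtain k0 where k0: "max (max 1 s) (max (c * R0) (max c (3 * c / \<kappa>))) < c ^ k0"
    using real_arch_pow[OF c] by blast
  have main: "upper_density (\<lambda>_. 1) {y. Q y R = Q x0 R} > 0 \<and>
     (c ^ k) ^ DIM('v) * upper_density (\<lambda>_. 1) {y. Q y R = Q x0 R} \<in> F"
    if k: "k \<ge> k0" and R: "c ^ k \<le> c * R" "R \<le> c ^ k" for k R x0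
  proof -
    have "c ^ k0 \<le> c ^ k" using k c by (intro power_increasing) auto
    then have ck: "1 \<le> c ^ k" "s \<le> c ^ k" "c * R0 \<le> c ^ k" "c \<le> c ^ k" "3 * c / \<kappa> \<le> c ^ k"
      using k0 by auto
    have "c * R0 \<le> c * R" "c * 1 \<le> c * R" using ck R by linarith+
    then have RR: "R0 \<le> R" "1 \<le> R" using c by simp_all
    have sepk: "separated (2 * (\<kappa> * c ^ k / (2 * c))) {y. Q y R = Q x0 R}"
    proof (rule separated_mono[OF \<kappa>(3)[OF RR(1)]])
      show "2 * (\<kappa> * c ^ k / (2 * c)) \<le> \<kappa> * R" using R(1) \<kappa>(1) c
        by (simp add: pos_divide_le_eq mult.commute mult.left_commute)
    qed
    have sep3: "separated 3 {y. Q y R = Q x0 R}"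
    proof (rule separated_mono[OF sepk])
      show "3 \<le> 2 * (\<kappa> * c ^ k / (2 * c))" using ck(5) \<kappa>(1) c
        by (simp add: pos_le_divide_eq pos_divide_le_eq mult.commute)
    qed
    interpret occurrence_sharing P Q M c s r0 \<delta> D R x0 k
      by unfold_locales (use D ck R sep3 in auto)
    have occ: "occ = {y. Q y R = Q x0 R}" by (rule occ_def)
    have A: "a + 2 * (D + 1) = A" by (simp add: a_def A_def)
    have pos: "upper_density (\<lambda>_. 1) occ > 0"
    proof (rule upper_density_relatively_dense[OF _ occ_separated])
      show "L * R + 1 > 0" using L(1) RR mult_nonneg_nonneg[of L R] by linarith
      show "\<exists>y\<in>occ. dist x y \<le> L * R + 1" for x
        using L(2)[OF RR(2), of x x0] unfolding occ by force
    qed simp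
    have range: "share near p \<in> V" for p
      unfolding V_def
    proof (rule share_range)
      let ?r = "\<kappa> * c ^ k / (2 * c)"
      have r: "?r > 0" using \<kappa>(1) ck(1) c by (intro divide_pos_pos mult_pos_pos) auto
      have "card {y. near y p} \<le> card (occ \<inter> cball ((M ^^ k) p) (c ^ k * (D + 1)))"
        by (rule card_mono) (use card_separated(1)[OF r sepk, of "c ^ k * (D + 1)"] D ck near_cball in \<open>auto simp: occ\<close>)
      also have "real \<dots> \<le> ((c ^ k * (D + 1) + ?r) / ?r) ^ DIM('v)"
        unfolding occ by (rule card_separated(2)[OF r sepk]) (use D ck in auto)
      also have "(c ^ k * (D + 1) + ?r) / ?r = (D + 1) * (2 * c / \<kappa>) + 1"
        using \<kappa>(1) ck(1) c by (simp add: field_simps)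
      finally show "card {y. near y p} \<le> b" unfolding b_def by (simp add: le_nat_floor)
      show "finite {y. near y p}" by (rule finite_near)
      fix y assume "near y p"
      obtain \<eta> where \<eta>: "y = (M ^^ k) \<eta>" using surj_pow by (metis surjD)
      have \<delta>: "\<delta> / 2 > 0" "separated (2 * (\<delta> / 2)) anchors" using rigid(1) anchors_separated by auto
      have "card {q. near y q} \<le> card (anchors \<inter> cball \<eta> (D + 1))"
        by (rule card_mono) (use card_separated(1)[OF \<delta>, of "D + 1"] D near_cball' \<eta> in auto)
      also have "real \<dots> \<le> ((D + 1 + \<delta> / 2) / (\<delta> / 2)) ^ DIM('v)"
        by (rule card_separated(2)[OF \<delta>]) (use D in auto)
      finally show "finite {q. near y q} \<and> card {q. near y q} \<le> m"
        unfolding m_def using finite_near by (auto simp: le_nat_floor)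
    qed
    \<comment> \<open>Any representative of a type serves, since \<open>share_near_cong\<close>
      makes the share depend on the type alone.\<close>
    define f where "f = (\<lambda>\<tau>\<in>types. share near (SOME p. P p A = \<tau>))"
    have "f \<in> types \<rightarrow>\<^sub>E V" unfolding f_def using range by auto
    moreover have "share near p = f (P p A)" if "p \<in> anchors" for p
    proof -
      have "P p A \<in> types" using that unfolding types_def anchors_def by blast
      moreover have "P (SOME q. P q A = P p A) A = P p A" by (rule someI[of _ p]) simp
      then have "share near (SOME q. P q A = P p A) = share near p"
        by (intro share_near_cong) (simp only: A)
      ultimately show ?thesis unfolding f_def by simp
    qed
    then have "upper_density (share near) anchors = upper_density (\<lambda>p. f (P p A)) anchors"
      by (rule upper_density_cong)
    ultimately have "upper_density (share near) anchors \<in> F" unfolding F_def by blast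
    then show ?thesis using pos density_share unfolding occ by simp
  qed
  show ?thesis
    by (intro exI[of _ F] exI[of _ k0]) (use main \<open>finite F\<close> in blast)
qed

end

text \<open>A pattern of radius \<open>N + R\<close> determines how often a pattern of radius
  \<open>R\<close> has its centre in the ball of radius \<open>N\<close>. Tilings with the same
  patterns therefore attain the same counts.\<close>

lemma upper_density_pattern_cong:
  fixes Q1 Q2 :: "'v::euclidean_space \<Rightarrow> real \<Rightarrow> 'q"
  assumes Q12: "\<And>x r. \<exists>x'. Q1 x r = Q2 x' r" and Q21: "\<And>x r. \<exists>x'. Q2 x r = Q1 x' r"
    and move: "\<And>x x' r r' u. Q1 x r = Q2 x' r \<Longrightarrow> norm u + r' \<le> r \<Longrightarrow> Q1 (x + u) r' = Q2 (x' + u) r'"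
  shows "upper_density (\<lambda>_. 1) {y. Q1 y R = \<tau>} = upper_density (\<lambda>_. 1) {y. Q2 y R = \<tau>}"
proof -
  have *: "card ({y. Q1 y R = \<tau>} \<inter> cball x N) = card ({y. Q2 y R = \<tau>} \<inter> cball x' N)"
    if "Q1 x (N + R) = Q2 x' (N + R)" for x x' N
  proof -
    have eq: "Q1 (x + u) R = Q2 (x' + u) R" if "norm u \<le> N" for u
      using move[OF \<open>Q1 x (N + R) = Q2 x' (N + R)\<close>] that by simp
    have 1: "Q2 (y + (x' - x)) R = Q1 y R \<and> dist x' (y + (x' - x)) \<le> N" if "dist x y \<le> N" for y
      using eq[of "y - x"] that by (simp add: dist_norm norm_minus_commute algebra_simps)
    have 2: "Q1 (y + (x - x')) R = Q2 y R \<and> dist x (y + (x - x')) \<le> N" if "dist x' y \<le> N" for y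
      using eq[of "y - x'"] that by (simp add: dist_norm norm_minus_commute algebra_simps)
    have "bij_betw (\<lambda>y. y + (x' - x)) ({y. Q1 y R = \<tau>} \<inter> cball x N) ({y. Q2 y R = \<tau>} \<inter> cball x' N)"
      by (rule bij_betw_byWitness[where f' = "\<lambda>y. y + (x - x')"]) (use 1 2 in auto)
    then show ?thesis by (rule bij_betw_same_card)
  qed
  show ?thesis
  proof (rule upper_density_count_cong)
    fix x N
    obtain x' where "Q1 x (N + R) = Q2 x' (N + R)" using Q12 by blast
    then show "\<exists>x'. card ({y. Q1 y R = \<tau>} \<inter> cball x N) = card ({y. Q2 y R = \<tau>} \<inter> cball x' N)"
      using * by blast
    obtain x' where "Q2 x (N + R) = Q1 x' (N + R)" using Q21 by blast
    then show "\<exists>x'. card ({y. Q2 y R = \<tau>} \<inter> cball x N) = card ({y. Q1 y R = \<tau>} \<inter> cball x' N)"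
      using *[of x' N x] by metis
  qed
qed

text \<open>The pattern at radius \<open>c1 ^ j\<close> has a density lying in \<open>c1 ^ (- j d) F1\<close> and in
  \<open>c2 ^ (- \<kappa> j d) F2\<close> with \<open>F1\<close> and \<open>F2\<close> finite, so two values of \<open>j\<close> share both coefficients.\<close>

theorem multiplicative_dependence:
  fixes Q1 Q2 :: "'v::euclidean_space \<Rightarrow> real \<Rightarrow> 'q"
  assumes 1: "self_similar_factor P1 Q1 M1 c1 s1 r1 \<delta>1" and 2: "self_similar_factor P2 Q2 M2 c2 s2 r2 \<delta>2"
    and Q12: "\<And>x r. \<exists>x'. Q1 x r = Q2 x' r" and Q21: "\<And>x r. \<exists>x'. Q2 x r = Q1 x' r"
    and move: "\<And>x x' r r' u. Q1 x r = Q2 x' r \<Longrightarrow> norm u + r' \<le> r \<Longrightarrow> Q1 (x + u) r' = Q2 (x' + u) r'"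
  shows "\<exists>n m :: nat. n > 0 \<and> m > 0 \<and> (c1 ^ DIM('v)) ^ n = (c2 ^ DIM('v)) ^ m"
proof -
  let ?d = "DIM('v)"
  interpret S1: self_similar_factor P1 Q1 M1 c1 s1 r1 \<delta>1 by fact
  interpret S2: self_similar_factor P2 Q2 M2 c2 s2 r2 \<delta>2 by fact
  note c1 = S1.c and c2 = S2.c
  obtain F1 k1 where F1: "finite F1"
    "\<And>k R x0. k \<ge> k1 \<Longrightarrow> c1 ^ k \<le> c1 * R \<Longrightarrow> R \<le> c1 ^ k \<Longrightarrow>
       upper_density (\<lambda>_. 1) {y. Q1 y R = Q1 x0 R} > 0 \<and>
       (c1 ^ k) ^ ?d * upper_density (\<lambda>_. 1) {y. Q1 y R = Q1 x0 R} \<in> F1"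
    using S1.occurrence_density_finite by blast
  obtain F2 k2 where F2: "finite F2"
    "\<And>k R x0. k \<ge> k2 \<Longrightarrow> c2 ^ k \<le> c2 * R \<Longrightarrow> R \<le> c2 ^ k \<Longrightarrow>
       upper_density (\<lambda>_. 1) {y. Q2 y R = Q2 x0 R} > 0 \<and>
       (c2 ^ k) ^ ?d * upper_density (\<lambda>_. 1) {y. Q2 y R = Q2 x0 R} \<in> F2"
    using S2.occurrence_density_finite by blast
  define \<Delta> where "\<Delta> j = upper_density (\<lambda>_. 1) {y. Q1 y (c1 ^ j) = Q1 0 (c1 ^ j)}" for j :: nat
  \<comment> \<open>The least power of \<open>c2\<close> not below \<open>c1 ^ j\<close>: the radius
    \<open>c1 ^ j\<close> is then within a factor \<open>c2\<close> of it, as the finiteness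
    statement for the second factor demands.\<close>
  define \<kappa> where "\<kappa> j = (LEAST k. c1 ^ j \<le> c2 ^ k)" for j
  have \<kappa>: "c1 ^ j \<le> c2 ^ \<kappa> j" "c2 ^ \<kappa> j \<le> c2 * c1 ^ j" for j
  proof -
    have "\<exists>k. c1 ^ j \<le> c2 ^ k" using real_arch_pow[OF c2, of "c1 ^ j"] less_imp_le by blast
    then show "c1 ^ j \<le> c2 ^ \<kappa> j" unfolding \<kappa>_def by (rule LeastI_ex)
    show "c2 ^ \<kappa> j \<le> c2 * c1 ^ j"
    proof (cases "\<kappa> j")
      case 0
      have "1 \<le> c1 ^ j" using c1 by simp
      then show ?thesis using 0 c2 mult_mono[of 1 c2 1 "c1 ^ j"] by simp
    next
      case (Suc i)
      then have "\<not> c1 ^ j \<le> c2 ^ i" unfolding \<kappa>_def by (metis lessI not_less_Least)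
      then show ?thesis using Suc c2 by simp
    qed
  qed
  obtain j0 where j0: "c2 ^ k2 < c1 ^ j0" using real_arch_pow[OF c1] by blast
  define J where "J = {max j0 k1..}"
  have val1: "\<Delta> j > 0 \<and> (c1 ^ j) ^ ?d * \<Delta> j \<in> F1" if "j \<in> J" for j
    unfolding \<Delta>_def using that c1 by (intro F1(2)) (auto simp: J_def)
  have val2: "(c2 ^ \<kappa> j) ^ ?d * \<Delta> j \<in> F2" if j: "j \<in> J" for j
  proof -
    obtain x0 where x0: "Q1 0 (c1 ^ j) = Q2 x0 (c1 ^ j)" using Q12 by blast
    have "c2 ^ k2 < c1 ^ j"
      using j0 c1 j by (intro less_le_trans[OF j0 power_increasing]) (auto simp: J_def)
    then have "c2 ^ k2 < c2 ^ \<kappa> j" using \<kappa>(1)[of j] by linarith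
    then have "k2 \<le> \<kappa> j" using c2 by simp
    moreover have "\<Delta> j = upper_density (\<lambda>_. 1) {y. Q2 y (c1 ^ j) = Q2 x0 (c1 ^ j)}"
      unfolding \<Delta>_def x0 by (rule upper_density_pattern_cong[OF Q12 Q21 move])
    ultimately show ?thesis using F2(2)[OF _ \<kappa>(2,1)] by simp
  qed
  have "infinite J" by (simp add: J_def infinite_Ici)
  moreover have "finite ((\<lambda>j. ((c1 ^ j) ^ ?d * \<Delta> j, (c2 ^ \<kappa> j) ^ ?d * \<Delta> j)) ` J)"
    by (rule finite_subset[of _ "F1 \<times> F2"]) (use val1 val2 F1(1) F2(1) in auto)
  ultimately obtain i where i: "i \<in> J"
    "infinite {j \<in> J. ((c1 ^ j) ^ ?d * \<Delta> j, (c2 ^ \<kappa> j) ^ ?d * \<Delta> j) = ((c1 ^ i) ^ ?d * \<Delta> i, (c2 ^ \<kappa> i) ^ ?d * \<Delta> i)}"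
    using pigeonhole_infinite by blast
  then obtain j where j: "j > i" "j \<in> J" "(c1 ^ j) ^ ?d * \<Delta> j = (c1 ^ i) ^ ?d * \<Delta> i"
      "(c2 ^ \<kappa> j) ^ ?d * \<Delta> j = (c2 ^ \<kappa> i) ^ ?d * \<Delta> i"
    unfolding infinite_nat_iff_unbounded by blast
  have pos: "\<Delta> i > 0" "\<Delta> j > 0" using val1 i j by auto
  have pow: "(c ^ k) ^ ?d = (c ^ ?d) ^ k" for c :: real and k
    by (simp add: power_mult[symmetric] mult.commute)
  have ratio: "\<Delta> i = C ^ (l - k) * \<Delta> j" if "C ^ l * \<Delta> j = C ^ k * \<Delta> i" "k < l" "C > 1" for C :: real and k l
  proof -
    have "C ^ k * (C ^ (l - k) * \<Delta> j) = C ^ k * \<Delta> i"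
      using that by (simp add: power_add[symmetric] mult.assoc[symmetric])
    then show ?thesis using that(3) by simp
  qed
  have C: "c1 ^ ?d > 1" "c2 ^ ?d > 1" using c1 c2 by (auto intro: one_less_power)
  have e1: "\<Delta> i = (c1 ^ ?d) ^ (j - i) * \<Delta> j"
    using j(1,3) C(1) unfolding pow by (intro ratio) auto
  have "(c1 ^ ?d) ^ (j - i) > 1" by (rule one_less_power[OF C(1)]) (use j(1) in simp)
  then have gt: "\<Delta> i > \<Delta> j" using e1 pos by simp
  \<comment> \<open>The density is strictly smaller at \<open>j\<close> than at \<open>i\<close>, so
    the normalising power of \<open>c2\<close> must be strictly larger there. This makes the second
    exponent of the result positive.\<close>
  have less: "\<kappa> i < \<kappa> j"
  proof (rule ccontr)
    assume "\<not> \<kappa> i < \<kappa> j"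
    then have "(c2 ^ ?d) ^ \<kappa> j \<le> (c2 ^ ?d) ^ \<kappa> i" using C by (intro power_increasing) auto
    then have "(c2 ^ ?d) ^ \<kappa> j * \<Delta> j < (c2 ^ ?d) ^ \<kappa> i * \<Delta> i"
      using gt pos c2 by (intro mult_le_less_imp_less) auto
    then show False using j(4) unfolding pow by simp
  qed
  have "\<Delta> i = (c2 ^ ?d) ^ (\<kappa> j - \<kappa> i) * \<Delta> j"
    using j(4) less C(2) unfolding pow by (intro ratio) auto
  then have "(c1 ^ ?d) ^ (j - i) = (c2 ^ ?d) ^ (\<kappa> j - \<kappa> i)" using e1 pos by simp
  then show ?thesis using j(1) less by (metis zero_less_diff)
qed

section \<open>Patterns of tilings and local codes\<close>

text \<open>Whole tiles are kept, in contrast to \<open>tiling_restrict\<close>, which cuts them; a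
  pattern can then be translated and substituted tile by tile.\<close>

definition pat :: "('l, 'n::finite) tile set \<Rightarrow> real ^ 'n \<Rightarrow> real \<Rightarrow> ('l, 'n) tile set" where
  "pat T x r = {t \<in> shift x T. supp t \<inter> ball 0 r \<noteq> {}}"

lemma supp_translate [simp]: "supp (translate_tile v t) = (\<lambda>x. x + v) ` supp t"
  by (simp add: translate_tile_def)

lemma mem_shift_iff: "t \<in> shift v T \<longleftrightarrow> translate_tile v t \<in> T"
proof
  assume "t \<in> shift v T"
  then show "translate_tile v t \<in> T" by (auto simp: shift_def)
next
  assume "translate_tile v t \<in> T"
  then have "translate_tile (- v) (translate_tile v t) \<in> shift v T" unfolding shift_def by blast
  then show "t \<in> shift v T" by simp
qed

lemma pat_shift: "pat (shift v T) x r = pat T (v + x) r"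
  by (simp add: pat_def add.commute)

lemma pat_subset: "pat T x r \<subseteq> shift x T"
  by (auto simp: pat_def)

lemma pat_mono: "r \<le> r' \<Longrightarrow> pat T x r \<subseteq> pat T x r'"
  unfolding pat_def using subset_ball[of r r' 0] by blast

lemma pat_add:
  fixes T :: "('l, 'n::finite) tile set"
  assumes "norm u + r' \<le> r"
  shows "pat T (x + u) r' = {t \<in> shift u (pat T x r). supp t \<inter> ball 0 r' \<noteq> {}}"
proof -
  have "supp (translate_tile u t) \<inter> ball 0 r \<noteq> {}" if t: "supp t \<inter> ball 0 r' \<noteq> {}" for t :: "('l, 'n) tile"
  proof -
    obtain z where "z \<in> supp t" "norm z < r'" using t by auto
    moreover have "norm (z + u) < r" using calculation assms norm_triangle_ineq[of z u] by linarith
    ultimately show ?thesis by auto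
  qed
  then show ?thesis
    by (auto simp: pat_def mem_shift_iff add.commute simp del: supp_translate)
qed

lemma pat_move:
  "pat T x r = pat T' x' r \<Longrightarrow> norm u + r' \<le> r \<Longrightarrow> pat T (x + u) r' = pat T' (x' + u) r'"
  by (simp add: pat_add)

lemma pat_restrict: "pat T x r = pat T' x' r \<Longrightarrow> r' \<le> r \<Longrightarrow> pat T x r' = pat T' x' r'"
  using pat_move[of T x r T' x' 0 r'] by simp

text \<open>A tile that meets the ball at a point \<open>z\<close> already shows up in the pattern
  of radius 1 about \<open>x + z\<close>.\<close>

lemma pat_local:
  assumes "\<And>u. norm u < \<rho> \<Longrightarrow> pat T (x + u) 1 = pat T' (x' + u) 1"
  shows "pat T x \<rho> = pat T' x' \<rho>"
proof -
  have "t \<in> pat T' x' \<rho>" if t: "t \<in> pat T x \<rho>"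
    and *: "\<And>u. norm u < \<rho> \<Longrightarrow> pat T (x + u) 1 = pat T' (x' + u) 1" for t T T' and x x' :: "real ^ 'n"
  proof -
    obtain z where z: "z \<in> supp t" "norm z < \<rho>" using t by (auto simp: pat_def)
    have "translate_tile (- z) t \<in> pat T (x + z) 1"
      using t z by (force simp: pat_def mem_shift_iff)
    then have "translate_tile (- z) t \<in> shift (x' + z) T'"
      using *[OF z(2)] pat_subset by blast
    then show ?thesis using t by (simp add: pat_def mem_shift_iff)
  qed
  from this[OF _ assms] this[OF _ assms[symmetric]] show ?thesis by blast
qed

lemma is_tile_nonempty: "is_tile t \<Longrightarrow> supp t \<noteq> {}"
  using is_tileD(3) interior_subset by blast

text \<open>Iterating a nonzero translation leaves every bounded set.\<close>

lemma translate_tile_fixed: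
  fixes t :: "('l, 'n::finite) tile"
  assumes t: "is_tile t" and fixed: "translate_tile u t = t"
  shows "u = 0"
proof (rule ccontr)
  assume "u \<noteq> 0"
  obtain x where x: "x \<in> supp t" using is_tile_nonempty[OF t] by blast
  obtain b where b: "\<And>y. y \<in> supp t \<Longrightarrow> norm y \<le> b"
    using is_tileD(1)[OF t] compact_imp_bounded bounded_iff by metis
  have im: "(\<lambda>x. x + u) ` supp t = supp t" using fixed by (metis supp_translate)
  have mem: "x + real k *\<^sub>R u \<in> supp t" for k
  proof (induction k)
    case (Suc k)
    then have "x + real k *\<^sub>R u + u \<in> supp t" using im by blast
    then show ?case by (simp add: algebra_simps)
  qed (use x in simp)
  obtain k :: nat where k: "real k * norm u > b + norm x"
    using ex_less_of_nat_mult[of "norm u" "b + norm x"] \<open>u \<noteq> 0\<close> by auto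
  have "norm (real k *\<^sub>R u) \<le> norm (x + real k *\<^sub>R u) + norm x"
    using norm_triangle_ineq4[of "x + real k *\<^sub>R u" x] by simp
  then show False using b[OF mem[of k]] k by simp
qed

lemma interior_supp_translate:
  "interior (supp (translate_tile v t)) = (\<lambda>x. x + v) ` interior (supp t)"
  using interior_translation[of v "supp t"] by (simp add: add.commute)

lemma tiling_spaceD:
  assumes "T \<in> tiling_space \<A>"
  shows "t \<in> T \<Longrightarrow> is_tile t" "t \<in> T \<Longrightarrow> \<exists>p\<in>\<A>. \<exists>v. t = translate_tile v p"
    and "\<exists>t\<in>T. x \<in> supp t" "countable T"
    and "t \<in> T \<Longrightarrow> t' \<in> T \<Longrightarrow> z \<in> interior (supp t) \<Longrightarrow> z \<in> interior (supp t') \<Longrightarrow> t = t'"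
proof -
  have T: "is_tiling T" "\<forall>t\<in>T. \<exists>p\<in>\<A>. tile_equiv p t"
    using assms by (auto simp: tiling_space_def)
  show "t \<in> T \<Longrightarrow> is_tile t" "countable T" using T(1) by (auto simp: is_tiling_def)
  show "t \<in> T \<Longrightarrow> \<exists>p\<in>\<A>. \<exists>v. t = translate_tile v p" using T(2) by (auto simp: tile_equiv_def)
  have "x \<in> tiles_support T" using T(1) by (simp add: is_tiling_def)
  then show "\<exists>t\<in>T. x \<in> supp t" by (auto simp: tiles_support_def)
  have "disjoint_interiors T" using T(1) by (simp add: is_tiling_def)
  then show "t = t'" if "t \<in> T" "t' \<in> T" "z \<in> interior (supp t)" "z \<in> interior (supp t')"
    using that unfolding disjoint_interiors_def by (meson disjoint_iff)
qed

lemma shift_tiling_space: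
  fixes T :: "('l, 'n::finite) tile set"
  assumes T: "T \<in> tiling_space \<A>"
  shows "shift v T \<in> tiling_space \<A>"
proof -
  have eqv: "\<exists>p\<in>\<B>. tile_equiv p t" if *: "\<forall>t\<in>T. \<exists>p\<in>\<B>. tile_equiv p t" "t \<in> shift v T"
    for \<B> and t :: "('l, 'n) tile"
  proof -
    obtain p w where p: "p \<in> \<B>" "translate_tile v t = translate_tile w p"
      using * unfolding mem_shift_iff tile_equiv_def by blast
    then have "translate_tile (- v) (translate_tile v t) = translate_tile (- v) (translate_tile w p)" by simp
    then have "t = translate_tile (w - v) p" by simp
    then show ?thesis using p unfolding tile_equiv_def by blast
  qed
  have "is_tile t" if "t \<in> shift v T" for t
    using that tiling_spaceD(1)[OF T] is_tile_translate unfolding shift_def by blast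
  moreover have "countable (shift v T)"
    using tiling_spaceD(4)[OF T] unfolding shift_def by blast
  moreover have "tiles_support (shift v T) = UNIV"
  proof -
    have "z \<in> tiles_support (shift v T)" for z
    proof -
      obtain t where "t \<in> T" "z + v \<in> supp t"
        using tiling_spaceD(3)[OF T] by blast
      then have "translate_tile (- v) t \<in> shift v T" "z \<in> supp (translate_tile (- v) t)"
        by (simp add: mem_shift_iff, force)
      then show ?thesis unfolding tiles_support_def by blast
    qed
    then show ?thesis by blast
  qed
  moreover have "disjoint_interiors (shift v T)"
    unfolding disjoint_interiors_def
  proof (intro ballI impI)
    fix t t' assume t: "t \<in> shift v T" "t' \<in> shift v T" "t \<noteq> t'"
    have "translate_tile v t \<noteq> translate_tile v t'"
    proof
      assume "translate_tile v t = translate_tile v t'"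
      then have "translate_tile (- v) (translate_tile v t) = translate_tile (- v) (translate_tile v t')" by simp
      then show False using t by simp
    qed
    then have "interior (supp (translate_tile v t)) \<inter> interior (supp (translate_tile v t')) = {}"
      using t(1,2) tiling_spaceD(5)[OF T] unfolding mem_shift_iff by blast
    then show "interior (supp t) \<inter> interior (supp t') = {}"
      unfolding interior_supp_translate by fast
  qed
  moreover have "\<forall>t\<in>shift v T. \<exists>p\<in>\<A>. tile_equiv p t"
    using eqv T unfolding tiling_space_def by blast
  moreover have "\<exists>\<B>. prototile_set \<B> \<and> (\<forall>t\<in>shift v T. \<exists>p\<in>\<B>. tile_equiv p t)"
    using eqv T unfolding tiling_space_def is_tiling_def by blast
  ultimately show ?thesis unfolding tiling_space_def is_tiling_def by simp
qed

section \<open>Uniform bounds on tiles and the metric in terms of patterns\<close>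

lemma prototile_bounds:
  fixes \<A> :: "('l, 'n::finite) tile set"
  assumes "prototile_set \<A>"
  shows "\<exists>\<delta>>0. \<exists>\<Delta>>0. \<forall>T\<in>tiling_space \<A>. \<forall>t\<in>T.
    (\<exists>z. ball z \<delta> \<subseteq> interior (supp t)) \<and> (\<forall>y\<in>supp t. \<forall>z\<in>supp t. dist y z < \<Delta>)"
proof -
  have "\<forall>p\<in>\<A>. \<exists>\<delta>>0. \<exists>z. ball z \<delta> \<subseteq> interior (supp p)"
  proof
    fix p assume "p \<in> \<A>"
    then obtain z where "z \<in> interior (supp p)" using assms is_tileD(3) unfolding prototile_set_def by blast
    then show "\<exists>\<delta>>0. \<exists>z. ball z \<delta> \<subseteq> interior (supp p)"
      using open_interior[of "supp p"] unfolding open_contains_ball by blast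
  qed
  then obtain d where d: "\<And>p. p \<in> \<A> \<Longrightarrow> d p > 0 \<and> (\<exists>z. ball z (d p) \<subseteq> interior (supp p))" by metis
  have "\<forall>p\<in>\<A>. \<exists>\<Delta>. \<forall>y\<in>supp p. \<forall>z\<in>supp p. dist y z < \<Delta>"
  proof
    fix p assume "p \<in> \<A>"
    then have "bounded (supp p)" using assms is_tileD(1) compact_imp_bounded unfolding prototile_set_def by blast
    then obtain e where "\<forall>y\<in>supp p. \<forall>z\<in>supp p. dist y z \<le> e" using bounded_two_points by blast
    then have "\<forall>y\<in>supp p. \<forall>z\<in>supp p. dist y z < e + 1" by force
    then show "\<exists>\<Delta>. \<forall>y\<in>supp p. \<forall>z\<in>supp p. dist y z < \<Delta>" by blast
  qed
  then obtain e where e: "\<And>p y z. p \<in> \<A> \<Longrightarrow> y \<in> supp p \<Longrightarrow> z \<in> supp p \<Longrightarrow> dist y z < e p" by metis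
  have fin: "finite \<A>" using assms by (simp add: prototile_set_def)
  \<comment> \<open>The inserted 1 keeps minimum and maximum meaningful when there are no
    prototiles.\<close>
  define \<delta> where "\<delta> = Min (insert 1 (d ` \<A>))"
  define \<Delta> where "\<Delta> = Max (insert 1 (e ` \<A>))"
  have "\<delta> > 0" unfolding \<delta>_def using fin d by (subst Min_gr_iff) auto
  moreover have "\<Delta> \<ge> 1" unfolding \<Delta>_def using fin by (intro Max_ge) auto
  moreover have "(\<exists>z. ball z \<delta> \<subseteq> interior (supp t)) \<and> (\<forall>y\<in>supp t. \<forall>z\<in>supp t. dist y z < \<Delta>)"
    if T: "T \<in> tiling_space \<A>" "t \<in> T" for T t
  proof -
    obtain p v where p: "p \<in> \<A>" "t = translate_tile v p" using tiling_spaceD(2)[OF T] by blast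
    obtain z where z: "ball z (d p) \<subseteq> interior (supp p)" using d p by blast
    have "\<delta> \<le> d p" unfolding \<delta>_def using fin p by (intro Min_le) auto
    have "ball (z + v) \<delta> \<subseteq> (\<lambda>x. x + v) ` ball z (d p)"
    proof
      fix y assume "y \<in> ball (z + v) \<delta>"
      then have "y - v \<in> ball z (d p)" using \<open>\<delta> \<le> d p\<close> by (simp add: dist_norm algebra_simps)
      then show "y \<in> (\<lambda>x. x + v) ` ball z (d p)" by force
    qed
    then have "ball (z + v) \<delta> \<subseteq> interior (supp t)"
      unfolding p(2) interior_supp_translate using z by blast
    moreover have "e p \<le> \<Delta>" unfolding \<Delta>_def using fin p by (intro Max_ge) auto
    then have "\<forall>y\<in>supp t. \<forall>z\<in>supp t. dist y z < \<Delta>"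
      using e[OF p(1)] unfolding p(2) by (auto simp: dist_norm intro: less_le_trans)
    ultimately show ?thesis by blast
  qed
  moreover have "\<Delta> > 0" using \<open>\<Delta> \<ge> 1\<close> by linarith
  ultimately show ?thesis by blast
qed

locale tile_bounds =
  fixes \<A> :: "('l, 'n::finite) tile set" and \<delta> \<Delta> :: real
  assumes pos: "\<delta> > 0" "\<Delta> > 0"
    and inner: "T \<in> tiling_space \<A> \<Longrightarrow> t \<in> T \<Longrightarrow> \<exists>z. ball z \<delta> \<subseteq> interior (supp t)"
    and outer: "T \<in> tiling_space \<A> \<Longrightarrow> t \<in> T \<Longrightarrow> y \<in> supp t \<Longrightarrow> z \<in> supp t \<Longrightarrow> dist y z < \<Delta>"
begin

text \<open>The tile over the origin contains a ball of radius \<open>\<delta>\<close>, so it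
  overlaps in its interior with its copy under a shorter translation. Both belong to one tiling and
  therefore coincide.\<close>

lemma rigid:
  assumes T: "T \<in> tiling_space \<A>" and u: "norm u < \<delta>" and eq: "pat T x 1 = pat T (x + u) 1"
  shows "u = 0"
proof -
  have S: "shift x T \<in> tiling_space \<A>" by (rule shift_tiling_space[OF T])
  obtain t where t: "t \<in> shift x T" "0 \<in> supp t" using tiling_spaceD(3)[OF S] by blast
  then have "t \<in> pat T x 1" by (force simp: pat_def)
  then have "t \<in> shift (x + u) T" using eq pat_subset by blast
  then have t': "translate_tile u t \<in> shift x T" by (simp add: mem_shift_iff add.commute)
  obtain z where z: "ball z \<delta> \<subseteq> interior (supp t)" using inner[OF S t(1)] by blast
  then have "z \<in> interior (supp t)" "z - u \<in> interior (supp t)"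
    using pos u by (auto simp: dist_norm)
  then have "z \<in> interior (supp t)" "z \<in> interior (supp (translate_tile u t))"
    unfolding interior_supp_translate by force+
  then have "t = translate_tile u t" using tiling_spaceD(5)[OF S t(1) t'] by blast
  then show "u = 0" using translate_tile_fixed tiling_spaceD(1)[OF S t(1)] by metis
qed

text \<open>Centres of inscribed balls are \<open>\<delta>\<close> apart for distinct tiles, so
  packing applies to them.\<close>

lemma finite_pat:
  assumes T: "T \<in> tiling_space \<A>"
  shows "finite (pat T x r)"
proof -
  have S: "shift x T \<in> tiling_space \<A>" by (rule shift_tiling_space[OF T])
  obtain f where f: "\<And>t. t \<in> shift x T \<Longrightarrow> ball (f t) \<delta> \<subseteq> interior (supp t)" using inner[OF S] by metis
  have sep: "t = t'" if "t \<in> shift x T" "t' \<in> shift x T" "dist (f t) (f t') < \<delta>" for t t'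
  proof (rule tiling_spaceD(5)[OF S that(1,2)])
    show "f t \<in> interior (supp t)" using f[OF that(1)] pos by auto
    show "f t \<in> interior (supp t')" using f[OF that(2)] that(3) by (auto simp: dist_commute)
  qed
  have "f ` pat T x r \<subseteq> f ` shift x T \<inter> cball 0 (\<bar>r\<bar> + \<Delta>)"
  proof clarify
    fix t assume t: "t \<in> pat T x r"
    then have tS: "t \<in> shift x T" by (auto simp: pat_def)
    obtain z where z: "z \<in> supp t" "norm z < r" using t by (auto simp: pat_def)
    have "f t \<in> supp t" using f[OF tS] pos interior_subset by fastforce
    then have "dist z (f t) < \<Delta>" using outer[OF S tS z(1)] by blast
    then have "norm (f t) \<le> \<bar>r\<bar> + \<Delta>"
      using z(2) norm_triangle_ineq3[of "f t" z] by (simp add: dist_norm norm_minus_commute)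
    then show "f t \<in> f ` shift x T \<inter> cball 0 (\<bar>r\<bar> + \<Delta>)" using tS by simp
  qed
  moreover have "finite (f ` shift x T \<inter> cball 0 (\<bar>r\<bar> + \<Delta>))"
    by (rule card_separated(1)[of "\<delta> / 2"]) (use pos sep in \<open>auto simp: separated_def\<close>)
  ultimately have "finite (f ` pat T x r)" by (rule finite_subset)
  moreover have "inj_on f (pat T x r)"
  proof (rule inj_onI)
    fix t t' assume "t \<in> pat T x r" "t' \<in> pat T x r" "f t = f t'"
    then show "t = t'" using sep[of t t'] pos(1) pat_subset[of T x r] by fastforce
  qed
  ultimately show ?thesis using finite_imageD by blast
qed

text \<open>A tile that meets the smaller ball lies wholly in the larger one. It equals the cut
  piece of some tile \<open>s\<close> of the other tiling, and this piece is open and closed in the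
  connected support of \<open>s\<close>, hence all of it.\<close>

lemma restrict_eq_imp_pat_subset:
  assumes T: "T \<in> tiling_space \<A>" "T' \<in> tiling_space \<A>"
    and eq: "tiling_restrict T (ball 0 R) = tiling_restrict T' (ball 0 R)" and r: "r + \<Delta> \<le> R"
  shows "pat T 0 r \<subseteq> pat T' 0 r"
proof
  let ?B = "ball (0 :: real ^ 'n) R"
  fix t assume "t \<in> pat T 0 r"
  then obtain z where t: "t \<in> T" "z \<in> supp t" "norm z < r" by (auto simp: pat_def)
  have "supp t \<subseteq> ?B"
  proof
    fix y assume "y \<in> supp t"
    then have "dist y z < \<Delta>" using outer[OF T(1) t(1) _ t(2)] by blast
    then have "norm y < R" using t(3) r norm_triangle_ineq2[of y z] by (simp add: dist_norm)
    then show "y \<in> ?B" by simp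
  qed
  then have tB: "supp t \<inter> ?B = supp t" by blast
  then have "t \<in> tiling_restrict T ?B"
    using t(1,2) unfolding tiling_restrict_def mem_Collect_eq
    by (intro exI[of _ t]) (metis Int_iff empty_iff prod.collapse)
  then obtain s where s: "s \<in> T'" "t = (fst s, supp s \<inter> ?B)"
    unfolding eq unfolding tiling_restrict_def by blast
  have K: "supp t = supp s \<inter> ?B" using s(2) by (metis snd_conv)
  have "closedin (top_of_set (supp s)) (supp t)"
    using K is_tileD(1)[OF tiling_spaceD(1)[OF T(1) t(1)]] by (intro closed_subset) (auto intro: compact_imp_closed)
  moreover have "openin (top_of_set (supp s)) (supp t)"
    unfolding K by (rule openin_open_Int) simp
  ultimately have "supp t = supp s"
    using is_tileD(2)[OF tiling_spaceD(1)[OF T(2) s(1)]] t(2) unfolding connected_clopen by blast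
  then have "t = s" using s(2) by (metis fst_conv prod.collapse)
  then show "t \<in> pat T' 0 r" using s(1) t by (auto simp: pat_def)
qed

text \<open>Agreement holds for two tilings moved by less than \<open>e\<close> each. Undoing the
  first move costs radius 1 at most, and the second tiling is left displaced by less than
  \<open>2 * e\<close>.\<close>

lemma dist_less_imp_pat:
  assumes T: "T \<in> tiling_space \<A>" "T' \<in> tiling_space \<A>"
    and d: "tiling_dist T T' < e" and e: "e > 0" "e \<le> 1" "e * (r + \<Delta> + 1) \<le> 1"
  shows "\<exists>w. norm w < 2 * e \<and> pat T 0 r = pat T' w r"
proof -
  obtain \<epsilon> where \<epsilon>: "\<epsilon> \<in> agreement_radii T T'" "\<epsilon> < e"
    using tiling_dist_lessD[OF d e(2)] by blast
  obtain v v' where v: "0 < \<epsilon>" "norm v < \<epsilon>" "norm v' < \<epsilon>"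
     "tiling_restrict (shift v T) (ball 0 (1 / \<epsilon>)) = tiling_restrict (shift v' T') (ball 0 (1 / \<epsilon>))"
    using \<epsilon>(1) by (auto simp: agreement_radii_def)
  have "r + \<Delta> + 1 \<le> 1 / e" using e by (simp add: pos_le_divide_eq mult.commute)
  also have "1 / e \<le> 1 / \<epsilon>" using \<epsilon>(2) v(1) by (intro divide_left_mono) auto
  finally have R: "(r + 1) + \<Delta> \<le> 1 / \<epsilon>" by simp
  have "pat (shift v T) 0 (r + 1) = pat (shift v' T') 0 (r + 1)"
    using restrict_eq_imp_pat_subset[OF _ _ v(4) R] restrict_eq_imp_pat_subset[OF _ _ v(4)[symmetric] R]
      shift_tiling_space T by blast
  then have "pat T v (r + 1) = pat T' v' (r + 1)" by (simp add: pat_shift)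
  then have "pat T (v + - v) r = pat T' (v' + - v) r"
    by (rule pat_move) (use v \<epsilon>(2) e in simp)
  moreover have "norm (v' - v) < 2 * e" using v \<epsilon>(2) norm_triangle_ineq4[of v' v] by linarith
  ultimately show ?thesis by auto
qed

end

lemma pat_imp_dist_le:
  fixes T T' :: "('l, 'n::finite) tile set"
  assumes "pat T 0 r = pat T' 0 r" "1 \<le> e * r" "0 < e" "e < 1"
  shows "tiling_dist T T' \<le> e"
proof (rule tiling_dist_le)
  have "1 / e \<le> r" using assms by (simp add: pos_divide_le_eq mult.commute)
  then have *: "pat T 0 (1 / e) = pat T' 0 (1 / e)" using pat_restrict assms(1) by blast
  have "tiling_restrict X B = (\<lambda>t. (fst t, supp t \<inter> B)) ` {t \<in> X. supp t \<inter> B \<noteq> {}}"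
    for X :: "('l, 'n) tile set" and B
    unfolding tiling_restrict_def by blast
  then have "tiling_restrict T (ball 0 (1 / e)) = tiling_restrict T' (ball 0 (1 / e))"
    using * unfolding pat_def shift_0 by simp
  then show "e \<in> agreement_radii T T'"
    using assms(3,4) unfolding agreement_radii_def by (auto intro!: bexI[of _ 0])
qed

text \<open>Every tile is seen in the pattern of radius 1 about any of its points, so
  \<open>u\<close> maps the whole tiling to itself.\<close>

lemma non_periodic_pat:
  assumes T: "T \<in> tiling_space \<A>" and np: "non_periodic T" and eq: "\<And>x. pat T x 1 = pat T (x + u) 1"
  shows "u = 0"
proof -
  have "t \<in> T \<longleftrightarrow> t \<in> shift u T" if t: "is_tile t" for t
  proof -
    obtain z where z: "z \<in> supp t" using is_tile_nonempty t by blast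
    have "0 \<in> supp (translate_tile (- z) t) \<inter> ball 0 1" using z by force
    then have "translate_tile (- z) t \<in> pat T x 1 \<longleftrightarrow> translate_tile (x - z) t \<in> T" for x
      unfolding pat_def mem_Collect_eq mem_shift_iff translate_translate_tile by auto
    from this[of z] this[of "z + u"] eq[of z] show ?thesis by (simp add: mem_shift_iff)
  qed
  moreover have "is_tile t" if "t \<in> T \<or> t \<in> shift u T" for t
    using that tiling_spaceD(1)[OF T] tiling_spaceD(1)[OF shift_tiling_space[OF T]] by blast
  ultimately have "shift u T = T" by blast
  then show ?thesis using np by (simp add: non_periodic_def)
qed

section \<open>Compactness of orbit closures\<close>

lemma diagonal_constant:
  fixes f :: "nat \<Rightarrow> nat \<Rightarrow> 'a"
  assumes fin: "\<And>k. finite (range (f k))"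
  shows "\<exists>\<phi> \<tau>. strict_mono (\<phi> :: nat \<Rightarrow> nat) \<and> (\<forall>k. \<forall>n>k. f k (\<phi> n) = \<tau> k)"
proof -
  interpret subseqs "\<lambda>k s. \<exists>\<tau>. \<forall>n. f k (s n) = \<tau>"
  proof
    fix k and s :: "nat \<Rightarrow> nat" assume s: "strict_mono s"
    have "finite ((\<lambda>n. f k (s n)) ` UNIV)"
      by (rule finite_subset[OF _ fin[of k]]) auto
    then obtain n0 where "infinite {n \<in> UNIV. f k (s n) = f k (s n0)}"
      using pigeonhole_infinite[of UNIV "\<lambda>n. f k (s n)"] by auto
    then obtain r :: "nat \<Rightarrow> nat" where r: "strict_mono r" "\<forall>n. r n \<in> {n \<in> UNIV. f k (s n) = f k (s n0)}"
      using infinite_enumerate by blast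
    then show "\<exists>r' :: nat \<Rightarrow> nat. strict_mono r' \<and> (\<exists>\<tau>. \<forall>n. f k ((s \<circ> r') n) = \<tau>)"
      by (intro exI[of _ r]) auto
  qed
  have "\<exists>\<tau>. \<forall>n. f k ((diagseq \<circ> (+) (Suc k)) n) = \<tau>" for k
    by (rule diagseq_holds) auto
  then obtain \<tau> where \<tau>: "\<And>k n. f k (diagseq (Suc k + n)) = \<tau> k" by (metis comp_apply)
  have "f k (diagseq n) = \<tau> k" if "n > k" for n k
    using \<tau>[of k "n - Suc k"] that by simp
  then show ?thesis using subseq_diagseq by blast
qed

context tile_bounds
begin

text \<open>Closeness in the metric means agreement up to a small translation, and that translation
  is absorbed into the choice of \<open>x\<close>. Hence exact equality of patterns characterises
  the closure.\<close>

lemma orbit_closure_iff: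
  assumes T: "T \<in> tiling_space \<A>"
  shows "orbit_closure \<A> T = {Z \<in> tiling_space \<A>. \<forall>r. \<exists>x. pat Z 0 r = pat T x r}"
proof -
  interpret Metric_space "tiling_space \<A>" tiling_dist by (rule Metric_space_tiling_space)
  have oc: "orbit_closure \<A> T = {Z \<in> tiling_space \<A>. \<forall>e>0. \<exists>x. tiling_dist Z (shift x T) < e}"
    unfolding orbit_closure_def tiling_topology_def metric_closure_of
    using shift_tiling_space[OF T] by auto
  show ?thesis
    unfolding oc
  proof (intro Collect_cong conj_cong refl iffI allI impI)
    fix Z and r :: real assume Z: "Z \<in> tiling_space \<A>" and *: "\<forall>e>0. \<exists>x. tiling_dist Z (shift x T) < e"
    define e where "e = min 1 (1 / (\<bar>r\<bar> + \<Delta> + 1))"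
    have p: "\<bar>r\<bar> + \<Delta> + 1 > 0" using pos by linarith
    then have e: "e > 0" "e \<le> 1" by (auto simp: e_def)
    have "e * (r + \<Delta> + 1) \<le> e * (\<bar>r\<bar> + \<Delta> + 1)" using e by (intro mult_left_mono) auto
    also have "\<dots> \<le> 1 / (\<bar>r\<bar> + \<Delta> + 1) * (\<bar>r\<bar> + \<Delta> + 1)" using p by (intro mult_right_mono) (auto simp: e_def)
    also have "\<dots> = 1" using p by simp
    finally have e': "e * (r + \<Delta> + 1) \<le> 1" .
    obtain x where "tiling_dist Z (shift x T) < e" using * e by blast
    from dist_less_imp_pat[OF Z shift_tiling_space[OF T] this e e']
    obtain w where "pat Z 0 r = pat (shift x T) w r" by blast
    then show "\<exists>x. pat Z 0 r = pat T x r" by (auto simp: pat_shift)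
  next
    fix Z and e :: real assume Z: "\<forall>r. \<exists>x. pat Z 0 r = pat T x r" and e: "e > 0"
    define e' where "e' = min (e / 2) (1 / 2)"
    have e': "0 < e'" "e' < 1" "e' < e" using e by (auto simp: e'_def)
    obtain x where "pat Z 0 (1 / e') = pat T x (1 / e')" using Z by blast
    then have "pat Z 0 (1 / e') = pat (shift x T) 0 (1 / e')" by (simp add: pat_shift)
    then have "tiling_dist Z (shift x T) \<le> e'" by (rule pat_imp_dist_le) (use e' in auto)
    then show "\<exists>x. tiling_dist Z (shift x T) < e" using e' by (intro exI[of _ x]) simp
  qed
qed

lemma orbit_closure_pat:
  assumes T: "T \<in> tiling_space \<A>" and Z: "Z \<in> orbit_closure \<A> T"
  shows "\<exists>x. pat Z y r = pat T x r"
proof -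
  obtain x where "pat Z 0 (r + norm y) = pat T x (r + norm y)" using Z unfolding orbit_closure_iff[OF T] by blast
  then have "pat Z (0 + y) r = pat T (x + y) r" by (rule pat_move) simp
  then show ?thesis by auto
qed

lemma orbit_closure_shift:
  assumes T: "T \<in> tiling_space \<A>" and Z: "Z \<in> orbit_closure \<A> T"
  shows "shift v Z \<in> orbit_closure \<A> T"
  unfolding orbit_closure_iff[OF T]
  using shift_tiling_space orbit_closure_pat[OF T Z] Z by (auto simp: orbit_closure_iff[OF T] pat_shift)

lemma orbit_closure_self: "T \<in> tiling_space \<A> \<Longrightarrow> T \<in> orbit_closure \<A> T"
  by (auto simp: orbit_closure_iff)

text \<open>Sequential compactness: along a diagonal subsequence the pattern of each integer radius
  is eventually constant, and the limit is the union of these constant patterns.\<close>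

lemma limit_tiling:
  fixes y :: "nat \<Rightarrow> real ^ 'n"
  assumes T: "T \<in> tiling_space \<A>" and types: "\<And>r. r \<ge> 1 \<Longrightarrow> finite (range (\<lambda>n. pat T (y n) r))"
  shows "\<exists>Z\<in>orbit_closure \<A> T. \<exists>\<phi> :: nat \<Rightarrow> nat. strict_mono \<phi> \<and> (\<forall>r. \<exists>N. \<forall>n\<ge>N. pat Z 0 r = pat T (y (\<phi> n)) r)"
proof -
  have "finite (range (\<lambda>n. pat T (y n) (real (Suc k))))" for k by (rule types) simp
  then have "\<exists>\<phi> \<tau>. strict_mono (\<phi> :: nat \<Rightarrow> nat) \<and> (\<forall>k. \<forall>n>k. pat T (y (\<phi> n)) (real (Suc k)) = \<tau> k)"
    by (rule diagonal_constant)
  then obtain \<phi> :: "nat \<Rightarrow> nat" and \<tau> where \<phi>: "strict_mono \<phi>"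
      and "\<forall>k. \<forall>n>k. pat T (y (\<phi> n)) (real (Suc k)) = \<tau> k" by (elim exE conjE)
  then have \<tau>: "pat T (y (\<phi> n)) (real (Suc k)) = \<tau> k" if "n > k" for k n using that by simp
  have sub\<tau>: "\<tau> k \<subseteq> shift (y (\<phi> n)) T" if "n > k" for n k
    unfolding \<tau>[OF that, symmetric] by (rule pat_subset)
  define Z where "Z = (\<Union>k. \<tau> k)"
  have Zk: "pat Z 0 (real (Suc m)) = \<tau> m" for m
  proof (intro equalityI subsetI)
    fix t assume t: "t \<in> pat Z 0 (real (Suc m))"
    then obtain k where "t \<in> \<tau> k" unfolding pat_def Z_def by auto
    then have "t \<in> shift (y (\<phi> (Suc (max k m)))) T" using sub\<tau>[of k "Suc (max k m)"] by (meson le_imp_less_Suc max.cobounded1 subsetD)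
    then have "t \<in> pat T (y (\<phi> (Suc (max k m)))) (real (Suc m))" using t unfolding pat_def by blast
    then show "t \<in> \<tau> m" using \<tau>[of m "Suc (max k m)"] by auto
  next
    fix t assume t: "t \<in> \<tau> m"
    then have "t \<in> pat T (y (\<phi> (Suc m))) (real (Suc m))" using \<tau>[of m "Suc m"] by auto
    then show "t \<in> pat Z 0 (real (Suc m))" using t unfolding pat_def Z_def by auto
  qed
  have conv: "pat Z 0 r = pat T (y (\<phi> n)) r" if "n > nat \<lceil>r\<rceil>" for r n
  proof -
    have "pat Z 0 (real (Suc (nat \<lceil>r\<rceil>))) = pat T (y (\<phi> n)) (real (Suc (nat \<lceil>r\<rceil>)))"
      using Zk \<tau>[OF that] by simp
    then show ?thesis by (rule pat_restrict) linarith
  qed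
  have Zt: "Z \<in> tiling_space \<A>"
  proof -
    \<comment> \<open>Any two tiles of the limit lie in a common translate of \<open>T\<close>, from
      which disjointness of interiors is inherited.\<close>
    have sub: "\<exists>x. t \<in> shift x T \<and> t' \<in> shift x T" if *: "t \<in> Z" "t' \<in> Z" for t t'
    proof -
      obtain k k' where k: "t \<in> \<tau> k" "t' \<in> \<tau> k'" using * unfolding Z_def by blast
      then have "t \<in> shift (y (\<phi> (Suc (max k k')))) T" "t' \<in> shift (y (\<phi> (Suc (max k k')))) T"
        using sub\<tau>[of k "Suc (max k k')"] sub\<tau>[of k' "Suc (max k k')"]
        by (meson le_imp_less_Suc max.cobounded1 max.cobounded2 subsetD)+
      then show ?thesis by blast
    qed
    have equiv: "\<exists>p\<in>\<B>. tile_equiv p t" if B: "T \<in> tiling_space \<B>" and t: "t \<in> Z" for \<B> t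
    proof -
      obtain x where "t \<in> shift x T" using sub[OF t t] by blast
      then show ?thesis
        using tiling_spaceD(2)[OF shift_tiling_space[OF B]] unfolding tile_equiv_def by blast
    qed
    have tile: "is_tile t" if t: "t \<in> Z" for t
    proof -
      obtain x where "t \<in> shift x T" using sub[OF t t] by blast
      then show ?thesis by (rule tiling_spaceD(1)[OF shift_tiling_space[OF T]])
    qed
    have "countable (\<tau> k)" for k
    proof (rule countable_subset)
      show "\<tau> k \<subseteq> shift (y (\<phi> (Suc k))) T" by (rule sub\<tau>) simp
      show "countable (shift (y (\<phi> (Suc k))) T)" by (rule tiling_spaceD(4)[OF shift_tiling_space[OF T]])
    qed
    then have "countable Z" unfolding Z_def by blast
    moreover have "disjoint_interiors Z"
      unfolding disjoint_interiors_def
    proof (intro ballI impI)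
      fix t t' assume t: "t \<in> Z" "t' \<in> Z" "t \<noteq> t'"
      obtain x where "t \<in> shift x T" "t' \<in> shift x T" using sub[OF t(1,2)] by blast
      then have "z \<notin> interior (supp t')" if "z \<in> interior (supp t)" for z
        using tiling_spaceD(5)[OF shift_tiling_space[OF T], of t x t' z] t(3) that by argo
      then show "interior (supp t) \<inter> interior (supp t') = {}" by blast
    qed
    moreover have "tiles_support Z = UNIV"
    proof (intro equalityI subsetI UNIV_I)
      fix z :: "real ^ 'n"
      define m where "m = nat \<lceil>norm z\<rceil>"
      obtain t where t: "t \<in> shift (y (\<phi> (Suc m))) T" "z \<in> supp t"
        using tiling_spaceD(3)[OF shift_tiling_space[OF T], of "y (\<phi> (Suc m))" z] by (elim bexE)
      have "norm z < real (Suc m)" unfolding m_def by linarith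
      then have "t \<in> pat T (y (\<phi> (Suc m))) (real (Suc m))" using t unfolding pat_def by auto
      then have "t \<in> \<tau> m" unfolding \<tau>[OF lessI] .
      then have "t \<in> Z" unfolding Z_def by blast
      then show "z \<in> tiles_support Z" using t unfolding tiles_support_def by blast
    qed
    moreover have "\<exists>\<A>. prototile_set \<A> \<and> (\<forall>t\<in>Z. \<exists>p\<in>\<A>. tile_equiv p t)"
    proof -
      obtain \<B> where \<B>: "prototile_set \<B>" "\<forall>t\<in>T. \<exists>p\<in>\<B>. tile_equiv p t"
        using T unfolding tiling_space_def is_tiling_def mem_Collect_eq by (elim conjE exE)
      then have "T \<in> tiling_space \<B>" using T unfolding tiling_space_def by simp
      then show ?thesis using \<B>(1) equiv by blast
    qed
    ultimately show ?thesis using tile equiv[OF T] unfolding tiling_space_def is_tiling_def by simp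
  qed
  have "\<exists>x. pat Z 0 r = pat T x r" for r using conv[of r "Suc (nat \<lceil>r\<rceil>)"] by blast
  then have "Z \<in> orbit_closure \<A> T" unfolding orbit_closure_iff[OF T] using Zt by blast
  moreover have "\<exists>N. \<forall>n\<ge>N. pat Z 0 r = pat T (y (\<phi> n)) r" for r
    using conv[of r] by (intro exI[of _ "Suc (nat \<lceil>r\<rceil>)"]) (simp add: Suc_le_eq)
  ultimately show ?thesis using \<phi> by blast
qed

end

section \<open>Factor maps as local codes\<close>

locale tiling_factor = A: tile_bounds \<A> \<delta> \<Delta> + B: tile_bounds \<B> \<delta>' \<Delta>'
  for \<A> :: "('l, 'n::finite) tile set" and \<delta> \<Delta> and \<B> :: "('k, 'n) tile set" and \<delta>' \<Delta>' +
  fixes X T \<pi>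
  assumes X: "X \<in> tiling_space \<A>" and T: "T \<in> tiling_space \<B>"
    and fm: "factor_map \<A> (orbit_closure \<A> X) \<B> (orbit_closure \<B> T) \<pi>"
    and recurrent: "\<And>x r. \<exists>L. \<forall>y. \<exists>y'. dist y y' \<le> L \<and> pat X y' r = pat X x r"
    and types: "\<And>r. r \<ge> 1 \<Longrightarrow> finite {pat X y r |y. pat X y 1 = pat X 0 1}"
begin

abbreviation "\<Omega> \<equiv> orbit_closure \<A> X"

lemma \<pi>_in: "Z \<in> \<Omega> \<Longrightarrow> \<pi> Z \<in> orbit_closure \<B> T"
  using fm unfolding factor_map_def by blast

lemma \<pi>_tiling: "Z \<in> \<Omega> \<Longrightarrow> \<pi> Z \<in> tiling_space \<B>"
  using \<pi>_in B.orbit_closure_iff[OF T] by blast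

lemma \<pi>_shift: "Z \<in> \<Omega> \<Longrightarrow> \<pi> (shift v Z) = shift v (\<pi> Z)"
  using fm unfolding factor_map_def by blast

lemma \<Omega>_tiling: "Z \<in> \<Omega> \<Longrightarrow> Z \<in> tiling_space \<A>"
  using A.orbit_closure_iff[OF X] by blast

lemma continuous_at_tiling:
  assumes Z: "Z \<in> \<Omega>" and e: "e > 0"
  shows "\<exists>d>0. \<forall>Z'\<in>\<Omega>. tiling_dist Z Z' < d \<longrightarrow> tiling_dist (\<pi> Z) (\<pi> Z') < e"
proof -
  interpret MA: Metric_space "tiling_space \<A>" tiling_dist by (rule Metric_space_tiling_space)
  interpret MB: Metric_space "tiling_space \<B>" tiling_dist by (rule Metric_space_tiling_space)
  let ?XA = "subtopology (tiling_topology \<A>) \<Omega>" and ?XB = "subtopology (tiling_topology \<B>) (orbit_closure \<B> T)"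
  have cm: "continuous_map ?XA ?XB \<pi>" using fm unfolding factor_map_def by blast
  define U where "U = MB.mball (\<pi> Z) e \<inter> orbit_closure \<B> T"
  have "openin ?XB U"
    unfolding U_def tiling_topology_def by (intro openin_subtopology_Int MB.openin_mball)
  then have "openin ?XA {z \<in> topspace ?XA. \<pi> z \<in> U}" using cm by (simp add: continuous_map_def)
  then obtain V where V: "openin MA.mtopology V" "{z \<in> topspace ?XA. \<pi> z \<in> U} = V \<inter> \<Omega>"
    unfolding openin_subtopology tiling_topology_def by (elim exE conjE)
  have top: "topspace ?XA = \<Omega>" using \<Omega>_tiling by (auto simp: tiling_topology_def)
  have "Z \<in> V"
  proof -
    have "\<pi> Z \<in> U" unfolding U_def using \<pi>_tiling[OF Z] \<pi>_in[OF Z] e by simp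
    then have "Z \<in> {z \<in> topspace ?XA. \<pi> z \<in> U}" unfolding top using Z by simp
    then show ?thesis unfolding V(2) by simp
  qed
  then obtain d where d: "d > 0" "MA.mball Z d \<subseteq> V" using V(1) unfolding MA.openin_mtopology by blast
  have "tiling_dist (\<pi> Z) (\<pi> Z') < e" if "Z' \<in> \<Omega>" "tiling_dist Z Z' < d" for Z'
  proof -
    have "Z' \<in> MA.mball Z d" using that \<Omega>_tiling Z by simp
    then have "Z' \<in> V \<inter> \<Omega>" using d that by blast
    then have "\<pi> Z' \<in> U" unfolding V(2)[symmetric] by simp
    then show ?thesis unfolding U_def by simp
  qed
  then show ?thesis using d(1) by blast
qed

lemma continuous_pat:
  assumes Z: "Z \<in> \<Omega>" and e: "e > 0"
  shows "\<exists>r'. \<forall>Z'\<in>\<Omega>. pat Z 0 r' = pat Z' 0 r' \<longrightarrow> (\<exists>w. norm w < e \<and> pat (\<pi> Z) 0 r = pat (\<pi> Z') w r)"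
proof -
  define \<epsilon> where "\<epsilon> = min (min 1 (e / 2)) (1 / (\<bar>r\<bar> + \<Delta>' + 1))"
  have p: "\<bar>r\<bar> + \<Delta>' + 1 > 0" using B.pos by linarith
  then have \<epsilon>: "\<epsilon> > 0" "\<epsilon> \<le> 1" "2 * \<epsilon> \<le> e" using e by (auto simp: \<epsilon>_def)
  have "\<epsilon> * (r + \<Delta>' + 1) \<le> \<epsilon> * (\<bar>r\<bar> + \<Delta>' + 1)" using \<epsilon> by (intro mult_left_mono) auto
  also have "\<dots> \<le> 1 / (\<bar>r\<bar> + \<Delta>' + 1) * (\<bar>r\<bar> + \<Delta>' + 1)" using p by (intro mult_right_mono) (auto simp: \<epsilon>_def)
  also have "\<dots> = 1" using p by simp
  finally have \<epsilon>': "\<epsilon> * (r + \<Delta>' + 1) \<le> 1" .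
  obtain d where d: "d > 0" "\<And>Z'. Z' \<in> \<Omega> \<Longrightarrow> tiling_dist Z Z' < d \<Longrightarrow> tiling_dist (\<pi> Z) (\<pi> Z') < \<epsilon>"
    using continuous_at_tiling[OF Z \<epsilon>(1)] by blast
  define d' where "d' = min (d / 2) (1 / 2)"
  have d': "0 < d'" "d' < 1" "d' < d" using d(1) by (auto simp: d'_def)
  have "\<exists>w. norm w < e \<and> pat (\<pi> Z) 0 r = pat (\<pi> Z') w r"
    if Z': "Z' \<in> \<Omega>" "pat Z 0 (1 / d') = pat Z' 0 (1 / d')" for Z'
  proof -
    have "tiling_dist Z Z' \<le> d'" by (rule pat_imp_dist_le[OF Z'(2)]) (use d' in auto)
    then have "tiling_dist (\<pi> Z) (\<pi> Z') < \<epsilon>" using d(2)[OF Z'(1)] d' by simp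
    from B.dist_less_imp_pat[OF \<pi>_tiling[OF Z] \<pi>_tiling[OF Z'(1)] this \<epsilon>(1,2) \<epsilon>']
    show ?thesis using \<epsilon>(3) by force
  qed
  then show ?thesis by blast
qed

text \<open>Compactness by contradiction: counterexamples that agree on growing balls accumulate,
  after bounded moves, at one tiling \<open>L\<close>. Continuity at \<open>L\<close> compares both
  images with that of \<open>L\<close> and so with each other.\<close>

lemma uniformly_continuous_pat:
  assumes e: "e > 0"
  shows "\<exists>s. \<forall>Z\<in>\<Omega>. \<forall>Z'\<in>\<Omega>. pat Z 0 s = pat Z' 0 s \<longrightarrow> (\<exists>w. norm w < e \<and> pat (\<pi> Z) 0 r = pat (\<pi> Z') w r)"
proof (rule ccontr)
  assume "\<not> ?thesis"
  then have "\<forall>n::nat. \<exists>Z Z'. Z \<in> \<Omega> \<and> Z' \<in> \<Omega> \<and> pat Z 0 (real n) = pat Z' 0 (real n) \<and>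
      \<not> (\<exists>w. norm w < e \<and> pat (\<pi> Z) 0 r = pat (\<pi> Z') w r)" by blast
  then obtain Z Z' where Z: "\<And>n. Z n \<in> \<Omega>" "\<And>n. Z' n \<in> \<Omega>" "\<And>n. pat (Z n) 0 (real n) = pat (Z' n) 0 (real n)"
      and no: "\<And>n. \<not> (\<exists>w. norm w < e \<and> pat (\<pi> (Z n)) 0 r = pat (\<pi> (Z' n)) w r)" by metis
  have "\<forall>n. \<exists>x. pat (Z n) 0 (real n) = pat X x (real n)"
    using A.orbit_closure_pat[OF X Z(1)] by blast
  then obtain x where x: "\<And>n. pat (Z n) 0 (real n) = pat X (x n) (real n)" by metis
  \<comment> \<open>Patterns vary continuously with their centre, so only those at returns of the
    pattern of radius 1 are known to be finite in number. The base points are moved to such returns,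
    by at most \<open>D\<close>.\<close>
  obtain D where D: "\<forall>y. \<exists>y'. dist y y' \<le> D \<and> pat X y' 1 = pat X 0 1" using recurrent by blast
  then have "\<forall>n. \<exists>y'. dist (x n) y' \<le> D \<and> pat X y' 1 = pat X 0 1" by blast
  then obtain y where y: "\<And>n. dist (x n) (y n) \<le> D" "\<And>n. pat X (y n) 1 = pat X 0 1" by metis
  have "finite (range (\<lambda>n. pat X (y n) r))" if "r \<ge> 1" for r
    by (rule finite_subset[OF _ types[OF that]]) (use y in auto)
  then obtain L and \<phi> :: "nat \<Rightarrow> nat" where L: "L \<in> \<Omega>" "strict_mono \<phi>" "\<And>r. \<exists>N. \<forall>n\<ge>N. pat L 0 r = pat X (y (\<phi> n)) r"
    using A.limit_tiling[OF X] by blast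
  \<comment> \<open>The extra radius \<open>D + e\<close> pays for undoing the move \<open>v\<close>
    to the return and the translation \<open>w\<close> from continuity.\<close>
  obtain r' where r': "\<And>Z'. Z' \<in> \<Omega> \<Longrightarrow> pat L 0 r' = pat Z' 0 r' \<Longrightarrow>
      \<exists>w. norm w < e / 2 \<and> pat (\<pi> L) 0 (r + D + e) = pat (\<pi> Z') w (r + D + e)"
    using continuous_pat[OF L(1), of "e / 2" "r + D + e"] e by (metis half_gt_zero)
  obtain N :: nat where N: "\<And>n. n \<ge> N \<Longrightarrow> pat L 0 r' = pat X (y (\<phi> n)) r'" using L(3) by blast
  define n where "n = max N (nat \<lceil>r' + D\<rceil>)"
  define m where "m = \<phi> n"
  define v where "v = y m - x m"
  have "real n \<le> real m" unfolding m_def using seq_suble[OF L(2)] by simp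
  then have m: "r' + D \<le> real m" unfolding n_def by linarith
  have v: "norm v \<le> D" using y(1)[of m] by (simp add: v_def dist_norm norm_minus_commute)
  have near: "\<exists>w. norm w < e / 2 \<and> pat (\<pi> L) 0 (r + D + e) = pat (\<pi> W) (v + w) (r + D + e)"
    if W: "W \<in> \<Omega>" "pat W 0 (real m) = pat X (x m) (real m)" for W
  proof -
    have "pat W (0 + v) r' = pat X (x m + v) r'" by (rule pat_move[OF W(2)]) (use v m in linarith)
    then have "pat (shift v W) 0 r' = pat X (y m) r'" by (simp add: pat_shift v_def)
    then have "pat L 0 r' = pat (shift v W) 0 r'" using N[of n] by (simp add: m_def n_def)
    from r'[OF A.orbit_closure_shift[OF X W(1)] this]
    show ?thesis by (simp add: \<pi>_shift[OF W(1)] pat_shift)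
  qed
  obtain w where w: "norm w < e / 2" "pat (\<pi> L) 0 (r + D + e) = pat (\<pi> (Z m)) (v + w) (r + D + e)"
    using near[OF Z(1) x] by blast
  obtain w' where w': "norm w' < e / 2" "pat (\<pi> L) 0 (r + D + e) = pat (\<pi> (Z' m)) (v + w') (r + D + e)"
    using near[OF Z(2)] x Z(3) by metis
  have "pat (\<pi> (Z m)) (v + w + - (v + w)) r = pat (\<pi> (Z' m)) (v + w' + - (v + w)) r"
  proof (rule pat_move)
    show "pat (\<pi> (Z m)) (v + w) (r + D + e) = pat (\<pi> (Z' m)) (v + w') (r + D + e)" using w w' by simp
    show "norm (- (v + w)) + r \<le> r + D + e" unfolding norm_minus_cancel
      using norm_triangle_ineq[of v w] v w(1) e by linarith
  qed
  then have "pat (\<pi> (Z m)) 0 r = pat (\<pi> (Z' m)) (w' - w) r" by simp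
  moreover have "norm (w' - w) < e" using norm_triangle_ineq4[of w' w] w w' by linarith
  ultimately show False using no by blast
qed

text \<open>The small translation relating two images is locally constant by rigidity, hence the same
  all over a ball on which the originals agree.\<close>

lemma local_code:
  "\<exists>s. \<forall>Z\<in>\<Omega>. \<forall>Z'\<in>\<Omega>. \<forall>x x' \<rho>. pat Z x (\<rho> + s) = pat Z' x' (\<rho> + s) \<longrightarrow>
     (\<exists>w. norm w < 1 \<and> pat (\<pi> Z) x \<rho> = pat (\<pi> Z') (x' + w) \<rho>)"
proof -
  \<comment> \<open>Two translations shorter than \<open>\<delta>' / 2\<close> differ by less than
    \<open>\<delta>'\<close>, where rigidity applies.\<close>
  define e where "e = min 1 (\<delta>' / 2)"
  have e: "e > 0" "e \<le> 1" "2 * e \<le> \<delta>'" using B.pos by (auto simp: e_def)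
  \<comment> \<open>Patterns of radius 2 about points at distance at most 1 have a pattern of radius
    1 in common, on which their translations are compared.\<close>
  obtain s where s: "\<And>Z Z'. Z \<in> \<Omega> \<Longrightarrow> Z' \<in> \<Omega> \<Longrightarrow> pat Z 0 s = pat Z' 0 s \<Longrightarrow>
      \<exists>w. norm w < e \<and> pat (\<pi> Z) 0 2 = pat (\<pi> Z') w 2"
    using uniformly_continuous_pat[OF e(1), of 2] by blast
  have "\<exists>w. norm w < 1 \<and> pat (\<pi> Z) x \<rho> = pat (\<pi> Z') (x' + w) \<rho>"
    if Z: "Z \<in> \<Omega>" "Z' \<in> \<Omega>" and eq: "pat Z x (\<rho> + s) = pat Z' x' (\<rho> + s)" for Z Z' x x' \<rho>
  proof (cases "\<rho> > 0")
    case False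
    then have "ball (0 :: real ^ 'n) \<rho> = {}" by simp
    then show ?thesis by (intro exI[of _ 0]) (simp add: pat_def del: ball_eq_empty)
  next
    case True
    have "\<exists>w. norm w < e \<and> pat (\<pi> Z) (x + u) 2 = pat (\<pi> Z') (x' + u + w) 2" if "norm u < \<rho>" for u
    proof -
      have "pat Z (x + u) s = pat Z' (x' + u) s" by (rule pat_move[OF eq]) (use that in linarith)
      then have "pat (shift (x + u) Z) 0 s = pat (shift (x' + u) Z') 0 s" by (simp add: pat_shift)
      from s[OF A.orbit_closure_shift[OF X Z(1)] A.orbit_closure_shift[OF X Z(2)] this]
      show ?thesis by (simp add: \<pi>_shift[OF Z(1)] \<pi>_shift[OF Z(2)] pat_shift)
    qed
    then obtain f where f: "\<And>u. norm u < \<rho> \<Longrightarrow> norm (f u) < e"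
      "\<And>u. norm u < \<rho> \<Longrightarrow> pat (\<pi> Z) (x + u) 2 = pat (\<pi> Z') (x' + u + f u) 2" by metis
    have step: "f u = f v" if uv: "norm u < \<rho>" "norm v < \<rho>" "norm (v - u) \<le> 1" for u v
    proof -
      have "pat (\<pi> Z) (x + u + (v - u)) 1 = pat (\<pi> Z') (x' + u + f u + (v - u)) 1"
        by (rule pat_move[OF f(2)]) (use uv in auto)
      then have "pat (\<pi> Z) (x + v) 1 = pat (\<pi> Z') (x' + v + f u) 1" by (simp add: algebra_simps)
      moreover have "pat (\<pi> Z) (x + v) 1 = pat (\<pi> Z') (x' + v + f v) 1"
        by (rule pat_restrict[OF f(2)]) (use uv in auto)
      ultimately have "pat (\<pi> Z') (x' + v + f u) 1 = pat (\<pi> Z') (x' + v + f u + (f v - f u)) 1"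
        by (simp add: add.assoc)
      moreover have "norm (f v - f u) < \<delta>'"
        using f(1)[OF uv(1)] f(1)[OF uv(2)] e(3) norm_triangle_ineq4[of "f v" "f u"] by linarith
      ultimately have "f v - f u = 0" using B.rigid[OF \<pi>_tiling[OF Z(2)]] by blast
      then show ?thesis by simp
    qed
    \<comment> \<open>Walk along the segment from the origin: scaling \<open>u\<close> by
      \<open>n / Suc n\<close> moves it by at most 1.\<close>
    have const: "f u = f 0" if "norm u \<le> real n" "norm u < \<rho>" for n u
      using that
    proof (induction n arbitrary: u)
      case (Suc n)
      let ?c = "real n / real (Suc n)" and ?v = "(real n / real (Suc n)) *\<^sub>R u"
      have "norm ?v \<le> real n"
        using Suc.prems(1) mult_left_mono[of "norm u" "real (Suc n)" ?c] by simp
      moreover have "norm ?v \<le> norm u" using mult_right_mono[of ?c 1 "norm u"] by simp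
      moreover have "u - ?v = (1 / real (Suc n)) *\<^sub>R u"
      proof -
        have "u - ?v = (1 - ?c) *\<^sub>R u" by (simp add: scaleR_left_diff_distrib)
        also have "1 - ?c = 1 / real (Suc n)" by (simp add: field_simps)
        finally show ?thesis .
      qed
      then have "norm (u - ?v) \<le> 1" using Suc.prems(1) by (simp add: pos_divide_le_eq)
      ultimately show ?case using Suc.IH[of ?v] step[of ?v u] Suc.prems(2) by simp
    qed auto
    have "pat (\<pi> Z) x \<rho> = pat (\<pi> Z') (x' + f 0) \<rho>"
    proof (rule pat_local)
      fix u :: "real ^ 'n" assume u: "norm u < \<rho>"
      have "f u = f 0" using const[of u "nat \<lceil>norm u\<rceil>"] u by linarith
      then show "pat (\<pi> Z) (x + u) 1 = pat (\<pi> Z') (x' + f 0 + u) 1"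
        using pat_restrict[OF f(2)[OF u], of 1] by (simp add: add_ac)
    qed
    moreover have "norm (f 0) < 1" using f(1)[of 0] True e by simp
    ultimately show ?thesis by blast
  qed
  then show ?thesis by blast
qed

end

section \<open>Self-similar tilings\<close>

text \<open>By invariance of domain the image of the open ball is open, and by continuity it is
  dense in the tile.\<close>

lemma closure_interior_tile:
  fixes t :: "('l, 'n::finite) tile"
  assumes "is_tile t"
  shows "supp t \<subseteq> closure (interior (supp t))"
proof -
  have "(cball 0 1 :: (real ^ 'n) set) homeomorphic supp t"
    using assms unfolding is_tile_def by (simp add: homeomorphic_sym[of "supp t"])
  then obtain f g where fg: "homeomorphism (cball 0 1 :: (real ^ 'n) set) (supp t) f g"
    unfolding homeomorphic_def by blast
  have f: "continuous_on (cball 0 1) f" "f ` cball 0 1 = supp t"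
    using homeomorphism_cont1[OF fg] homeomorphism_image1[OF fg] by auto
  have inj: "inj_on f (cball 0 1)"
    by (rule inj_on_inverseI[of _ g]) (rule homeomorphism_apply1[OF fg])
  have "open (f ` ball 0 1)"
  proof (rule invariance_of_domain)
    show "continuous_on (ball 0 1) f" by (rule continuous_on_subset[OF f(1)]) auto
    show "inj_on f (ball 0 1)" by (rule inj_on_subset[OF inj]) auto
  qed simp
  then have "f ` ball 0 1 \<subseteq> interior (supp t)"
    by (intro interior_maximal) (use f(2) in auto)
  then have sub: "closure (f ` ball 0 1) \<subseteq> closure (interior (supp t))" by (rule closure_mono)
  have "f ` closure (ball 0 1) \<subseteq> closure (f ` ball 0 1)"
    by (rule continuous_image_closure_subset[OF f(1)]) simp
  then show ?thesis using sub f(2) by simp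
qed

lemma interior_Union_closed_empty:
  assumes "finite F" "\<And>s. s \<in> F \<Longrightarrow> closed s \<and> interior s = {}"
  shows "interior (\<Union>F) = {}"
  using assms
proof (induction F rule: finite_induct)
  case (insert s F)
  have "interior (\<Union>F \<union> s) = interior (\<Union>F)"
    by (rule interior_closed_Un_empty_interior) (use insert in auto)
  then show ?case using insert by (simp add: Un_commute)
qed simp

context tile_bounds
begin

text \<open>A pattern already covers its ball. An additional tile would have a nonempty open part
  inside the ball that avoids the interiors of the other tiles, so finitely many tile boundaries
  would cover an open set; but they are closed with empty interior.\<close>

lemma pat_subset_imp_eq:
  assumes Z: "Z \<in> tiling_space \<A>" "Z' \<in> tiling_space \<A>" and sub: "pat Z x r \<subseteq> pat Z' x' r"
  shows "pat Z x r = pat Z' x' r"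
proof (rule antisym[OF sub], rule subsetI)
  note S = shift_tiling_space[OF Z(1), of x] and S' = shift_tiling_space[OF Z(2), of x']
  fix t' assume t': "t' \<in> pat Z' x' r"
  then have t'S: "t' \<in> shift x' Z'" by (simp add: pat_def)
  define U where "U = interior (supp t') \<inter> ball 0 r"
  obtain z where z: "z \<in> supp t'" "z \<in> ball 0 r" using t' by (auto simp: pat_def)
  have "z \<in> closure (interior (supp t'))"
    using closure_interior_tile[OF tiling_spaceD(1)[OF S' t'S]] z(1) by blast
  then have "ball 0 r \<inter> closure (interior (supp t')) \<noteq> {}" using z(2) by blast
  then have "U \<noteq> {}"
    unfolding U_def open_Int_closure_eq_empty[OF open_ball] by (simp add: Int_commute)
  have "open U" unfolding U_def by (intro open_Int open_interior open_ball)
  have "U \<subseteq> (\<Union>t\<in>pat Z x r. supp t)"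
  proof
    fix u assume u: "u \<in> U"
    obtain t where t: "t \<in> shift x Z" "u \<in> supp t" using tiling_spaceD(3)[OF S, of u] by (elim bexE)
    then have "t \<in> pat Z x r" using u unfolding pat_def U_def by auto
    then show "u \<in> (\<Union>t\<in>pat Z x r. supp t)" using t(2) by blast
  qed
  show "t' \<in> pat Z x r"
  proof (rule ccontr)
    assume no: "t' \<notin> pat Z x r"
    define F where "F = (\<lambda>t. supp t - interior (supp t)) ` pat Z x r"
    have "U \<subseteq> \<Union>F"
    proof
      fix u assume u: "u \<in> U"
      then obtain t where t: "t \<in> pat Z x r" "u \<in> supp t"
        using \<open>U \<subseteq> (\<Union>t\<in>pat Z x r. supp t)\<close> by blast
      then have tS': "t \<in> shift x' Z'" using sub pat_subset by blast
      have "u \<in> interior (supp t')" using u unfolding U_def by blast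
      moreover have "t \<noteq> t'" using t(1) no by blast
      ultimately have "u \<notin> interior (supp t)" using tiling_spaceD(5)[OF S' tS' t'S, of u] by blast
      then show "u \<in> \<Union>F" using t unfolding F_def by blast
    qed
    then have "U \<subseteq> interior (\<Union>F)" using \<open>open U\<close> by (rule interior_maximal)
    moreover have "interior (\<Union>F) = {}"
    proof (rule interior_Union_closed_empty)
      show "finite F" unfolding F_def using finite_pat[OF Z(1)] by simp
      fix s assume "s \<in> F"
      then obtain t where t: "t \<in> pat Z x r" "s = supp t - interior (supp t)" unfolding F_def by blast
      have "compact (supp t)" using is_tileD(1) tiling_spaceD(1)[OF S] t(1) unfolding pat_def by blast
      then have "closed s" unfolding t(2) by (intro closed_Diff compact_imp_closed) auto
      moreover have "interior s \<subseteq> interior (supp t)" unfolding t(2) by (rule interior_mono) blast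
      then have "interior s = {}" using interior_subset[of s] unfolding t(2) by blast
      ultimately show "closed s \<and> interior s = {}" by blast
    qed
    ultimately show False using \<open>U \<noteq> {}\<close> by blast
  qed
qed

text \<open>The finite pattern condition counts patches only up to translation. The tile
  \<open>t0\<close> over the origin, common to all centres with the given pattern of radius 1, pins
  the translation down.\<close>

lemma finite_types:
  assumes T: "T \<in> tiling_space \<A>" and fpc: "finite_pattern_condition T" and r: "r \<ge> 1"
  shows "finite {pat T y r |y. pat T y 1 = pat T 0 1}"
proof -
  obtain t0 where t0: "t0 \<in> shift 0 T" "0 \<in> supp t0" using tiling_spaceD(3)[OF shift_tiling_space[OF T]] by blast
  then have "0 \<in> supp t0 \<inter> ball 0 1" by simp
  then have t0': "t0 \<in> pat T 0 1" unfolding pat_def using t0(1) by blast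
  have tile0: "is_tile t0" using tiling_spaceD(1)[OF shift_tiling_space[OF T] t0(1)] .
  define R where "R = 2 * r + 2 * \<Delta> + 1"
  have "R > 0" using r pos by (simp add: R_def)
  then obtain F where F: "finite F"
    "\<And>P. P \<subseteq> T \<Longrightarrow> finite P \<Longrightarrow> diameter (tiles_support P) < R \<Longrightarrow> \<exists>Q\<in>F. \<exists>v. P = translate_tile v ` Q"
    using fpc unfolding finite_pattern_condition_def by meson
  \<comment> \<open>At most one translate of \<open>Q\<close> carries its tile \<open>q\<close> to
    \<open>t0\<close>, so each of these sets has at most one element.\<close>
  define G :: "('l, 'n) tile set \<Rightarrow> ('l, 'n) tile \<Rightarrow> ('l, 'n) tile set set" where "G Q q = {translate_tile u ` Q |u. translate_tile u q = t0}" for Q q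
  have G: "finite (G Q q)" for Q q
  proof -
    have "P = P'" if P: "P \<in> G Q q" "P' \<in> G Q q" for P P'
    proof -
      obtain u u' where u: "P = translate_tile u ` Q" "P' = translate_tile u' ` Q"
        "translate_tile u q = t0" "translate_tile u' q = t0" using P unfolding G_def by blast
      have "translate_tile (u' - u) t0 = t0" using u(3,4) by (metis add.commute diff_add_cancel translate_translate_tile)
      then have "u' - u = 0" by (rule translate_tile_fixed[OF tile0])
      then show ?thesis using u by simp
    qed
    then have "\<exists>P. G Q q \<subseteq> {P}" by blast
    then show ?thesis using finite_subset by blast
  qed
  have "{pat T y r |y. pat T y 1 = pat T 0 1} \<subseteq> (\<Union>Q\<in>{Q \<in> F. finite Q}. \<Union>q\<in>Q. G Q q)"
  proof clarify
    fix y assume y: "pat T y 1 = pat T 0 1"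
    note S = shift_tiling_space[OF T, of y]
    define P where "P = translate_tile y ` pat T y r"
    have t0y: "t0 \<in> pat T y r" using t0' y pat_mono[OF r, of T y] by blast
    have finP: "finite P" unfolding P_def using finite_pat[OF T] by simp
    have "P \<subseteq> T" unfolding P_def pat_def mem_shift_iff by blast
    moreover have "diameter (tiles_support P) < R"
    proof -
      have near: "dist z y < r + \<Delta>" if z: "z \<in> tiles_support P" for z
      proof -
        obtain t z' where t: "t \<in> pat T y r" "z' \<in> supp t" "z = z' + y"
          using z unfolding tiles_support_def P_def by auto
        obtain z0 where z0: "z0 \<in> supp t" "norm z0 < r" using t(1) unfolding pat_def by auto
        have "dist z' z0 < \<Delta>" using outer[OF S] t z0 unfolding pat_def by blast
        then have "norm z' < r + \<Delta>" using z0(2) norm_triangle_ineq2[of z' z0] by (simp add: dist_norm)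
        then show ?thesis by (simp add: t(3) dist_norm)
      qed
      have "diameter (tiles_support P) \<le> 2 * (r + \<Delta>)"
      proof (rule diameter_le)
        fix z z' assume "z \<in> tiles_support P" "z' \<in> tiles_support P"
        then show "norm (z - z') \<le> 2 * (r + \<Delta>)"
          using near[of z] near[of z'] dist_triangle2[of z z' y] by (simp add: dist_norm)
      qed (use r pos in simp)
      then show ?thesis by (simp add: R_def)
    qed
    ultimately obtain Q v where Q: "Q \<in> F" "P = translate_tile v ` Q" using F(2) finP by blast
    have Pq: "pat T y r = translate_tile (v - y) ` Q"
    proof -
      have "pat T y r = translate_tile (- y) ` P" unfolding P_def by (simp add: image_image)
      then show ?thesis unfolding Q(2) by (simp add: image_image)
    qed
    have inj: "inj (translate_tile v :: ('l, 'n) tile \<Rightarrow> _)" for v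
      by (rule inj_on_inverseI[of _ "translate_tile (- v)"]) simp
    have "finite Q" using finP inj unfolding Q(2) by (meson finite_imageD inj_on_subset subset_UNIV)
    moreover obtain q where "q \<in> Q" "translate_tile (v - y) q = t0" using t0y unfolding Pq by blast
    ultimately show "pat T y r \<in> (\<Union>Q\<in>{Q \<in> F. finite Q}. \<Union>q\<in>Q. G Q q)"
      using Q(1) unfolding G_def Pq by blast
  qed
  moreover have "finite (\<Union>Q\<in>{Q \<in> F. finite Q}. \<Union>q\<in>Q. G Q q)"
    using F(1) G by auto
  ultimately show ?thesis by (rule finite_subset)
qed

end

section \<open>Substitutions acting on patches\<close>

lemma translate_tile_image: "translate_tile u ` translate_tile v ` P = translate_tile (v + u) ` P"
  by (simp add: image_image)

lemma subst_tiles_mono: "P \<subseteq> P' \<Longrightarrow> subst_tiles M ps S P \<subseteq> subst_tiles M ps S P'"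
  by (auto simp: subst_tiles_def)

lemma subst_pow_mono: "P \<subseteq> P' \<Longrightarrow> (subst_tiles M ps S ^^ k) P \<subseteq> (subst_tiles M ps S ^^ k) P'"
  by (induction k) (simp_all add: subst_tiles_mono)

lemma subst_tile_translate:
  assumes "linear M"
  shows "subst_tile M ps S (translate_tile u t) = translate_tile (M u) ` subst_tile M ps S t"
proof -
  have *: "translate_tile (M u) ` subst_tile M ps S t \<subseteq> subst_tile M ps S (translate_tile u t)" for u t
  proof
    fix s assume "s \<in> translate_tile (M u) ` subst_tile M ps S t"
    then obtain p v s0 where p: "p \<in> set ps" "t = translate_tile v p" "s0 \<in> S p"
        "s = translate_tile (M u) (translate_tile (M v) s0)"
      unfolding subst_tile_def by blast
    have "translate_tile u t = translate_tile (v + u) p" "s = translate_tile (M (v + u)) s0"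
      using p by (simp_all add: linear_add[OF assms])
    then show "s \<in> subst_tile M ps S (translate_tile u t)" unfolding subst_tile_def using p by blast
  qed
  have "translate_tile (M u) ` translate_tile (M (- u)) ` subst_tile M ps S (translate_tile u t)
      \<subseteq> translate_tile (M u) ` subst_tile M ps S (translate_tile (- u) (translate_tile u t))"
    by (rule image_mono) (rule *)
  then show ?thesis using *[of u t]
    by (simp add: translate_tile_image linear_neg[OF assms])
qed

lemma subst_tiles_translate:
  assumes "linear M"
  shows "subst_tiles M ps S (translate_tile u ` P) = translate_tile (M u) ` subst_tiles M ps S P"
  by (simp add: subst_tiles_def subst_tile_translate[OF assms] image_UN)

lemma subst_pow_translate:
  assumes "linear M"
  shows "(subst_tiles M ps S ^^ k) (translate_tile u ` P) = translate_tile ((M ^^ k) u) ` (subst_tiles M ps S ^^ k) P"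
  by (induction k) (simp_all add: subst_tiles_translate[OF assms])

lemma subst_tile_superset: "p \<in> set ps \<Longrightarrow> linear M \<Longrightarrow> S p \<subseteq> subst_tile M ps S p"
  unfolding subst_tile_def
proof (rule Union_upper)
  assume "p \<in> set ps" "linear M"
  then have "S p = translate_tile (M 0) ` S p \<and> p \<in> set ps \<and> p = translate_tile 0 p"
    by (simp add: linear_0)
  then show "S p \<in> {translate_tile (M v) ` S q |q v. q \<in> set ps \<and> p = translate_tile v q}" by blast
qed

locale self_similar = tile_bounds "set ps" \<delta> \<Delta>
  for ps :: "('l, 'n::finite) tile list" and \<delta> \<Delta> +
  fixes M :: "real ^ 'n \<Rightarrow> real ^ 'n" and S and T and c :: real
  assumes sst: "self_similar_tiling M ps S T" and prim: "primitive_substitution ps S"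
    and T_in: "T \<in> substitution_space M ps S"
    and c: "c > 1" and norm_M: "norm (M v) = c * norm v"
begin

abbreviation "subst \<equiv> subst_tiles M ps S"

lemma T: "T \<in> tiling_space (set ps)" and fixed: "subst T = T" and fpc: "finite_pattern_condition T"
  using sst by (auto simp: self_similar_tiling_def)

lemma linear: "linear M"
  using sst by (simp add: self_similar_tiling_def substitution_def similarity_def)

lemma linear_pow: "linear (M ^^ k)"
  by (rule linear_funpow[OF linear])

lemma norm_pow: "norm ((M ^^ k) v) = c ^ k * norm v"
  by (rule norm_funpow[OF norm_M])

lemma surj_pow: "surj (M ^^ k)"
  by (rule bij_is_surj[OF bij_funpow_similarity[OF linear norm_M c]])

lemma supp_subst_tile:
  assumes "s \<in> subst_tile M ps S t"
  shows "supp s \<subseteq> M ` supp t"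
proof -
  obtain p v s0 where p: "p \<in> set ps" "t = translate_tile v p" "s0 \<in> S p" "s = translate_tile (M v) s0"
    using assms unfolding subst_tile_def by blast
  have "tiles_support (S p) = M ` supp p"
    using sst p(1) by (simp add: self_similar_tiling_def substitution_def)
  then have sub: "supp s0 \<subseteq> M ` supp p" using p(3) unfolding tiles_support_def by blast
  show ?thesis
  proof
    fix z assume "z \<in> supp s"
    then obtain z0 where z0: "z0 \<in> supp s0" "z = z0 + M v" unfolding p(4) by auto
    then obtain y where y: "y \<in> supp p" "z0 = M y" using sub by blast
    have "y + v \<in> supp t" unfolding p(2) using y(1) by simp
    moreover have "z = M (y + v)" by (simp add: z0(2) y(2) linear_add[OF linear])
    ultimately show "z \<in> M ` supp t" by blast
  qed
qed

lemma supp_subst_pow: "s \<in> (subst ^^ k) {t} \<Longrightarrow> supp s \<subseteq> (M ^^ k) ` supp t"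
proof (induction k arbitrary: s)
  case (Suc k)
  then have "s \<in> subst ((subst ^^ k) {t})" by simp
  then obtain s' where s': "s' \<in> (subst ^^ k) {t}" "s \<in> subst_tile M ps S s'"
    unfolding subst_tiles_def[of _ _ _ "(subst ^^ k) {t}"] by blast
  then have "supp s \<subseteq> M ` (M ^^ k) ` supp t"
    using supp_subst_tile[OF s'(2)] Suc.IH[OF s'(1)] by blast
  then show ?case by (simp add: image_comp)
qed simp

lemma fixed_pow: "(subst ^^ k) T = T"
  by (induction k) (simp_all add: fixed)

text \<open>As \<open>T\<close> is fixed, its shift by \<open>M x\<close> is the substitution of its
  shift by \<open>x\<close>. A tile meeting the ball of radius \<open>c * r\<close> arises from one
  meeting the ball of radius \<open>r\<close>, because \<open>M\<close> scales all norms by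
  \<open>c\<close>.\<close>

lemma pat_inflate_eq:
  "pat T (M x) (c * r) = {s \<in> subst (pat T x r). supp s \<inter> ball 0 (c * r) \<noteq> {}}"
proof -
  have sh: "shift (M x) T = subst (shift x T)"
    unfolding shift_def using subst_tiles_translate[OF linear, of ps S "- x" T]
    by (simp add: fixed linear_neg[OF linear])
  have "s \<in> subst (pat T x r)" if s: "s \<in> subst (shift x T)" "supp s \<inter> ball 0 (c * r) \<noteq> {}" for s
  proof -
    obtain t where t: "t \<in> shift x T" "s \<in> subst_tile M ps S t" using s(1) unfolding subst_tiles_def by blast
    obtain z where z: "z \<in> supp s" "norm z < c * r" using s(2) by auto
    obtain z' where z': "z' \<in> supp t" "z = M z'" using supp_subst_tile[OF t(2)] z(1) by blast
    have "norm z' < r" using z(2) c unfolding z'(2) norm_M by simp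
    then have "t \<in> pat T x r" using t(1) z'(1) unfolding pat_def by auto
    then show ?thesis using t(2) unfolding subst_tiles_def by blast
  qed
  moreover have "subst (pat T x r) \<subseteq> subst (shift x T)" by (intro subst_tiles_mono pat_subset)
  ultimately show ?thesis unfolding pat_def[of T "M x"] sh by blast
qed

lemma inflate: "pat T x r = pat T x' r \<Longrightarrow> pat T (M x) (c * r) = pat T (M x') (c * r)"
  unfolding pat_inflate_eq by simp

text \<open>A nonzero sum over intermediate prototiles has a nonzero term, which names a prototile
  to pass through.\<close>

lemma subst_matrix_pow:
  assumes "i < length ps" "j < length ps" "(subst_matrix ps S ^\<^sub>m k) $$ (i, j) \<noteq> 0"
  shows "\<exists>v. translate_tile v (ps ! j) \<in> (subst ^^ k) {ps ! i}"
  using assms(2,3)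
proof (induction k arbitrary: j)
  case 0
  then have "j = i" using assms(1) by (auto simp: subst_matrix_def split: if_splits)
  then show ?case by (intro exI[of _ 0]) simp
next
  case (Suc k)
  let ?A = "subst_matrix ps S" and ?m = "length ps"
  have A: "?A \<in> carrier_mat ?m ?m" by (simp add: subst_matrix_def)
  have "(\<Sum>l = 0..<?m. (?A ^\<^sub>m k) $$ (i, l) * ?A $$ (l, j)) \<noteq> 0"
    using Suc.prems assms(1) A pow_carrier_mat[OF A, of k]
    by (auto simp: scalar_prod_def)
  then obtain l where l: "l < ?m" "(?A ^\<^sub>m k) $$ (i, l) \<noteq> 0" "?A $$ (l, j) \<noteq> 0"
    by (metis (no_types, lifting) atLeastLessThan_iff mult_eq_0_iff sum.neutral)
  obtain u where u: "translate_tile u (ps ! l) \<in> (subst ^^ k) {ps ! i}" using Suc.IH[OF l(1,2)] by blast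
  have "card {t \<in> S (ps ! l). tile_equiv (ps ! j) t} \<noteq> 0"
    using l Suc.prems(1) by (simp add: subst_matrix_def)
  then have "{t \<in> S (ps ! l). tile_equiv (ps ! j) t} \<noteq> {}" by force
  then obtain v where v: "translate_tile v (ps ! j) \<in> S (ps ! l)" by (auto simp: tile_equiv_def)
  have "translate_tile v (ps ! j) \<in> subst_tile M ps S (ps ! l)"
    using v subst_tile_superset[of "ps ! l" ps M S] l(1) linear by auto
  then have "translate_tile (M u) (translate_tile v (ps ! j)) \<in> subst_tile M ps S (translate_tile u (ps ! l))"
    unfolding subst_tile_translate[OF linear] by blast
  then have "translate_tile (v + M u) (ps ! j) \<in> subst ((subst ^^ k) {ps ! i})"
    using u unfolding subst_tiles_def by auto
  then show ?case by auto
qed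

text \<open>The pattern occurs in some \<open>k\<close>-fold substituted prototile \<open>p\<close>,
  and by primitivity \<open>p\<close> occurs in every \<open>k0\<close>-fold substituted tile. So
  the pattern occurs in every tile inflated \<open>k + k0\<close> times, and these tiles cover
  space. Containment becomes equality by \<open>pat_subset_imp_eq\<close>.\<close>

lemma recurrent: "\<exists>L. \<forall>y. \<exists>y'. dist y y' \<le> L \<and> pat T y' r = pat T x r"
proof (cases "r > 0")
  case False
  then have "ball (0 :: real ^ 'n) r = {}" by simp
  then have "pat T y r = {}" for y by (simp add: pat_def del: ball_eq_empty)
  then show ?thesis by (intro exI[of _ 0]) auto
next
  case True
  define P where "P = translate_tile x ` pat T x r"
  have "translate_tile x t \<in> T" if "t \<in> pat T x r" for t
    using that pat_subset mem_shift_iff by blast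
  then have "P \<subseteq> T" unfolding P_def by blast
  moreover have "finite P" unfolding P_def using finite_pat[OF T] by simp
  moreover have "\<forall>P. P \<subseteq> T \<and> finite P \<longrightarrow> (\<exists>p\<in>set ps. \<exists>k>0. \<exists>v. translate_tile v ` P \<subseteq> (subst ^^ k) {p})"
    using T_in by (simp add: substitution_space_def)
  ultimately have "\<exists>p\<in>set ps. \<exists>k>0. \<exists>v. translate_tile v ` P \<subseteq> (subst ^^ k) {p}" by simp
  then obtain p k v where p: "p \<in> set ps" "translate_tile v ` P \<subseteq> (subst ^^ k) {p}"
    by (elim bexE exE conjE)
  obtain j where j: "j < length ps" "p = ps ! j" using p(1) by (metis in_set_conv_nth)
  have dim: "dim_row (subst_matrix ps S) = length ps" "dim_col (subst_matrix ps S) = length ps"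
    by (simp_all add: subst_matrix_def)
  have "\<exists>k0>0. \<forall>i<length ps. \<forall>j<length ps. (subst_matrix ps S ^\<^sub>m k0) $$ (i, j) > 0"
    using prim unfolding primitive_substitution_def primitive_matrix_def dim .
  then obtain k0 where "\<forall>i<length ps. \<forall>j<length ps. (subst_matrix ps S ^\<^sub>m k0) $$ (i, j) > 0"
    by (elim exE conjE)
  then have k0: "(subst_matrix ps S ^\<^sub>m k0) $$ (i, j) \<noteq> 0" if "i < length ps" for i
    using j(1) that by (metis less_irrefl)
  show ?thesis
  proof (intro exI[of _ "c ^ (k + k0) * \<Delta>"] allI)
    fix y
    obtain \<eta> where \<eta>: "y = (M ^^ (k + k0)) \<eta>" using surj_pow by (metis surjD)
    obtain t where t: "t \<in> T" "\<eta> \<in> supp t" using tiling_spaceD(3)[OF T, of \<eta>] by (elim bexE)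
    obtain q z where q: "q \<in> set ps" "t = translate_tile z q" using tiling_spaceD(2)[OF T t(1)] by blast
    obtain i where i: "i < length ps" "q = ps ! i" using q(1) by (metis in_set_conv_nth)
    obtain u where u: "translate_tile u p \<in> (subst ^^ k0) {q}"
      using subst_matrix_pow[OF i(1) j(1) k0[OF i(1)]] i(2) j(2) by blast
    let ?u = "u + (M ^^ k0) z"
    define w where "w = v + (M ^^ k) ?u"
    have t': "{t} = translate_tile z ` {q}" by (simp add: q)
    have "translate_tile ?u p \<in> (subst ^^ k0) {t}"
      unfolding t' subst_pow_translate[OF linear] using u by (force simp: image_iff)
    then have "(subst ^^ k) (translate_tile ?u ` {p}) \<subseteq> (subst ^^ k) ((subst ^^ k0) {t})"
      by (intro subst_pow_mono) simp
    also have "\<dots> = (subst ^^ (k + k0)) {t}" by (simp add: funpow_add)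
    finally have "translate_tile ((M ^^ k) ?u) ` (subst ^^ k) {p} \<subseteq> (subst ^^ (k + k0)) {t}"
      unfolding subst_pow_translate[OF linear] .
    moreover have "translate_tile w ` P \<subseteq> translate_tile ((M ^^ k) ?u) ` (subst ^^ k) {p}"
      unfolding w_def translate_tile_image[symmetric] using p(2) by (rule image_mono)
    ultimately have wP: "translate_tile w ` P \<subseteq> (subst ^^ (k + k0)) {t}" by blast
    also have "\<dots> \<subseteq> T" using subst_pow_mono[of "{t}" T "k + k0" M ps S] t(1) fixed_pow by simp
    finally have wPT: "translate_tile w ` P \<subseteq> T" .
    have "pat T x r \<subseteq> pat T (x + w) r"
    proof
      fix s assume s: "s \<in> pat T x r"
      then have "translate_tile w (translate_tile x s) \<in> T" using wPT unfolding P_def by blast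
      then show "s \<in> pat T (x + w) r" using s by (simp add: pat_def mem_shift_iff)
    qed
    then have "pat T x r = pat T (x + w) r" by (rule pat_subset_imp_eq[OF T T])
    moreover have "dist y (x + w) \<le> c ^ (k + k0) * \<Delta>"
    proof -
      \<comment> \<open>A tile over the centre of the pattern ties \<open>x + w\<close> to the
        inflated tile: both \<open>x + w\<close> and \<open>y\<close> lie in the image of
        \<open>supp t\<close> under \<open>M ^^ (k + k0)\<close>.\<close>
      obtain s where s: "s \<in> shift x T" "0 \<in> supp s"
        using tiling_spaceD(3)[OF shift_tiling_space[OF T], of x 0] by (elim bexE)
      then have "s \<in> pat T x r" using True unfolding pat_def by auto
      then have "translate_tile w (translate_tile x s) \<in> (subst ^^ (k + k0)) {t}" using wP unfolding P_def by blast
      from supp_subst_pow[OF this] s(2) obtain \<xi> where \<xi>: "\<xi> \<in> supp t" "x + w = (M ^^ (k + k0)) \<xi>"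
        by (force simp: add.commute)
      have "dist y (x + w) = norm ((M ^^ (k + k0)) (\<eta> - \<xi>))"
        unfolding \<eta> \<xi>(2) dist_norm linear_diff[OF linear_pow] ..
      also have "\<dots> = c ^ (k + k0) * dist \<eta> \<xi>" unfolding norm_pow dist_norm ..
      also have "\<dots> \<le> c ^ (k + k0) * \<Delta>"
        using outer[OF T t(1) t(2) \<xi>(1)] c by (intro mult_left_mono) auto
      finally show ?thesis .
    qed
    ultimately show "\<exists>y'. dist y y' \<le> c ^ (k + k0) * \<Delta> \<and> pat T y' r = pat T x r" by metis
  qed
qed

end

section \<open>The Perron eigenvalue of a similarity\<close>

lemma mult_mat_sum:
  assumes "A \<in> carrier_mat n n" "B \<in> carrier_mat n n" "i < n"
  shows "(\<Sum>j<n. (A * B) $$ (i, j) * f j) = (\<Sum>l<n. A $$ (i, l) * (\<Sum>j<n. B $$ (l, j) * (f j :: 'a :: comm_semiring_1)))"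
proof -
  have "(A * B) $$ (i, j) = (\<Sum>l<n. A $$ (i, l) * B $$ (l, j))" if "j < n" for j
    using assms that by (auto simp: scalar_prod_def lessThan_atLeast0 intro!: sum.cong)
  then have "(\<Sum>j<n. (A * B) $$ (i, j) * f j) = (\<Sum>j<n. \<Sum>l<n. A $$ (i, l) * B $$ (l, j) * f j)"
    by (simp add: sum_distrib_right)
  also have "\<dots> = (\<Sum>l<n. \<Sum>j<n. A $$ (i, l) * B $$ (l, j) * f j)" by (rule sum.swap)
  finally show ?thesis by (simp add: sum_distrib_left mult.assoc)
qed

lemma pow_mat_nonneg:
  fixes A :: "real mat"
  assumes A: "A \<in> carrier_mat n n" and nonneg: "\<And>i j. i < n \<Longrightarrow> j < n \<Longrightarrow> A $$ (i, j) \<ge> 0"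
  shows "i < n \<Longrightarrow> j < n \<Longrightarrow> (A ^\<^sub>m m) $$ (i, j) \<ge> 0"
proof (induction m arbitrary: j)
  case 0
  then show ?case using A by simp
next
  case (Suc m)
  have "(A ^\<^sub>m Suc m) $$ (i, j) = (\<Sum>l = 0..<n. (A ^\<^sub>m m) $$ (i, l) * A $$ (l, j))"
    using Suc.prems A pow_carrier_mat[OF A, of m] by (auto simp: scalar_prod_def intro!: sum.cong)
  also have "\<dots> \<ge> 0" using Suc nonneg by (intro sum_nonneg mult_nonneg_nonneg) auto
  finally show ?case .
qed

text \<open>An iterated sub-eigenvector inequality. The vector may change with \<open>k\<close>, as
  it will be made of volumes of tiles under \<open>M ^^ k\<close>.\<close>

lemma pow_mat_growth_le:
  fixes A :: "real mat"
  assumes A: "A \<in> carrier_mat n n" and nonneg: "\<And>i j. i < n \<Longrightarrow> j < n \<Longrightarrow> A $$ (i, j) \<ge> 0"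
    and step: "\<And>k i. i < n \<Longrightarrow> (\<Sum>j<n. A $$ (i, j) * v k j) \<le> r * v (Suc k) i" and r: "r \<ge> 0" and i: "i < n"
  shows "(\<Sum>j<n. (A ^\<^sub>m m) $$ (i, j) * v k j) \<le> r ^ m * v (k + m) i"
proof (induction m arbitrary: k)
  case 0
  have "(\<Sum>j<n. (A ^\<^sub>m 0) $$ (i, j) * v k j) = (\<Sum>j<n. if j = i then v k j else 0)"
    using A i by (intro sum.cong) auto
  then show ?case using i by simp
next
  case (Suc m)
  have "(\<Sum>j<n. (A ^\<^sub>m Suc m) $$ (i, j) * v k j) = (\<Sum>l<n. (A ^\<^sub>m m) $$ (i, l) * (\<Sum>j<n. A $$ (l, j) * v k j))"
    using mult_mat_sum[OF pow_carrier_mat[OF A, of m] A i] by simp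
  also have "\<dots> \<le> (\<Sum>l<n. (A ^\<^sub>m m) $$ (i, l) * (r * v (Suc k) l))"
    using step pow_mat_nonneg[OF A nonneg i] by (intro sum_mono mult_left_mono) auto
  also have "\<dots> = r * (\<Sum>l<n. (A ^\<^sub>m m) $$ (i, l) * v (Suc k) l)"
    by (simp add: sum_distrib_left mult.left_commute)
  also have "\<dots> \<le> r * (r ^ m * v (Suc k + m) i)" using Suc.IH[of "Suc k"] r by (rule mult_left_mono)
  finally show ?case by (simp add: mult.assoc)
qed

lemma pow_mat_growth_ge:
  fixes A :: "real mat"
  assumes A: "A \<in> carrier_mat n n" and nonneg: "\<And>i j. i < n \<Longrightarrow> j < n \<Longrightarrow> A $$ (i, j) \<ge> 0"
    and step: "\<And>k i. i < n \<Longrightarrow> (\<Sum>j<n. A $$ (i, j) * v k j) \<ge> r * v (Suc k) i" and r: "r \<ge> 0" and i: "i < n"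
  shows "(\<Sum>j<n. (A ^\<^sub>m m) $$ (i, j) * v k j) \<ge> r ^ m * v (k + m) i"
  using pow_mat_growth_le[OF A nonneg, of "\<lambda>k j. - v k j" r i m k] step r i
  by (simp add: sum_negf)

lemma bounded_power_imp_le_1:
  fixes q :: real
  assumes "\<And>m. q ^ m \<le> C"
  shows "q \<le> 1"
proof (rule ccontr)
  assume "\<not> q \<le> 1"
  then obtain m where "C < q ^ m" using real_arch_pow[of q C] by auto
  then show False using assms[of m] by simp
qed

text \<open>The entries of an eigenvector are dominated by a multiple of \<open>v 0\<close>.
  Iteration bounds the powers of \<open>cmod \<mu> / r\<close>, so this quotient is at most
  1.\<close>

lemma eigenvalue_le_growth:
  fixes A :: "real mat" and v :: "nat \<Rightarrow> nat \<Rightarrow> real"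
  assumes A: "A \<in> carrier_mat n n" and nonneg: "\<And>i j. i < n \<Longrightarrow> j < n \<Longrightarrow> A $$ (i, j) \<ge> 0"
    and step: "\<And>k i. i < n \<Longrightarrow> (\<Sum>j<n. A $$ (i, j) * v k j) \<le> r * v (Suc k) i" and r: "r > 0"
    and bounds: "\<And>k i. i < n \<Longrightarrow> v k i \<le> b i" "\<And>i. i < n \<Longrightarrow> v 0 i > 0"
    and ev: "eigenvalue (map_mat complex_of_real A) \<mu>"
  shows "cmod \<mu> \<le> r"
proof -
  let ?A = "map_mat complex_of_real A"
  have cA: "?A \<in> carrier_mat n n" using A by simp
  obtain x where x: "eigenvector ?A x \<mu>" using ev unfolding eigenvalue_def by blast
  have xc: "x \<in> carrier_vec n" and x0: "x \<noteq> 0\<^sub>v n" using x A unfolding eigenvector_def by auto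
  obtain i where i: "i < n" "x $ i \<noteq> 0" using xc x0 by (metis eq_vecI carrier_vecD index_zero_vec)
  define X where "X = (\<Sum>j<n. cmod (x $ j) / v 0 j)"
  have X: "cmod (x $ j) \<le> X * v 0 j" if "j < n" for j
  proof -
    have "cmod (x $ j) / v 0 j \<le> X"
      unfolding X_def by (rule member_le_sum) (use that bounds(2) in \<open>auto intro: divide_nonneg_pos\<close>)
    then show ?thesis using bounds(2)[OF that] by (simp add: pos_divide_le_eq)
  qed
  have X0: "X \<ge> 0" unfolding X_def using bounds(2) by (intro sum_nonneg divide_nonneg_pos) auto
  have main: "(cmod \<mu> / r) ^ m \<le> X * b i / cmod (x $ i)" for m
  proof -
    have pw: "?A ^\<^sub>m m = map_mat complex_of_real (A ^\<^sub>m m)" by (rule of_real_hom.mat_hom_pow[OF A, symmetric])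
    have "(?A ^\<^sub>m m *\<^sub>v x) $ i = (\<Sum>j<n. complex_of_real ((A ^\<^sub>m m) $$ (i, j)) * x $ j)"
      using i xc A pow_carrier_mat[OF A, of m] unfolding pw
      by (auto simp: scalar_prod_def lessThan_atLeast0 intro!: sum.cong)
    moreover have "(?A ^\<^sub>m m *\<^sub>v x) $ i = \<mu> ^ m * x $ i"
      using eigenvector_pow[OF cA x, of m] i xc by simp
    ultimately have "cmod \<mu> ^ m * cmod (x $ i) = cmod (\<Sum>j<n. complex_of_real ((A ^\<^sub>m m) $$ (i, j)) * x $ j)"
      by (metis norm_mult norm_power)
    also have "\<dots> \<le> (\<Sum>j<n. (A ^\<^sub>m m) $$ (i, j) * cmod (x $ j))"
      by (rule order_trans[OF norm_sum]) (use pow_mat_nonneg[OF A nonneg i(1)] in \<open>simp add: norm_mult\<close>)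
    also have "\<dots> \<le> (\<Sum>j<n. (A ^\<^sub>m m) $$ (i, j) * (X * v 0 j))"
      using X pow_mat_nonneg[OF A nonneg i(1)] by (intro sum_mono mult_left_mono) auto
    also have "\<dots> = X * (\<Sum>j<n. (A ^\<^sub>m m) $$ (i, j) * v 0 j)"
      by (simp add: sum_distrib_left mult.left_commute)
    also have "\<dots> \<le> X * (r ^ m * v (0 + m) i)"
      using pow_mat_growth_le[where v = v and r = r and m = m and k = 0, OF A nonneg step _ i(1)] r
      by (intro mult_left_mono X0) auto
    also have "\<dots> \<le> X * (r ^ m * b i)"
      using X0 r bounds(1)[OF i(1)] by (intro mult_left_mono) auto
    finally show ?thesis using r i(2) by (simp add: power_divide field_simps)
  qed
  have "cmod \<mu> / r \<le> 1" by (rule bounded_power_imp_le_1[OF main])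
  then show ?thesis using r by simp
qed

text \<open>Otherwise take \<open>t\<close> strictly between \<open>l\<close> and \<open>r\<close>.
  The spectral radius of \<open>A / t\<close> is below 1, so its powers have bounded entries,
  whereas the inequality makes them grow like the powers of \<open>r / t\<close>.\<close>

lemma growth_le_spectral_bound:
  fixes A :: "real mat" and v :: "nat \<Rightarrow> nat \<Rightarrow> real"
  assumes A: "A \<in> carrier_mat n n" and nonneg: "\<And>i j. i < n \<Longrightarrow> j < n \<Longrightarrow> A $$ (i, j) \<ge> 0"
    and step: "\<And>k i. i < n \<Longrightarrow> (\<Sum>j<n. A $$ (i, j) * v k j) \<ge> r * v (Suc k) i" and r: "r > 0"
    and bounds: "\<And>k i. i < n \<Longrightarrow> v k i \<ge> a i" "\<And>i. i < n \<Longrightarrow> a i > 0" and n: "n > 0"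
    and ev: "\<And>\<mu>. eigenvalue (map_mat complex_of_real A) \<mu> \<Longrightarrow> cmod \<mu> \<le> l" and l: "l \<ge> 0"
  shows "r \<le> l"
proof (rule ccontr)
  assume "\<not> r \<le> l"
  define t where "t = (l + r) / 2"
  have t: "l < t" "t < r" "t > 0" using \<open>\<not> r \<le> l\<close> l by (auto simp: t_def)
  define B where "B = (1 / t) \<cdot>\<^sub>m A"
  have B: "B \<in> carrier_mat n n" using A by (simp add: B_def)
  have Bij: "B $$ (i, j) = A $$ (i, j) / t" if "i < n" "j < n" for i j using A that by (simp add: B_def)
  have Bnonneg: "B $$ (i, j) \<ge> 0" if "i < n" "j < n" for i j using nonneg that t Bij by simp
  let ?cA = "map_mat complex_of_real A" and ?cB = "map_mat complex_of_real B"
  have cB: "?cB \<in> carrier_mat n n" using B by simp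
  have ev_B: "cmod \<mu> < 1" if \<mu>: "eigenvalue ?cB \<mu>" for \<mu>
  proof -
    obtain x where x: "x \<in> carrier_vec n" "x \<noteq> 0\<^sub>v n" "?cB *\<^sub>v x = \<mu> \<cdot>\<^sub>v x"
      using \<mu> B unfolding eigenvalue_def eigenvector_def by auto
    have "?cA = complex_of_real t \<cdot>\<^sub>m ?cB"
      using A t by (intro eq_matI) (auto simp: B_def)
    then have "?cA *\<^sub>v x = complex_of_real t \<cdot>\<^sub>v (?cB *\<^sub>v x)"
      using cB x(1) by (intro eq_vecI) (auto simp: scalar_prod_def sum_distrib_left mult.assoc)
    also have "\<dots> = (complex_of_real t * \<mu>) \<cdot>\<^sub>v x" using x(3) by (simp add: smult_smult_assoc)
    finally have "eigenvalue ?cA (complex_of_real t * \<mu>)"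
      unfolding eigenvalue_def eigenvector_def using A x by (intro exI[of _ x]) auto
    then have "t * cmod \<mu> \<le> l" using ev[of "complex_of_real t * \<mu>"] t by (simp add: norm_mult)
    then have "t * cmod \<mu> < t * 1" using t by linarith
    then show ?thesis using t by (simp only: mult_less_cancel_left_pos)
  qed
  have "spectral_radius ?cB < 1"
    using spectral_radius_mem_max(1)[OF cB n] ev_B unfolding spectrum_def by auto
  then obtain C where C: "\<And>k. norm_bound (?cB ^\<^sub>m k) C"
    using spectral_radius_jnf_norm_bound_less_1_upper_triangular[OF cB] by blast
  have entry: "(B ^\<^sub>m m) $$ (i, j) \<le> C" if "i < n" "j < n" for m i j
  proof -
    have "?cB ^\<^sub>m m = map_mat complex_of_real (B ^\<^sub>m m)" by (rule of_real_hom.mat_hom_pow[OF B, symmetric])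
    then have "(?cB ^\<^sub>m m) $$ (i, j) = complex_of_real ((B ^\<^sub>m m) $$ (i, j))"
      using that carrier_matD[OF pow_carrier_mat[OF B, of m]] by simp
    moreover have "cmod ((?cB ^\<^sub>m m) $$ (i, j)) \<le> C"
      using C[of m] that unfolding norm_bound_def carrier_matD[OF pow_carrier_mat[OF cB, of m]] by blast
    ultimately show ?thesis by simp
  qed
  have stepB: "r / t * v (Suc k) i \<le> (\<Sum>j<n. B $$ (i, j) * v k j)" if "i < n" for k i
    using step[OF that, of k] t Bij[OF that] by (simp add: sum_divide_distrib[symmetric] divide_right_mono)
  have v0: "v 0 j \<ge> 0" if "j < n" for j using bounds[OF that] order_trans less_imp_le by metis
  have "(r / t) ^ m \<le> (\<Sum>j<n. C * v 0 j) / a 0" for m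
  proof -
    have "(r / t) ^ m * a 0 \<le> (r / t) ^ m * v (0 + m) 0" using bounds(1)[OF n] r t by (intro mult_left_mono) auto
    also have "\<dots> \<le> (\<Sum>j<n. (B ^\<^sub>m m) $$ (0, j) * v 0 j)"
      by (rule pow_mat_growth_ge[where v = v and r = "r / t" and m = m and k = 0, OF B Bnonneg stepB _ n])
         (use r t in auto)
    also have "\<dots> \<le> (\<Sum>j<n. C * v 0 j)" using entry n v0 by (intro sum_mono mult_right_mono) auto
    finally show ?thesis using bounds(2)[OF n] by (simp add: pos_le_divide_eq)
  qed
  then have "r / t \<le> 1" by (rule bounded_power_imp_le_1)
  then show False using t by simp
qed


text \<open>Each tile of \<open>S (ps ! i)\<close> is equivalent to exactly one prototile, because
  prototiles are pairwise inequivalent, and \<open>g\<close> takes the same value on both.\<close>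

lemma sum_subst_matrix:
  fixes g :: "('l, 'n::finite) tile \<Rightarrow> real"
  assumes sub: "substitution M ps S" and i: "i < length ps" and inv: "\<And>v t. g (translate_tile v t) = g t"
  shows "(\<Sum>j<length ps. subst_matrix ps S $$ (i, j) * g (ps ! j)) = (\<Sum>t\<in>S (ps ! i). g t)"
proof -
  let ?n = "length ps" and ?S = "S (ps ! i)"
  have "\<forall>p\<in>set ps. finite (S p) \<and> (\<forall>t\<in>S p. \<exists>q\<in>set ps. tile_equiv q t)"
    and ineq: "\<forall>j<?n. \<forall>k<?n. j \<noteq> k \<longrightarrow> \<not> tile_equiv (ps ! j) (ps ! k)"
    using sub unfolding substitution_def by simp_all
  then have fin: "finite ?S" and eqv: "\<forall>t\<in>?S. \<exists>q\<in>set ps. tile_equiv q t"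
    using nth_mem[OF i] by simp_all
  have uniq: "\<exists>j<?n. {k. k \<in> {..<?n} \<and> tile_equiv (ps ! k) t} = {j}" if t: "t \<in> ?S" for t
  proof -
    obtain q where q: "q \<in> set ps" "tile_equiv q t" using bspec[OF eqv t] by (elim bexE)
    obtain j where j: "j < ?n" "q = ps ! j" using q(1) by (metis in_set_conv_nth)
    have "k = j" if k: "k < ?n" "tile_equiv (ps ! k) t" for k
    proof -
      obtain v w where vw: "t = translate_tile v (ps ! j)" "t = translate_tile w (ps ! k)"
        using q(2) k(2) j(2) unfolding tile_equiv_def by blast
      then have "translate_tile (- w) (translate_tile v (ps ! j)) = translate_tile (- w) (translate_tile w (ps ! k))"
        by simp
      then have "ps ! k = translate_tile (v - w) (ps ! j)" by simp
      then have "tile_equiv (ps ! j) (ps ! k)" unfolding tile_equiv_def by blast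
      then show "k = j" using ineq k(1) j(1) by metis
    qed
    moreover have "tile_equiv (ps ! j) t" using q(2) unfolding j(2) .
    ultimately have "{k. k \<in> {..<?n} \<and> tile_equiv (ps ! k) t} = {j}" using j(1) by blast
    then show ?thesis using j(1) by blast
  qed
  have "(\<Sum>j<?n. subst_matrix ps S $$ (i, j) * g (ps ! j)) = (\<Sum>j<?n. \<Sum>t | t \<in> ?S \<and> tile_equiv (ps ! j) t. g t)"
  proof (rule sum.cong[OF refl])
    fix j assume j: "j \<in> {..<?n}"
    have "(\<Sum>t | t \<in> ?S \<and> tile_equiv (ps ! j) t. g t) = (\<Sum>t | t \<in> ?S \<and> tile_equiv (ps ! j) t. g (ps ! j))"
      by (rule sum.cong[OF refl]) (auto simp: tile_equiv_def inv)
    then show "subst_matrix ps S $$ (i, j) * g (ps ! j) = (\<Sum>t | t \<in> ?S \<and> tile_equiv (ps ! j) t. g t)"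
      using i j by (simp add: subst_matrix_def)
  qed
  also have "\<dots> = (\<Sum>t\<in>?S. \<Sum>j | j \<in> {..<?n} \<and> tile_equiv (ps ! j) t. g t)"
    by (rule sum.swap_restrict) (use fin in auto)
  also have "\<dots> = (\<Sum>t\<in>?S. g t)"
  proof (rule sum.cong[OF refl])
    fix t assume "t \<in> ?S"
    from uniq[OF this] obtain j where "{k. k \<in> {..<?n} \<and> tile_equiv (ps ! k) t} = {j}" by blast
    then show "(\<Sum>j | j \<in> {..<?n} \<and> tile_equiv (ps ! j) t. g t) = g t" by (simp only:) simp
  qed
  finally show ?thesis .
qed

text \<open>Tile boundaries may have positive measure. Therefore the interiors give the upper bound and
  the closed tiles give the lower one. Their images under \<open>M ^^ k\<close> are squeezed between balls, so the
  determinant of \<open>M\<close> is not needed.\<close>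

theorem perron_eigenvalue_similarity:
  fixes M :: "real ^ 'n::finite \<Rightarrow> real ^ 'n" and ps :: "('l, 'n) tile list"
  assumes sub: "substitution M ps S" and norm_M: "\<And>v. norm (M v) = c * norm v" and c: "c > 1"
    and perron: "perron_eigenvalue (subst_matrix ps S) l"
  shows "l = c ^ DIM(real ^ 'n)"
proof -
  let ?d = "DIM(real ^ 'n)" and ?n = "length ps" and ?A = "subst_matrix ps S"
  let ?V = "unit_ball_vol (real DIM(real ^ 'n))"
  have V: "?V > 0" by simp
  have lin: "linear M" using sub by (simp add: substitution_def similarity_def)
  note linp = linear_funpow[OF lin]
  have normp: "norm ((M ^^ k) v) = c ^ k * norm v" for k v by (rule norm_funpow[OF norm_M])
  have bijp: "bij (M ^^ k)" for k by (rule bij_funpow_similarity[OF lin norm_M c])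
  have ck: "c ^ k > 0" for k using c by simp
  have tile: "is_tile (ps ! i)" if "i < ?n" for i
    using sub that by (simp add: substitution_def prototile_set_def)
  have S: "finite (S (ps ! i))" "\<And>t. t \<in> S (ps ! i) \<Longrightarrow> is_tile t" "disjoint_interiors (S (ps ! i))"
    "(\<Union>t\<in>S (ps ! i). supp t) = M ` supp (ps ! i)" if i: "i < ?n" for i
  proof -
    have *: "finite (S (ps ! i)) \<and> (\<forall>t\<in>S (ps ! i). \<exists>q\<in>set ps. tile_equiv q t) \<and>
        disjoint_interiors (S (ps ! i)) \<and> tiles_support (S (ps ! i)) = M ` supp (ps ! i)"
      using bspec[OF _ nth_mem[OF i]] sub unfolding substitution_def by (elim conjE)
    then show "finite (S (ps ! i))" "disjoint_interiors (S (ps ! i))"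
        "(\<Union>t\<in>S (ps ! i). supp t) = M ` supp (ps ! i)" by (simp_all add: tiles_support_def)
    have tiles: "\<forall>q\<in>set ps. is_tile q" using sub by (simp add: substitution_def prototile_set_def)
    fix t assume "t \<in> S (ps ! i)"
    then obtain q v where "q \<in> set ps" "t = translate_tile v q" using * unfolding tile_equiv_def by blast
    then show "is_tile t" using tiles is_tile_translate by blast
  qed
  have ball_image: "(M ^^ k) ` ball z r = ball ((M ^^ k) z) (c ^ k * r)" for k z r
  proof -
    have dist: "dist ((M ^^ k) x) ((M ^^ k) y) = c ^ k * dist x y" for x y
      unfolding dist_norm linear_diff[OF linp, symmetric] by (rule normp)
    show ?thesis
    proof (intro equalityI subsetI)
      fix y assume y: "y \<in> ball ((M ^^ k) z) (c ^ k * r)"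
      obtain x where x: "y = (M ^^ k) x" using bijp[of k] by (metis bij_pointE)
      then show "y \<in> (M ^^ k) ` ball z r" using y ck[of k] by (simp add: dist)
    qed (use ck[of k] in \<open>auto simp: dist\<close>)
  qed
  have vol_ball: "measure lebesgue ((M ^^ k) ` ball z r) = (c ^ k) ^ ?d * (?V * r ^ ?d)" if "r \<ge> 0" for k z r
    using that ck[of k] unfolding ball_image by (simp add: content_ball power_mult_distrib)
  define vol where "vol X = measure lebesgue X" for X :: "(real ^ 'n) set"
  have compact_image: "compact ((M ^^ k) ` supp t)" if "is_tile t" for k and t :: "('l, 'n) tile"
    using is_tileD(1)[OF that] linear_continuous_on[OF linp[unfolded linear_conv_bounded_linear]]
    by (rule compact_continuous_image[rotated])
  have open_image: "open ((M ^^ k) ` interior (supp t))" for k and t :: "('l, 'n) tile"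
    unfolding interior_bijective_linear_image[OF linp bijp, symmetric] by (rule open_interior)
  have compact_fm: "X \<in> lmeasurable" if "compact X" for X :: "(real ^ 'n) set"
    by (rule lmeasurable_compact) fact
  have open_fm: "X \<in> lmeasurable" if "open X" "X \<subseteq> K" "compact K" for X K :: "(real ^ 'n) set"
    using that bounded_subset[OF compact_imp_bounded[OF that(3)] that(2)] by (simp add: lmeasurable_open)
  \<comment> \<open>The division keeps \<open>v\<close> between bounds independent of
    \<open>k\<close> and \<open>u\<close> above such a bound, as the growth lemmas require.\<close>
  define v where "v k i = vol ((M ^^ k) ` interior (supp (ps ! i))) / (c ^ k) ^ ?d" for k i
  define u where "u k i = vol ((M ^^ k) ` supp (ps ! i)) / (c ^ k) ^ ?d" for k i
  have sub_int: "(M ^^ k) ` interior (supp t) \<subseteq> (M ^^ k) ` supp t" for k and t :: "('l, 'n) tile"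
    by (intro image_mono interior_subset)
  have "\<exists>r>0. \<exists>z. ball z r \<subseteq> interior (supp (ps ! i))" if i: "i < ?n" for i
  proof -
    obtain z where "z \<in> interior (supp (ps ! i))" using is_tileD(3)[OF tile[OF i]] by blast
    then show ?thesis using open_interior[of "supp (ps ! i)"] unfolding open_contains_ball by blast
  qed
  then obtain r z where r: "\<And>i. i < ?n \<Longrightarrow> r i > 0" "\<And>i. i < ?n \<Longrightarrow> ball (z i) (r i) \<subseteq> interior (supp (ps ! i))"
    by metis
  have "\<exists>R\<ge>0. supp (ps ! i) \<subseteq> ball 0 R" if "i < ?n" for i
    using compact_imp_bounded[OF is_tileD(1)[OF tile[OF that]]] bounded_subset_ballD[of _ 0] by (metis less_imp_le)
  then obtain R where R: "\<And>i. i < ?n \<Longrightarrow> R i \<ge> 0" "\<And>i. i < ?n \<Longrightarrow> supp (ps ! i) \<subseteq> ball 0 (R i)" by metis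
  have lower: "?V * r i ^ ?d \<le> v k i" if i: "i < ?n" for k i
  proof -
    have "vol ((M ^^ k) ` ball (z i) (r i)) \<le> vol ((M ^^ k) ` interior (supp (ps ! i)))"
      unfolding vol_def
    proof (rule measure_mono_fmeasurable)
      show "(M ^^ k) ` interior (supp (ps ! i)) \<in> lmeasurable"
        by (rule open_fm[OF open_image sub_int compact_image[OF tile[OF i]]])
      show "(M ^^ k) ` ball (z i) (r i) \<subseteq> (M ^^ k) ` interior (supp (ps ! i))" using r(2)[OF i] by blast
    qed (simp add: ball_image)
    then have "(c ^ k) ^ ?d * (?V * r i ^ ?d) \<le> vol ((M ^^ k) ` interior (supp (ps ! i)))"
      using vol_ball[of "r i" k "z i"] r(1)[OF i] unfolding vol_def by simp
    then show ?thesis unfolding v_def using ck[of k] by (simp add: pos_le_divide_eq mult.commute)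
  qed
  have vu: "v k i \<le> u k i" if i: "i < ?n" for k i
    unfolding v_def u_def vol_def
    using compact_fm[OF compact_image[OF tile[OF i]]] open_image ck[of k]
    by (intro divide_right_mono measure_mono_fmeasurable[OF sub_int]) auto
  have upper: "v k i \<le> ?V * R i ^ ?d" if i: "i < ?n" for k i
  proof -
    have "vol ((M ^^ k) ` interior (supp (ps ! i))) \<le> vol ((M ^^ k) ` ball 0 (R i))"
      unfolding vol_def
    proof (rule measure_mono_fmeasurable)
      show "(M ^^ k) ` interior (supp (ps ! i)) \<subseteq> (M ^^ k) ` ball 0 (R i)"
        using R(2)[OF i] interior_subset by blast
      show "(M ^^ k) ` ball 0 (R i) \<in> lmeasurable"
        unfolding ball_image by (rule open_fm[OF open_ball ball_subset_cball compact_cball])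
    qed (use open_image in simp)
    then have "vol ((M ^^ k) ` interior (supp (ps ! i))) \<le> (c ^ k) ^ ?d * (?V * R i ^ ?d)"
      using vol_ball[of "R i" k 0] R(1)[OF i] unfolding vol_def by simp
    then show ?thesis unfolding v_def using ck[of k] by (simp add: pos_divide_le_eq mult.commute)
  qed
  have inv: "vol ((M ^^ k) ` (\<lambda>x. x + w) ` X) = vol ((M ^^ k) ` X)" for k w X
  proof -
    have "(M ^^ k) ` (\<lambda>x. x + w) ` X = (+) ((M ^^ k) w) ` (M ^^ k) ` X"
      by (simp add: image_image linear_add[OF linp] add.commute)
    then show ?thesis unfolding vol_def by (simp add: measure_translation)
  qed
  have pow_Suc: "(M ^^ k) ` M ` X = (M ^^ Suc k) ` X" for k X
    by (simp add: image_comp funpow_swap1[symmetric] comp_def)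
  have rescale: "y / (c ^ k) ^ ?d = c ^ ?d * (y / (c ^ Suc k) ^ ?d)" for y k
    using c by (simp add: power_mult_distrib)
  \<comment> \<open>Inflated interiors are disjoint and lie in the interior of the next inflation,
    so their volumes add up to at most its volume.\<close>
  have step_v: "(\<Sum>j<?n. ?A $$ (i, j) * v k j) \<le> c ^ ?d * v (Suc k) i" if i: "i < ?n" for k i
  proof -
    let ?I = "\<lambda>t. (M ^^ k) ` interior (supp t)"
    have disj: "pairwise (\<lambda>t t'. disjnt (?I t) (?I t')) (S (ps ! i))"
    proof (rule pairwiseI)
      fix t t' assume "t \<in> S (ps ! i)" "t' \<in> S (ps ! i)" "t \<noteq> t'"
      then have "interior (supp t) \<inter> interior (supp t') = {}"
        using S(3)[OF i] unfolding disjoint_interiors_def by simp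
      then show "disjnt (?I t) (?I t')"
        using image_Int[OF bij_is_inj[OF bijp[of k]], of "interior (supp t)" "interior (supp t')"]
        by (simp add: disjnt_def)
    qed
    have "(\<Sum>j<?n. ?A $$ (i, j) * v k j) = (\<Sum>j<?n. ?A $$ (i, j) * vol (?I (ps ! j))) / (c ^ k) ^ ?d"
      by (simp add: v_def sum_divide_distrib)
    also have "(\<Sum>j<?n. ?A $$ (i, j) * vol (?I (ps ! j))) = (\<Sum>t\<in>S (ps ! i). vol (?I t))"
      by (rule sum_subst_matrix[OF sub i, of "\<lambda>t. vol (?I t)"]) (simp only: interior_supp_translate inv)
    also have "\<dots> = vol (\<Union>t\<in>S (ps ! i). ?I t)"
      unfolding vol_def
    proof (rule measure_UNION'[symmetric, OF S(1)[OF i] _ disj])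
      fix t assume "t \<in> S (ps ! i)"
      then show "?I t \<in> lmeasurable"
        by (intro open_fm[OF open_image sub_int compact_image] S(2)[OF i])
    qed
    also have "\<dots> \<le> vol ((M ^^ Suc k) ` interior (supp (ps ! i)))"
      unfolding vol_def
    proof (rule measure_mono_fmeasurable)
      show "(M ^^ Suc k) ` interior (supp (ps ! i)) \<in> lmeasurable"
        by (rule open_fm[OF open_image sub_int compact_image[OF tile[OF i]]])
      have "interior (supp t) \<subseteq> M ` interior (supp (ps ! i))" if "t \<in> S (ps ! i)" for t
      proof -
        have "interior (supp t) \<subseteq> interior (M ` supp (ps ! i))"
          unfolding S(4)[OF i, symmetric] using that by (intro interior_mono) blast
        also have "\<dots> = M ` interior (supp (ps ! i))"
          using interior_bijective_linear_image[OF linp bijp, of 1] by simp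
        finally show ?thesis .
      qed
      then show "(\<Union>t\<in>S (ps ! i). ?I t) \<subseteq> (M ^^ Suc k) ` interior (supp (ps ! i))"
        unfolding pow_Suc[symmetric] by blast
      show "(\<Union>t\<in>S (ps ! i). ?I t) \<in> sets lebesgue" using open_image by (simp add: open_UN)
    qed
    finally have "(\<Sum>j<?n. ?A $$ (i, j) * v k j) \<le> vol ((M ^^ Suc k) ` interior (supp (ps ! i))) / (c ^ k) ^ ?d"
      using ck[of k] by (simp add: divide_right_mono)
    then show ?thesis unfolding rescale[of _ k] v_def[of "Suc k"] .
  qed
  \<comment> \<open>Closed tiles cover the inflated tile but may overlap in positive measure;
    subadditivity allows for this.\<close>
  have step_u: "c ^ ?d * u (Suc k) i \<le> (\<Sum>j<?n. ?A $$ (i, j) * u k j)" if i: "i < ?n" for k i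
  proof -
    let ?I = "\<lambda>t. (M ^^ k) ` supp t"
    have "(M ^^ Suc k) ` supp (ps ! i) = (\<Union>t\<in>S (ps ! i). ?I t)"
      unfolding pow_Suc[symmetric] S(4)[OF i, symmetric] by blast
    then have "vol ((M ^^ Suc k) ` supp (ps ! i)) \<le> (\<Sum>t\<in>S (ps ! i). vol (?I t))"
      unfolding vol_def using compact_image[OF S(2)[OF i]] S(1)[OF i]
      by (simp only:) (intro measure_UNION_le, auto intro!: fmeasurableD compact_fm)
    also have "\<dots> = (\<Sum>j<?n. ?A $$ (i, j) * vol (?I (ps ! j)))"
      by (rule sum_subst_matrix[OF sub i, of "\<lambda>t. vol (?I t)", symmetric]) (simp only: supp_translate inv)
    finally have "vol ((M ^^ Suc k) ` supp (ps ! i)) / (c ^ k) ^ ?d \<le> (\<Sum>j<?n. ?A $$ (i, j) * vol (?I (ps ! j))) / (c ^ k) ^ ?d"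
      using ck[of k] by (simp add: divide_right_mono)
    also have "\<dots> = (\<Sum>j<?n. ?A $$ (i, j) * u k j)"
      by (simp add: u_def sum_divide_distrib)
    finally show ?thesis unfolding rescale[of _ k] u_def[of "Suc k"] .
  qed
  have A: "?A \<in> carrier_mat ?n ?n" by (simp add: subst_matrix_def)
  have nonneg: "?A $$ (i, j) \<ge> 0" if "i < ?n" "j < ?n" for i j using that by (simp add: subst_matrix_def)
  have l: "l > 0" "eigenvalue (map_mat complex_of_real ?A) (complex_of_real l)"
    "\<And>\<mu>. eigenvalue (map_mat complex_of_real ?A) \<mu> \<Longrightarrow> \<mu> \<noteq> complex_of_real l \<Longrightarrow> cmod \<mu> < l"
    using perron by (auto simp: perron_eigenvalue_def)
  have ev: "cmod \<mu> \<le> l" if "eigenvalue (map_mat complex_of_real ?A) \<mu>" for \<mu>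
    using l(3)[OF that] l(1) by (cases "\<mu> = complex_of_real l") auto
  have n: "?n > 0"
  proof (rule ccontr)
    assume "\<not> ?n > 0"
    then have "dim_row (map_mat complex_of_real ?A) = 0" using A by simp
    then show False using l(2) unfolding eigenvalue_def eigenvector_def by auto
  qed
  have low: "?V * r i ^ ?d > 0" if "i < ?n" for i using r(1)[OF that] by simp
  have "cmod (complex_of_real l) \<le> c ^ ?d"
    by (rule eigenvalue_le_growth[where v = v and b = "\<lambda>i. ?V * R i ^ ?d", OF A nonneg step_v _ upper _ l(2)])
       (use c low lower in \<open>auto intro: less_le_trans\<close>)
  moreover have "c ^ ?d \<le> l"
    by (rule growth_le_spectral_bound[where v = u and a = "\<lambda>i. ?V * r i ^ ?d", OF A nonneg step_u _ _ low n ev])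
       (use c l(1) order_trans[OF lower vu] in auto)
  ultimately show ?thesis using l(1) by simp
qed

section \<open>Multiplicative dependence\<close>

lemma tile_bounds_exist:
  assumes "prototile_set \<A>"
  shows "\<exists>\<delta> \<Delta>. tile_bounds \<A> \<delta> \<Delta>"
proof -
  obtain \<delta> \<Delta> where "\<delta> > 0" "\<Delta> > 0" and *: "\<forall>T\<in>tiling_space \<A>. \<forall>t\<in>T.
    (\<exists>z. ball z \<delta> \<subseteq> interior (supp t)) \<and> (\<forall>y\<in>supp t. \<forall>z\<in>supp t. dist y z < \<Delta>)"
    using prototile_bounds[OF assms] by (elim exE conjE)
  then have "tile_bounds \<A> \<delta> \<Delta>" by unfold_locales simp_all
  then show ?thesis by blast
qed

lemma self_similar_exist:
  assumes "self_similar_tiling M ps S T" and "primitive_substitution ps S"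
    and eq: "orbit_closure (set ps) T = substitution_space M ps S"
  shows "\<exists>\<delta> \<Delta> c. self_similar ps \<delta> \<Delta> M S T c"
proof -
  have sub: "substitution M ps S" and T: "T \<in> tiling_space (set ps)"
    using assms(1) by (simp_all add: self_similar_tiling_def)
  then have "prototile_set (set ps)" by (simp add: substitution_def)
  then obtain \<delta> \<Delta> where b: "tile_bounds (set ps) \<delta> \<Delta>" using tile_bounds_exist by blast
  have "\<exists>c>1. \<forall>v. norm (M v) = c * norm v" using sub by (simp add: substitution_def similarity_def)
  then obtain c where c: "c > 1" "\<And>v. norm (M v) = c * norm v" by blast
  have "T \<in> substitution_space M ps S"
    unfolding eq[symmetric] by (rule tile_bounds.orbit_closure_self[OF b T])
  then have "self_similar ps \<delta> \<Delta> M S T c"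
    by (intro self_similar.intro b self_similar_axioms.intro assms(1,2) c)
  then show ?thesis by blast
qed

context self_similar
begin

text \<open>The image \<open>\<pi> T\<close> may differ from \<open>Y\<close>, but every tiling in
  the orbit closure of \<open>Y\<close>, including \<open>Y\<close>, has the same patterns as
  \<open>\<pi> T\<close>. Aperiodicity passes from \<open>Y\<close> to \<open>\<pi> T\<close> in
  this way.\<close>

lemma factor_patterns:
  fixes \<B> :: "('k, 'n) tile set"
  assumes \<B>: "prototile_set \<B>" and Y: "Y \<in> tiling_space \<B>" "non_periodic Y"
    and fm: "factor_map (set ps) (orbit_closure (set ps) T) \<B> (orbit_closure \<B> Y) \<pi>"
  shows "\<exists>s. self_similar_factor (pat T) (pat (\<pi> T)) M c s 1 \<delta>"
    and "Z \<in> orbit_closure \<B> Y \<Longrightarrow> \<exists>x'. pat Z x r = pat (\<pi> T) x' r"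
    and "Z \<in> orbit_closure \<B> Y \<Longrightarrow> \<exists>x'. pat (\<pi> T) x r = pat Z x' r"
proof -
  obtain \<delta>' \<Delta>' where B: "tile_bounds \<B> \<delta>' \<Delta>'" using tile_bounds_exist[OF \<B>] by blast
  interpret B: tile_bounds \<B> \<delta>' \<Delta>' by (rule B)
  interpret F: tiling_factor "set ps" \<delta> \<Delta> \<B> \<delta>' \<Delta>' T Y \<pi>
    by (intro tiling_factor.intro tile_bounds_axioms B tiling_factor_axioms.intro T Y(1) fm recurrent
        finite_types[OF T fpc])
  have T\<Omega>: "T \<in> F.\<Omega>" by (rule orbit_closure_self[OF T])
  obtain s where s: "\<And>Z Z' x x' \<rho>. Z \<in> F.\<Omega> \<Longrightarrow> Z' \<in> F.\<Omega> \<Longrightarrow> pat Z x (\<rho> + s) = pat Z' x' (\<rho> + s) \<Longrightarrow>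
     \<exists>w. norm w < 1 \<and> pat (\<pi> Z) x \<rho> = pat (\<pi> Z') (x' + w) \<rho>"
    using F.local_code by blast
  have lift: "\<exists>Z'\<in>F.\<Omega>. Z = \<pi> Z'" if "Z \<in> orbit_closure \<B> Y" for Z
  proof -
    have "\<pi> ` F.\<Omega> = orbit_closure \<B> Y" using fm unfolding factor_map_def by (elim conjE)
    then show ?thesis using that by blast
  qed
  show sub: "\<exists>x'. pat Z x r = pat (\<pi> T) x' r" if Z: "Z \<in> orbit_closure \<B> Y" for Z x r
  proof -
    obtain Z' where Z': "Z' \<in> F.\<Omega>" "Z = \<pi> Z'" using lift[OF Z] by blast
    obtain x1 where "pat Z' x (r + s) = pat T x1 (r + s)" using orbit_closure_pat[OF T Z'(1)] by blast
    from s[OF Z'(1) T\<Omega> this] show ?thesis unfolding Z'(2) by blast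
  qed
  show "\<exists>x'. pat (\<pi> T) x r = pat Z x' r" if Z: "Z \<in> orbit_closure \<B> Y"
  proof -
    obtain Z' where Z': "Z' \<in> F.\<Omega>" "Z = \<pi> Z'" using lift[OF Z] by blast
    \<comment> \<open>Here recurrence is essential: any sufficiently large patch of
      \<open>T\<close>, and hence the one seen in \<open>Z'\<close>, contains the prescribed
      pattern.\<close>
    obtain L where L: "\<forall>y. \<exists>y'. dist y y' \<le> L \<and> pat T y' (r + s) = pat T x (r + s)"
      using recurrent[of "r + s" x] by blast
    obtain y0 where y0: "pat Z' 0 (r + s + L) = pat T y0 (r + s + L)"
      using orbit_closure_pat[OF T Z'(1)] by blast
    obtain y' where y': "dist y0 y' \<le> L" "pat T y' (r + s) = pat T x (r + s)" using L by blast
    have "pat Z' (0 + (y' - y0)) (r + s) = pat T (y0 + (y' - y0)) (r + s)"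
      by (rule pat_move[OF y0]) (use y'(1) in \<open>simp add: dist_norm norm_minus_commute\<close>)
    then have "pat T x (r + s) = pat Z' (y' - y0) (r + s)" using y'(2) by simp
    from s[OF T\<Omega> Z'(1) this] show ?thesis unfolding Z'(2) by blast
  qed
  \<comment> \<open>A large enough pattern of \<open>Y\<close> around \<open>x\<close>, found in
    \<open>\<pi> T\<close>, shows both \<open>x\<close> and \<open>x + u\<close>.\<close>
  have aper: "u = 0" if u: "\<And>x. pat (\<pi> T) x 1 = pat (\<pi> T) (x + u) 1" for u
  proof (rule non_periodic_pat[OF Y])
    fix x
    obtain x' where x': "pat Y x (1 + norm u) = pat (\<pi> T) x' (1 + norm u)"
      using sub[OF B.orbit_closure_self[OF Y(1)]] by blast
    have "pat Y x 1 = pat (\<pi> T) x' 1" by (rule pat_restrict[OF x']) simp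
    also have "\<dots> = pat (\<pi> T) (x' + u) 1" by (rule u)
    also have "\<dots> = pat Y (x + u) 1" by (rule pat_move[OF x'[symmetric]]) simp
    finally show "pat Y x 1 = pat Y (x + u) 1" .
  qed
  have "self_similar_factor (pat T) (pat (\<pi> T)) M c s 1 \<delta>"
  proof (intro self_similar_factor.intro pattern_map.intro self_similar_factor_axioms.intro)
    show "finite {pat T p r |p. pat T p 1 = pat T 0 1}" if "1 \<le> r" for r
      by (rule finite_types[OF T fpc that])
    show "\<exists>w. norm w < 1 \<and> pat (\<pi> T) x \<rho> = pat (\<pi> T) (x' + w) \<rho>"
      if "pat T x (\<rho> + s) = pat T x' (\<rho> + s)" for x x' \<rho>
      by (rule s[OF T\<Omega> T\<Omega> that])
  qed (fact pat_move c linear norm_M inflate recurrent pos(1) rigid[OF T] aper)+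
  then show "\<exists>s. self_similar_factor (pat T) (pat (\<pi> T)) M c s 1 \<delta>" by blast
qed

end

theorem theorem1:
  fixes M1 M2 :: "real ^ 'n::finite \<Rightarrow> real ^ 'n"
    and ps1 :: "('l1, 'n) tile list" and ps2 :: "('l2, 'n) tile list"
    and S1 :: "('l1, 'n) tile \<Rightarrow> ('l1, 'n) tile set"
    and S2 :: "('l2, 'n) tile \<Rightarrow> ('l2, 'n) tile set"
    and T1 :: "('l1, 'n) tile set" and T2 :: "('l2, 'n) tile set"
    and lambda1 lambda2 :: real
    and \<A> :: "('l, 'n) tile set" and T :: "('l, 'n) tile set"
    and \<pi>1 :: "('l1, 'n) tile set \<Rightarrow> ('l, 'n) tile set"
    and \<pi>2 :: "('l2, 'n) tile set \<Rightarrow> ('l, 'n) tile set"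
  assumes "self_similar_tiling M1 ps1 S1 T1"
    and "self_similar_tiling M2 ps2 S2 T2"
    and "primitive_substitution ps1 S1"
    and "primitive_substitution ps2 S2"
    and "orbit_closure (set ps1) T1 = substitution_space M1 ps1 S1"
    and "orbit_closure (set ps2) T2 = substitution_space M2 ps2 S2"
    and "perron_eigenvalue (subst_matrix ps1 S1) lambda1"
    and "perron_eigenvalue (subst_matrix ps2 S2) lambda2"
    and "prototile_set \<A>" and "T \<in> tiling_space \<A>" and "non_periodic T"
    and "factor_map (set ps1) (orbit_closure (set ps1) T1) \<A> (orbit_closure \<A> T) \<pi>1"
    and "factor_map (set ps2) (orbit_closure (set ps2) T2) \<A> (orbit_closure \<A> T) \<pi>2"
  shows "\<exists>n m :: nat. n > 0 \<and> m > 0 \<and> lambda1 ^ n = lambda2 ^ m"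
proof -
  let ?d = "DIM(real ^ 'n)"
  obtain \<delta>1 \<Delta>1 c1 where 1: "self_similar ps1 \<delta>1 \<Delta>1 M1 S1 T1 c1"
    using self_similar_exist[OF assms(1,3,5)] by blast
  obtain \<delta>2 \<Delta>2 c2 where 2: "self_similar ps2 \<delta>2 \<Delta>2 M2 S2 T2 c2"
    using self_similar_exist[OF assms(2,4,6)] by blast
  have sub: "substitution M1 ps1 S1" "substitution M2 ps2 S2"
    using assms(1,2) by (simp_all add: self_similar_tiling_def)
  have l1: "lambda1 = c1 ^ ?d"
    using perron_eigenvalue_similarity[OF sub(1) self_similar.norm_M[OF 1] self_similar.c[OF 1] assms(7)] .
  have l2: "lambda2 = c2 ^ ?d"
    using perron_eigenvalue_similarity[OF sub(2) self_similar.norm_M[OF 2] self_similar.c[OF 2] assms(8)] .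
  note f1 = self_similar.factor_patterns[OF 1 assms(9-12)]
  note f2 = self_similar.factor_patterns[OF 2 assms(9-11,13)]
  obtain s1 where s1: "self_similar_factor (pat T1) (pat (\<pi>1 T1)) M1 c1 s1 1 \<delta>1" using f1(1) by blast
  obtain s2 where s2: "self_similar_factor (pat T2) (pat (\<pi>2 T2)) M2 c2 s2 1 \<delta>2" using f2(1) by blast
  \<comment> \<open>Applied to \<open>\<pi>2 T2\<close>, the statements about the first factor say
    that the two images have the same patterns.\<close>
  have "T2 \<in> orbit_closure (set ps2) T2"
    unfolding assms(6) by (rule self_similar.T_in[OF 2])
  moreover have "\<pi>2 ` orbit_closure (set ps2) T2 = orbit_closure \<A> T"
    using assms(13) unfolding factor_map_def by (elim conjE)
  ultimately have "\<pi>2 T2 \<in> orbit_closure \<A> T" by blast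
  then show ?thesis
    unfolding l1 l2 by (intro multiplicative_dependence[OF s1 s2] f1(2,3) pat_move)
qed

end
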